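(* There is an algorithm that, for every $\epsilon>0$, given any instance of the lower-bounded min-sum-of-radii problem (defined in the context) that admits a feasible solution, returns a feasible solution of cost at most $\bigl(3.83+O(\epsilon)\bigr)\cdot O^*$, where $O^*$ is the optimal cost of the instance, and runs in time $n^{O(1/\epsilon)}$, where $n=|\mathcal F|+|\mathcal D|$.
   Context: Lower-bounded min-sum-of-radii: the input is a finite facility set $\mathcal F$ and a finite client set $\mathcal D$ in a common metric space with distances $c(i,j)$ for $i,j\in\mathcal F\cup\mathcal D$, nonnegative integer lower bounds $\{L_i\}_{i\in\mathcal F}$, and a positive integer $k$. A feasible solution is a pair $(S,\sigma)$ with $S\subseteq\mathcal F$, $|S|\le k$, and $\sigma:\mathcal D\to S$ such that $|\sigma^{-1}(i)|\ge L_i$ for all $i\in S$. Its cost is $\sum_{i\in S}\max_{j\in\sigma^{-1}(i)}c(i,j)$. The goal is to minimize the cost. *)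

theory Defs
  imports "HOL-Analysis.Abstract_Metric_Spaces"
begin

section \<open>Lower-bounded min-sum-of-radii\<close>

definition lbmsr_instance ::
  "'a set \<Rightarrow> 'a set \<Rightarrow> ('a \<Rightarrow> 'a \<Rightarrow> real) \<Rightarrow> ('a \<Rightarrow> nat) \<Rightarrow> nat \<Rightarrow> bool" where
  "lbmsr_instance F D c L k \<longleftrightarrow>
     finite F \<and> finite D \<and> Metric_space (F \<union> D) c \<and> k > 0"

definition cluster :: "'a set \<Rightarrow> ('a \<Rightarrow> 'a) \<Rightarrow> 'a \<Rightarrow> 'a set" where
  "cluster D \<sigma> i = {j \<in> D. \<sigma> j = i}"

definition feasible ::
  "'a set \<Rightarrow> 'a set \<Rightarrow> ('a \<Rightarrow> nat) \<Rightarrow> nat \<Rightarrow> 'a set \<Rightarrow> ('a \<Rightarrow> 'a) \<Rightarrow> bool" where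
  "feasible F D L k S \<sigma> \<longleftrightarrow>
     S \<subseteq> F \<and> card S \<le> k \<and> (\<forall>j\<in>D. \<sigma> j \<in> S) \<and> (\<forall>i\<in>S. L i \<le> card (cluster D \<sigma> i))"

text \<open>A facility with \<open>L i = 0\<close> may be opened without serving any client; its radius is then 0.\<close>

definition radius :: "'a set \<Rightarrow> ('a \<Rightarrow> 'a \<Rightarrow> real) \<Rightarrow> ('a \<Rightarrow> 'a) \<Rightarrow> 'a \<Rightarrow> real" where
  "radius D c \<sigma> i = (if cluster D \<sigma> i = {} then 0 else Max (c i ` cluster D \<sigma> i))"

definition cost :: "'a set \<Rightarrow> ('a \<Rightarrow> 'a \<Rightarrow> real) \<Rightarrow> 'a set \<Rightarrow> ('a \<Rightarrow> 'a) \<Rightarrow> real" where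
  "cost D c S \<sigma> = (\<Sum>i\<in>S. radius D c \<sigma> i)"

definition opt_cost ::
  "'a set \<Rightarrow> 'a set \<Rightarrow> ('a \<Rightarrow> 'a \<Rightarrow> real) \<Rightarrow> ('a \<Rightarrow> nat) \<Rightarrow> nat \<Rightarrow> real" where
  "opt_cost F D c L k = Inf {cost D c S \<sigma> | S \<sigma>. feasible F D L k S \<sigma>}"


section \<open>Algorithms: a structured real RAM\<close>

text \<open>
  Since distances are real numbers and running time is measured in the number of points only,
  algorithms are programs for a real RAM with unit-cost operations. Every program variable is an
  unbounded two-dimensional array, of natural numbers or of reals, indexed by computed natural
  numbers. Some restrictions keep unit cost from hiding work: natural numbers can only be
  added and (truncatedly) subtracted, there is no conversion (floor) from reals to naturals, and
  real constants of a program are limited to natural numbers.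
\<close>

type_synonym var = string

datatype nexp =
    NConst nat
  | NGet var nexp nexp
  | NAdd nexp nexp
  | NSub nexp nexp

datatype rexp =
    OfNat nexp
  | RGet var nexp nexp
  | RAdd rexp rexp
  | RSub rexp rexp
  | RMul rexp rexp
  | RDiv rexp rexp

datatype bexp =
    NLess nexp nexp
  | RLess rexp rexp
  | BNot bexp
  | BAnd bexp bexp

datatype com =
    Skip
  | NSet var nexp nexp nexp
  | RSet var nexp nexp rexp
  | Seq com com
  | Cond bexp com com
  | While bexp com

record state =
  nmem :: "var \<Rightarrow> nat \<Rightarrow> nat \<Rightarrow> nat"
  rmem :: "var \<Rightarrow> nat \<Rightarrow> nat \<Rightarrow> real"

primrec nval :: "nexp \<Rightarrow> state \<Rightarrow> nat" where
  "nval (NConst m) s = m"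
| "nval (NGet v a b) s = nmem s v (nval a s) (nval b s)"
| "nval (NAdd a b) s = nval a s + nval b s"
| "nval (NSub a b) s = nval a s - nval b s"

primrec rval :: "rexp \<Rightarrow> state \<Rightarrow> real" where
  "rval (OfNat a) s = real (nval a s)"
| "rval (RGet v a b) s = rmem s v (nval a s) (nval b s)"
| "rval (RAdd a b) s = rval a s + rval b s"
| "rval (RSub a b) s = rval a s - rval b s"
| "rval (RMul a b) s = rval a s * rval b s"
| "rval (RDiv a b) s = rval a s / rval b s"

primrec bval :: "bexp \<Rightarrow> state \<Rightarrow> bool" where
  "bval (NLess a b) s \<longleftrightarrow> nval a s < nval b s"
| "bval (RLess a b) s \<longleftrightarrow> rval a s < rval b s"
| "bval (BNot p) s \<longleftrightarrow> \<not> bval p s"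
| "bval (BAnd p q) s \<longleftrightarrow> bval p s \<and> bval q s"

text \<open>Evaluating an expression takes one time unit per node.\<close>

primrec ntime :: "nexp \<Rightarrow> nat" where
  "ntime (NConst m) = 1"
| "ntime (NGet v a b) = 1 + ntime a + ntime b"
| "ntime (NAdd a b) = 1 + ntime a + ntime b"
| "ntime (NSub a b) = 1 + ntime a + ntime b"

primrec rtime :: "rexp \<Rightarrow> nat" where
  "rtime (OfNat a) = 1 + ntime a"
| "rtime (RGet v a b) = 1 + ntime a + ntime b"
| "rtime (RAdd a b) = 1 + rtime a + rtime b"
| "rtime (RSub a b) = 1 + rtime a + rtime b"
| "rtime (RMul a b) = 1 + rtime a + rtime b"
| "rtime (RDiv a b) = 1 + rtime a + rtime b"

primrec btime :: "bexp \<Rightarrow> nat" where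
  "btime (NLess a b) = 1 + ntime a + ntime b"
| "btime (RLess a b) = 1 + rtime a + rtime b"
| "btime (BNot p) = 1 + btime p"
| "btime (BAnd p q) = 1 + btime p + btime q"

definition upd :: "(var \<Rightarrow> nat \<Rightarrow> nat \<Rightarrow> 'v) \<Rightarrow> var \<Rightarrow> nat \<Rightarrow> nat \<Rightarrow> 'v \<Rightarrow> var \<Rightarrow> nat \<Rightarrow> nat \<Rightarrow> 'v" where
  "upd m v x y z = m(v := (m v)(x := (m v x)(y := z)))"

text \<open>\<open>exec P s t s'\<close>: started in \<open>s\<close>, program \<open>P\<close> halts in \<open>s'\<close> after \<open>t\<close> time units.\<close>

inductive exec :: "com \<Rightarrow> state \<Rightarrow> nat \<Rightarrow> state \<Rightarrow> bool" where
  Skip: "exec Skip s 1 s"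
| NSet: "exec (NSet v a b e) s (1 + ntime a + ntime b + ntime e)
           (s\<lparr>nmem := upd (nmem s) v (nval a s) (nval b s) (nval e s)\<rparr>)"
| RSet: "exec (RSet v a b e) s (1 + ntime a + ntime b + rtime e)
           (s\<lparr>rmem := upd (rmem s) v (nval a s) (nval b s) (rval e s)\<rparr>)"
| Seq: "exec P s t s' \<Longrightarrow> exec Q s' u s'' \<Longrightarrow> exec (Seq P Q) s (t + u) s''"
| CondTrue: "bval p s \<Longrightarrow> exec P s t s' \<Longrightarrow> exec (Cond p P Q) s (1 + btime p + t) s'"
| CondFalse: "\<not> bval p s \<Longrightarrow> exec Q s t s' \<Longrightarrow> exec (Cond p P Q) s (1 + btime p + t) s'"
| WhileFalse: "\<not> bval p s \<Longrightarrow> exec (While p P) s (1 + btime p) s"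
| WhileTrue: "bval p s \<Longrightarrow> exec P s t s' \<Longrightarrow> exec (While p P) s' u s'' \<Longrightarrow>
    exec (While p P) s (1 + btime p + t + u) s''"

inductive_cases SkipE: "exec Skip s t s'"
inductive_cases NSetE: "exec (NSet v a b e) s t s'"
inductive_cases RSetE: "exec (RSet v a b e) s t s'"
inductive_cases SeqE: "exec (Seq P Q) s t s'"
inductive_cases CondE: "exec (Cond p P Q) s t s'"
inductive_cases WhileE: "exec (While p P) s t s'"

lemma exec_deterministic: "exec P s t s' \<Longrightarrow> exec P s u s'' \<Longrightarrow> u = t \<and> s'' = s'"
proof (induction arbitrary: u s'' rule: exec.induct)
  case Skip
  then show ?case by (elim SkipE) simp
next
  case NSet
  then show ?case by (elim NSetE) simp
next
  case RSet
  then show ?case by (elim RSetE) simp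
next
  case Seq
  from Seq.prems show ?case by (rule SeqE) (auto dest: Seq.IH)
next
  case CondTrue
  from CondTrue.prems show ?case by (rule CondE) (auto simp: CondTrue.hyps(1) dest!: CondTrue.IH)
next
  case CondFalse
  from CondFalse.prems show ?case by (rule CondE) (auto simp: CondFalse.hyps(1) dest!: CondFalse.IH)
next
  case WhileFalse
  from WhileFalse.prems show ?case by (rule WhileE) (auto simp: WhileFalse.hyps(1))
next
  case WhileTrue
  from WhileTrue.prems show ?case by (rule WhileE) (auto simp: WhileTrue.hyps(1) dest!: WhileTrue.IH)
qed


section \<open>Encoding of inputs and outputs\<close>

text \<open>
  Points are named by natural numbers; every finite instance has an isomorphic copy of this form,
  and names need not be consecutive. Besides \<open>eps\<close>, \<open>k\<close>, \<open>nF = |F|\<close> and \<open>nD = |D|\<close>, the memory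
  initially contains enumerations of \<open>F\<close> and \<open>D\<close>, the lower bounds, and the distances within
  \<open>F \<union> D\<close>. Scalars are stored at index \<open>(0, 0)\<close>, one-dimensional arrays in column 0, and all
  other cells are 0.
\<close>

definition input_nmem ::
  "nat set \<Rightarrow> nat set \<Rightarrow> (nat \<Rightarrow> nat) \<Rightarrow> nat \<Rightarrow> var \<Rightarrow> nat \<Rightarrow> nat \<Rightarrow> nat" where
  "input_nmem F D L k v x y =
    (if y \<noteq> 0 then 0
     else if v = ''k'' \<and> x = 0 then k
     else if v = ''nF'' \<and> x = 0 then card F
     else if v = ''nD'' \<and> x = 0 then card D
     else if v = ''F'' \<and> x < card F then sorted_list_of_set F ! x
     else if v = ''D'' \<and> x < card D then sorted_list_of_set D ! x
     else if v = ''L'' \<and> x \<in> F then L x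
     else 0)"

definition input_rmem ::
  "real \<Rightarrow> nat set \<Rightarrow> nat set \<Rightarrow> (nat \<Rightarrow> nat \<Rightarrow> real) \<Rightarrow> var \<Rightarrow> nat \<Rightarrow> nat \<Rightarrow> real" where
  "input_rmem \<epsilon> F D c v x y =
    (if v = ''eps'' \<and> x = 0 \<and> y = 0 then \<epsilon>
     else if v = ''c'' \<and> x \<in> F \<union> D \<and> y \<in> F \<union> D then c x y
     else 0)"

definition input_state ::
  "real \<Rightarrow> nat set \<Rightarrow> nat set \<Rightarrow> (nat \<Rightarrow> nat \<Rightarrow> real) \<Rightarrow> (nat \<Rightarrow> nat) \<Rightarrow> nat \<Rightarrow> state" where
  "input_state \<epsilon> F D c L k = \<lparr>nmem = input_nmem F D L k, rmem = input_rmem \<epsilon> F D c\<rparr>"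

definition output_S :: "state \<Rightarrow> nat set" where
  "output_S s = {i. nmem s ''S'' i 0 \<noteq> 0}"

definition output_sigma :: "state \<Rightarrow> nat \<Rightarrow> nat" where
  "output_sigma s j = nmem s ''sigma'' j 0"

end

theory Submission
  imports Defs
begin

text \<open>
  The ten largest balls of a solution are guessed, so that every other ball has a radius \<open>R\<close> that is at
  most a tenth of the guessed cost. The remaining clients are treated by a primal-dual method with a
  Lagrange multiplier \<open>lam\<close> for the number of facilities: a greedily chosen disjoint family of
  dual-tight balls pays for itself, meets the lower bounds by disjointness, and covers everything when
  its radii are tripled. Binary search on \<open>lam\<close> gives two such families \<open>A\<close> and \<open>B\<close>, with too many and
  with at most the allowed number of balls. Either \<open>B\<close> with tripled radii is cheap enough, or merging
  cheapest-first those balls of \<open>A\<close> that meet a common ball of \<open>B\<close> is; the last merge costs at most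
  \<open>7 R\<close>. The better of the two is within a factor 3.825, and the guess absorbs the additive terms.
  Since ten guessed balls suffice for the factor 3.83, the running time is polynomial and does not
  depend on the accuracy parameter.
\<close>

section \<open>Polynomial-time realizability\<close>

text \<open>The lower bounds are the obstacle: a facility may be opened only if enough clients are
  reserved for it, so two families cannot be rounded by picking centres from both at will. Every
  candidate therefore keeps balls of one disjoint family as cores, each reserved for its own centre,
  and only enlarges radii. The two families belong to different multipliers and hence to different
  duals. To compare both with one optimum these duals must be close. The sequential ascent has a
  Lipschitz constant of 2^q for q clients; this is exponential, but a number of halvings linear in q
  beats it. The family \<open>B\<close> is also enlarged by balls of \<open>A\<close>, until either
  the budget is used exactly, so that the multiplier terms of the packing bound cancel, or every
  ball of \<open>A\<close> meets one of \<open>B\<close>, so that no ball of \<open>A\<close>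
  outside the guess is left without a group. In the second case the convex weights that bring the
  two sizes to the budget cancel the multiplier. Every candidate is tested at run time, so wrong
  guesses do no harm and the cost analysis follows one correct guess only.\<close>

definition size_of :: "state \<Rightarrow> nat" where
  "size_of s = nmem s ''nF'' 0 0 + nmem s ''nD'' 0 0 + 2"

lemma size_of_ge_2: "2 \<le> size_of s"
  by (simp add: size_of_def)

text \<open>The summand 2 in \<open>size_of\<close> makes the base at least 2, so a sum of two
  powers fits under one more factor of the base. Every time bound can thus be a single power, of
  which only the exponent is tracked.\<close>

lemma pow_add_le:
  fixes N :: nat
  assumes "2 \<le> N" "t \<le> N ^ a" "u \<le> N ^ b"
  shows "t + u \<le> N ^ (a + b + 1)"
proof -
  have "t \<le> N ^ (a + b)" "u \<le> N ^ (a + b)"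
    using assms power_increasing[of a "a + b" N] power_increasing[of b "a + b" N] by linarith+
  then have "t + u \<le> 2 * N ^ (a + b)" by linarith
  also have "\<dots> \<le> N * N ^ (a + b)" using assms by (intro mult_right_mono) auto
  finally show ?thesis by simp
qed

lemma le_pow_self:
  fixes N :: nat
  assumes "2 \<le> N"
  shows "k \<le> N ^ k"
proof -
  have "k \<le> 2 ^ k" using less_exp[of k] by linarith
  also have "\<dots> \<le> N ^ k" using assms by (intro power_mono) auto
  finally show ?thesis .
qed

text \<open>The exact time is hidden behind an exponent, so that bounds compose by adding exponents.
  Below, the exponent is always chosen before the state.\<close>

definition runs :: "com \<Rightarrow> nat \<Rightarrow> state \<Rightarrow> state \<Rightarrow> bool" where
  "runs P c s s' \<longleftrightarrow> (\<exists>t. exec P s t s' \<and> t \<le> size_of s ^ c)"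

lemma runs_Seq:
  assumes "runs P c s s'" "runs Q c' s' s''" "size_of s' = size_of s"
  shows "runs (Seq P Q) (c + c' + 1) s s''"
  using assms exec.Seq pow_add_le[OF size_of_ge_2] unfolding runs_def by metis

lemma runs_Seq3:
  assumes "runs P c s s1" "runs Q b s1 s2" "runs R a s2 s3"
    "size_of s1 = size_of s" "size_of s2 = size_of s1"
  shows "runs (Seq (Seq P Q) R) (c + b + 1 + a + 1) s s3"
  using runs_Seq[OF runs_Seq[OF assms(1,2,4)] assms(3)] assms(4,5) by simp

lemma runs_Cond:
  assumes "runs (if bval p s then P else Q) c s s'"
  shows "runs (Cond p P Q) ((1 + btime p) + c + 1) s s'"
proof -
  obtain t where t: "exec (if bval p s then P else Q) s t s'" "t \<le> size_of s ^ c"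
    using assms by (auto simp: runs_def)
  have "exec (Cond p P Q) s (1 + btime p + t) s'"
    using t exec.CondTrue exec.CondFalse by (cases "bval p s") auto
  then show ?thesis
    using pow_add_le[OF size_of_ge_2 le_pow_self[OF size_of_ge_2] t(2)] unfolding runs_def by blast
qed

lemma runs_Cond_uniform:
  assumes "bval p s \<Longrightarrow> runs P c s s'" "\<not> bval p s \<Longrightarrow> runs Q c' s s'"
  shows "runs (Cond p P Q) ((1 + btime p) + (c + c') + 1) s s'"
proof (rule runs_Cond)
  have "size_of s ^ c \<le> size_of s ^ (c + c')" "size_of s ^ c' \<le> size_of s ^ (c + c')"
    using size_of_ge_2[of s] by (auto intro!: power_increasing)
  then show "runs (if bval p s then P else Q) (c + c') s s'"
    using assms unfolding runs_def by (auto intro: order_trans)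
qed

lemma runs_NSet:
  "runs (NSet v a b e) (1 + ntime a + ntime b + ntime e) s
     (s\<lparr>nmem := upd (nmem s) v (nval a s) (nval b s) (nval e s)\<rparr>)"
  unfolding runs_def using exec.NSet le_pow_self[OF size_of_ge_2] by blast

lemma runs_RSet:
  "runs (RSet v a b e) (1 + ntime a + ntime b + rtime e) s
     (s\<lparr>rmem := upd (rmem s) v (nval a s) (nval b s) (rval e s)\<rparr>)"
  unfolding runs_def using exec.RSet le_pow_self[OF size_of_ge_2] by blast

text \<open>The invariant carries the iteration number, which ties the guard to the count. The size
  is constant along the loop, so one bound \<open>N ^ c\<close> serves all rounds.\<close>

lemma runs_While:
  assumes body: "\<And>x s. x < n \<Longrightarrow> Inv x s \<Longrightarrow> \<exists>s'. runs B c s s' \<and> Inv (Suc x) s'"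
    and guard: "\<And>x s. x \<le> n \<Longrightarrow> Inv x s \<Longrightarrow> bval g s \<longleftrightarrow> x < n"
    and size: "\<And>x s. Inv x s \<Longrightarrow> size_of s = N"
    and n: "n \<le> N ^ b" and init: "Inv 0 s"
  shows "\<exists>s'. runs (While g B) (b + (1 + btime g + c + 1) + 1) s s' \<and> Inv n s'"
proof -
  let ?T = "1 + btime g + N ^ c"
  \<comment> \<open>Induction on the number j of iterations still to be done; the extra round pays
    for the final failing guard.\<close>
  have 1: "\<exists>t s'. exec (While g B) s t s' \<and> t \<le> Suc j * ?T \<and> Inv n s'"
    if "j \<le> n" "Inv (n - j) s" for j s
    using that
  proof (induction j arbitrary: s)
    case 0
    then have "\<not> bval g s" using guard[of n s] by simp
    then show ?case using 0 exec.WhileFalse by fastforce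
  next
    case (Suc j)
    then have g: "bval g s" using guard[of "n - Suc j" s] by simp
    obtain s' where s': "runs B c s s'" "Inv (Suc (n - Suc j)) s'"
      using body[of "n - Suc j" s] Suc.prems by auto
    then obtain t where t: "exec B s t s'" "t \<le> N ^ c"
      using size[OF Suc.prems(2)] by (auto simp: runs_def)
    have "Inv (n - j) s'" using s' Suc.prems by (simp add: Suc_diff_Suc)
    then obtain u s'' where u: "exec (While g B) s' u s''" "u \<le> Suc j * ?T" "Inv n s''"
      using Suc.IH[of s'] Suc.prems by auto
    have "exec (While g B) s (1 + btime g + t + u) s''" using exec.WhileTrue[OF g t(1) u(1)] .
    moreover have "1 + btime g + t + u \<le> Suc (Suc j) * ?T" using t u by simp
    ultimately show ?case using u by blast
  qed
  obtain t s' where t: "exec (While g B) s t s'" "t \<le> Suc n * ?T" "Inv n s'"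
    using 1[of n s] init by auto
  have N: "2 \<le> N" "size_of s = N" using size[OF init] size_of_ge_2[of s] by auto
  have "Suc n \<le> N ^ (b + 1)" using pow_add_le[OF N(1) n, of 1 0] by simp
  moreover have "?T \<le> N ^ (1 + btime g + c + 1)"
    using pow_add_le[OF N(1) le_pow_self[OF N(1)] order_refl] .
  ultimately have "Suc n * ?T \<le> N ^ (b + 1) * N ^ (1 + btime g + c + 1)" by (intro mult_mono) auto
  also have "\<dots> = N ^ (b + (1 + btime g + c + 1) + 1)" by (simp add: power_add)
  finally show ?thesis using t N unfolding runs_def by (auto intro: order_trans)
qed

text \<open>Temporaries live in the rows of the variable \<open>#\<close>, used as a stack; \<open>l\<close> is the stack level.\<close>

definition agree :: "nat \<Rightarrow> state \<Rightarrow> state \<Rightarrow> bool" where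
  "agree l a b \<longleftrightarrow> (\<forall>v i j. v \<noteq> ''#'' \<or> i < l \<longrightarrow>
     nmem a v i j = nmem b v i j \<and> rmem a v i j = rmem b v i j)"

text \<open>Finer than \<open>agree m\<close>: writing row m leaves the rows above it intact, so
  that operands stored there can still be read afterwards.\<close>

definition changes_only :: "nat \<Rightarrow> state \<Rightarrow> state \<Rightarrow> bool" where
  "changes_only m a b \<longleftrightarrow> (\<forall>v i j. v \<noteq> ''#'' \<or> i \<noteq> m \<longrightarrow>
     nmem a v i j = nmem b v i j \<and> rmem a v i j = rmem b v i j)"

lemma agree_refl [simp]: "agree l a a" by (simp add: agree_def)
lemma agree_trans: "agree l a b \<Longrightarrow> agree l b c \<Longrightarrow> agree l a c" by (simp add: agree_def)
lemma agree_mono: "agree l a b \<Longrightarrow> k \<le> l \<Longrightarrow> agree k a b"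
  unfolding agree_def by (meson less_le_trans)
lemma agree_changes_only: "changes_only m a b \<Longrightarrow> l \<le> m \<Longrightarrow> agree l a b"
  unfolding agree_def changes_only_def by (metis not_less)
lemma size_of_agree: "agree l a b \<Longrightarrow> size_of b = size_of a"
  by (simp add: agree_def size_of_def)
lemma size_of_changes_only: "changes_only m a b \<Longrightarrow> size_of b = size_of a"
  by (simp add: changes_only_def size_of_def)

definition ntmp :: "state \<Rightarrow> nat \<Rightarrow> nat" where "ntmp s m = nmem s ''#'' m 0"
definition rtmp :: "state \<Rightarrow> nat \<Rightarrow> real" where "rtmp s m = rmem s ''#'' m 0"
definition btmp :: "state \<Rightarrow> nat \<Rightarrow> bool" where "btmp s m \<longleftrightarrow> nmem s ''#'' m 0 \<noteq> 0"

definition reader :: "(state \<Rightarrow> nat \<Rightarrow> 'a) \<Rightarrow> bool" where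
  "reader T \<longleftrightarrow> (\<forall>a b m. (\<forall>j. nmem a ''#'' m j = nmem b ''#'' m j \<and> rmem a ''#'' m j = rmem b ''#'' m j)
     \<longrightarrow> T a m = T b m)"

lemma reader_tmp [simp]: "reader ntmp" "reader rtmp" "reader btmp"
  by (auto simp: reader_def ntmp_def rtmp_def btmp_def)

lemma reader_agree: "reader T \<Longrightarrow> agree l a b \<Longrightarrow> m < l \<Longrightarrow> T b m = T a m"
  unfolding reader_def agree_def by metis

lemma reader_changes_only: "reader T \<Longrightarrow> changes_only l a b \<Longrightarrow> m \<noteq> l \<Longrightarrow> T b m = T a m"
  unfolding reader_def changes_only_def by metis

definition writer :: "(state \<Rightarrow> nat \<Rightarrow> 'a) \<Rightarrow> nat \<Rightarrow> (state \<Rightarrow> 'a) \<Rightarrow> bool" where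
  "writer T m h \<longleftrightarrow> (\<exists>P c. \<forall>s. \<exists>s'. runs P c s s' \<and> changes_only m s s' \<and> T s' m = h s)"

lemma writer_ntmp: "(\<And>s. nval E s = h s) \<Longrightarrow> writer ntmp m h"
  unfolding writer_def changes_only_def ntmp_def
  by (rule exI[of _ "NSet ''#'' (NConst m) (NConst 0) E"])
     (fastforce intro: runs_NSet simp: upd_def)

lemma writer_rtmp: "(\<And>s. rval E s = h s) \<Longrightarrow> writer rtmp m h"
  unfolding writer_def changes_only_def rtmp_def
  by (rule exI[of _ "RSet ''#'' (NConst m) (NConst 0) E"])
     (fastforce intro: runs_RSet simp: upd_def)

lemma writer_btmp:
  assumes "\<And>s. bval p s = h s"
  shows "writer btmp m h"
proof -
  let ?S = "\<lambda>k. NSet ''#'' (NConst m) (NConst 0) (NConst k)"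
  let ?s = "\<lambda>s. s\<lparr>nmem := upd (nmem s) ''#'' m 0 (if h s then 1 else 0)\<rparr>"
  have "runs (Cond p (?S 1) (?S 0)) ((1 + btime p) + (4 + 4) + 1) s (?s s)" for s
    using runs_NSet[of "''#''" "NConst m" "NConst 0" "NConst 1" s]
      runs_NSet[of "''#''" "NConst m" "NConst 0" "NConst 0" s]
    by (intro runs_Cond_uniform) (auto simp: assms numeral_eq_Suc)
  moreover have "changes_only m s (?s s) \<and> btmp (?s s) m = h s" for s
    by (auto simp: changes_only_def btmp_def upd_def)
  ultimately show ?thesis unfolding writer_def by blast
qed

text \<open>The target row m is arbitrary above l, so that a subexpression can be evaluated at any
  height above the temporaries in use. The first conjunct forbids f to depend on rows from l
  on.\<close>

definition computable :: "(state \<Rightarrow> nat \<Rightarrow> 'a) \<Rightarrow> nat \<Rightarrow> (state \<Rightarrow> 'a) \<Rightarrow> bool" where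
  "computable T l f \<longleftrightarrow> (\<forall>a b. agree l a b \<longrightarrow> f a = f b) \<and>
     (\<forall>m\<ge>l. \<exists>P c. \<forall>s. \<exists>s'. runs P c s s' \<and> agree m s s' \<and> T s' m = f s)"

abbreviation "ne \<equiv> computable ntmp"
abbreviation "re \<equiv> computable rtmp"
abbreviation "be \<equiv> computable btmp"

lemma computable_mono: "computable T l f \<Longrightarrow> l \<le> k \<Longrightarrow> computable T k f"
  unfolding computable_def by (meson agree_mono order_trans)

lemma computable_resp: "computable T l f \<Longrightarrow> agree l a b \<Longrightarrow> f b = f a"
  unfolding computable_def by metis

lemma computableE:
  assumes "computable T l f" "l \<le> m"
  obtains P c where "\<And>s. \<exists>s'. runs P c s s' \<and> agree m s s' \<and> T s' m = f s"
  using assms unfolding computable_def by blast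

lemma writerE:
  assumes "writer T m h"
  obtains P c where "\<And>s. \<exists>s'. runs P c s s' \<and> changes_only m s s' \<and> T s' m = h s"
  using assms unfolding writer_def by blast

lemma computable_writer:
  assumes "\<And>a b. agree l a b \<Longrightarrow> h b = h a" "\<And>m. l \<le> m \<Longrightarrow> writer T m h"
  shows "computable T l h"
  unfolding computable_def
proof (intro conjI allI impI)
  fix m assume "l \<le> m"
  then obtain P c where "\<And>s. \<exists>s'. runs P c s s' \<and> changes_only m s s' \<and> T s' m = h s"
    using assms(2) writerE by metis
  then show "\<exists>P c. \<forall>s. \<exists>s'. runs P c s s' \<and> agree m s s' \<and> T s' m = h s"
    using agree_changes_only[of m _ _ m] by (intro exI[of _ P] exI[of _ c]) (metis order_refl)
qed (use assms(1) in metis)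

text \<open>Stack discipline: f is left in row m, g in row m + 1, and one instruction combines them
  in row m. Evaluating f may disturb rows from m on, to which g is insensitive.\<close>

lemma computable_binop:
  assumes f: "computable T1 l f" and g: "computable T2 l g" and T: "reader T1"
    and h: "\<And>m. writer T3 m (\<lambda>s. h (T1 s m) (T2 s (Suc m)))"
  shows "computable T3 l (\<lambda>s. h (f s) (g s))"
  unfolding computable_def
proof (intro conjI allI impI)
  fix a b assume "agree l a b"
  then show "h (f a) (g a) = h (f b) (g b)" using computable_resp f g by metis
next
  fix m assume m: "l \<le> m"
  obtain P c where P: "\<And>s. \<exists>s'. runs P c s s' \<and> agree m s s' \<and> T1 s' m = f s"
    using computableE[OF f m] by blast
  have "l \<le> Suc m" using m by simp
  then obtain Q b where Q: "\<And>s. \<exists>s'. runs Q b s s' \<and> agree (Suc m) s s' \<and> T2 s' (Suc m) = g s"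
    using computableE[OF g] by blast
  obtain W a where W: "\<And>s. \<exists>s'. runs W a s s' \<and> changes_only m s s' \<and> T3 s' m = h (T1 s m) (T2 s (Suc m))"
    using writerE[OF h[of m]] by blast
  show "\<exists>P c. \<forall>s. \<exists>s'. runs P c s s' \<and> agree m s s' \<and> T3 s' m = h (f s) (g s)"
  proof (rule exI, rule exI, rule allI)
    fix s
    obtain s1 where 1: "runs P c s s1" "agree m s s1" "T1 s1 m = f s" using P by blast
    obtain s2 where 2: "runs Q b s1 s2" "agree (Suc m) s1 s2" "T2 s2 (Suc m) = g s1" using Q by blast
    obtain s3 where 3: "runs W a s2 s3" "changes_only m s2 s3" "T3 s3 m = h (T1 s2 m) (T2 s2 (Suc m))"
      using W[of s2] by blast
    have "T1 s2 m = f s" using 1 2 T reader_agree by fastforce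
    moreover have "g s1 = g s" using computable_resp[OF g agree_mono[OF 1(2) m]] .
    moreover have "agree m s s3"
      by (rule agree_trans[OF agree_trans[OF 1(2) agree_mono[OF 2(2)]] agree_changes_only[OF 3(2)]]) auto
    ultimately have "runs (Seq (Seq P Q) W) (c + b + 1 + a + 1) s s3 \<and> agree m s s3 \<and> T3 s3 m = h (f s) (g s)"
      using runs_Seq3[OF 1(1) 2(1) 3(1) size_of_agree[OF 1(2)] size_of_agree[OF 2(2)]] 3(3) 2(3) by simp
    then show "\<exists>s'. runs (Seq (Seq P Q) W) (c + b + 1 + a + 1) s s' \<and> agree m s s' \<and> T3 s' m = h (f s) (g s)" by blast
  qed
qed

section \<open>Closure of computable expressions under memory access, arithmetic and logic\<close>

lemma ne_const: "ne l (\<lambda>s. k)"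
  by (rule computable_writer) (auto intro: writer_ntmp[of "NConst k"])

lemma ne_tmp: "i < l \<Longrightarrow> ne l (\<lambda>s. ntmp s i)"
  by (rule computable_writer) (auto intro: reader_agree writer_ntmp[of "NGet ''#'' (NConst i) (NConst 0)"] simp: ntmp_def agree_def)

text \<open>An array access combines the index with memory outside the stack, so it is not of the
  form \<open>h (T1 s m) (T2 s (Suc m))\<close> that \<open>computable_binop\<close> asks
  for.\<close>

lemma ne_get:
  assumes v: "v \<noteq> ''#''" and e: "ne l e"
  shows "ne l (\<lambda>s. nmem s v (e s) 0)"
  unfolding computable_def
proof (intro conjI allI impI)
  fix a b assume "agree l a b"
  then show "nmem a v (e a) 0 = nmem b v (e b) 0"
    using computable_resp[OF e] v by (metis agree_def)
next
  fix m assume m: "l \<le> m"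
  obtain P c where P: "\<And>s. \<exists>s'. runs P c s s' \<and> agree m s s' \<and> ntmp s' m = e s"
    using computableE[OF e m] by blast
  let ?W = "NSet ''#'' (NConst m) (NConst 0) (NGet v (NGet ''#'' (NConst m) (NConst 0)) (NConst 0))"
  show "\<exists>P c. \<forall>s. \<exists>s'. runs P c s s' \<and> agree m s s' \<and> ntmp s' m = nmem s v (e s) 0"
  proof (rule exI, rule exI, rule allI)
    fix s
    obtain s1 where 1: "runs P c s s1" "agree m s s1" "ntmp s1 m = e s" using P by blast
    let ?s = "s1\<lparr>nmem := upd (nmem s1) ''#'' m 0 (nmem s1 v (ntmp s1 m) 0)\<rparr>"
    have 2: "runs ?W 8 s1 ?s"
      using runs_NSet[of "''#''" "NConst m" "NConst 0" "NGet v (NGet ''#'' (NConst m) (NConst 0)) (NConst 0)" s1]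
      by (simp add: ntmp_def numeral_eq_Suc)
    have "agree m s1 ?s" by (auto simp: agree_def upd_def)
    moreover have "ntmp ?s m = nmem s v (e s) 0" using 1 v by (simp add: ntmp_def upd_def agree_def)
    ultimately have "runs (Seq P ?W) (c + 8 + 1) s ?s \<and> agree m s ?s \<and> ntmp ?s m = nmem s v (e s) 0"
      using runs_Seq[OF 1(1) 2 size_of_agree[OF 1(2)]] 1(2) agree_trans by blast
    then show "\<exists>s'. runs (Seq P ?W) (c + 8 + 1) s s' \<and> agree m s s' \<and> ntmp s' m = nmem s v (e s) 0" by blast
  qed
qed

lemma re_get:
  assumes v: "v \<noteq> ''#''" and e: "ne l e" and f: "ne l f"
  shows "re l (\<lambda>s. rmem s v (e s) (f s))"
  unfolding computable_def
proof (intro conjI allI impI)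
  fix a b assume "agree l a b"
  then show "rmem a v (e a) (f a) = rmem b v (e b) (f b)"
    using computable_resp[OF e] computable_resp[OF f] v by (metis agree_def)
next
  fix m assume m: "l \<le> m"
  obtain P c where P: "\<And>s. \<exists>s'. runs P c s s' \<and> agree m s s' \<and> ntmp s' m = e s"
    using computableE[OF e m] by blast
  have "l \<le> Suc m" using m by simp
  then obtain Q b where Q: "\<And>s. \<exists>s'. runs Q b s s' \<and> agree (Suc m) s s' \<and> ntmp s' (Suc m) = f s"
    using computableE[OF f] by blast
  let ?E = "RGet v (NGet ''#'' (NConst m) (NConst 0)) (NGet ''#'' (NConst (Suc m)) (NConst 0))"
  let ?W = "RSet ''#'' (NConst m) (NConst 0) ?E"
  show "\<exists>P c. \<forall>s. \<exists>s'. runs P c s s' \<and> agree m s s' \<and> rtmp s' m = rmem s v (e s) (f s)"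
  proof (rule exI, rule exI, rule allI)
    fix s
    obtain s1 where 1: "runs P c s s1" "agree m s s1" "ntmp s1 m = e s" using P by blast
    obtain s2 where 2: "runs Q b s1 s2" "agree (Suc m) s1 s2" "ntmp s2 (Suc m) = f s1" using Q by blast
    let ?s = "s2\<lparr>rmem := upd (rmem s2) ''#'' m 0 (rmem s2 v (ntmp s2 m) (ntmp s2 (Suc m)))\<rparr>"
    have 3: "runs ?W 10 s2 ?s"
      using runs_RSet[of "''#''" "NConst m" "NConst 0" ?E s2] by (simp add: ntmp_def numeral_eq_Suc)
    have 4: "ntmp s2 m = e s" "f s1 = f s"
      using 1 2 reader_agree[of ntmp "Suc m" s1 s2 m] computable_resp[OF f agree_mono[OF 1(2) m]] by auto
    have 5: "agree m s s2" using agree_trans[OF 1(2) agree_mono[OF 2(2), of m]] by simp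
    have "agree m s2 ?s" by (auto simp: agree_def upd_def)
    moreover have "rtmp ?s m = rmem s v (e s) (f s)"
      using 2 4 5 v by (simp add: rtmp_def upd_def agree_def)
    ultimately have "runs (Seq (Seq P Q) ?W) (c + b + 1 + 10 + 1) s ?s \<and> agree m s ?s \<and> rtmp ?s m = rmem s v (e s) (f s)"
      using runs_Seq3[OF 1(1) 2(1) 3 size_of_agree[OF 1(2)] size_of_agree[OF 2(2)]] agree_trans[OF 5] by blast
    then show "\<exists>s'. runs (Seq (Seq P Q) ?W) (c + b + 1 + 10 + 1) s s' \<and> agree m s s' \<and> rtmp s' m = rmem s v (e s) (f s)" by blast
  qed
qed

abbreviation (input) "tN m \<equiv> NGet ''#'' (NConst m) (NConst 0)"
abbreviation (input) "tR m \<equiv> RGet ''#'' (NConst m) (NConst 0)"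

lemma ne_add: "ne l f \<Longrightarrow> ne l g \<Longrightarrow> ne l (\<lambda>s. f s + g s)"
  by (rule computable_binop[where h = "(+)"]) (auto intro!: writer_ntmp[of "NAdd (tN m) (tN (Suc m))" for m] simp: ntmp_def)

lemma ne_diff: "ne l f \<Longrightarrow> ne l g \<Longrightarrow> ne l (\<lambda>s. f s - g s)"
  by (rule computable_binop[where h = "(-)"]) (auto intro!: writer_ntmp[of "NSub (tN m) (tN (Suc m))" for m] simp: ntmp_def)

text \<open>A unary operation is obtained from the binary rule by supplying the operand twice and
  ignoring the second copy; \<open>be_not\<close> is obtained in the same way.\<close>

lemma re_of_nat: "ne l f \<Longrightarrow> re l (\<lambda>s. real (f s))"
  by (rule computable_binop[of ntmp l f ntmp f, where h = "\<lambda>x y. real x"])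
     (auto intro!: writer_rtmp[of "OfNat (tN m)" for m] simp: ntmp_def)

lemma re_numeral: "re l (\<lambda>s. 0)" "re l (\<lambda>s. 1)" "re l (\<lambda>s. numeral w)"
  using re_of_nat[OF ne_const, of l 0] re_of_nat[OF ne_const, of l 1]
    re_of_nat[OF ne_const, of l "numeral w"] by simp_all

lemma re_add: "re l f \<Longrightarrow> re l g \<Longrightarrow> re l (\<lambda>s. f s + g s)"
  by (rule computable_binop[where h = "(+)"]) (auto intro!: writer_rtmp[of "RAdd (tR m) (tR (Suc m))" for m] simp: rtmp_def)

lemma re_diff: "re l f \<Longrightarrow> re l g \<Longrightarrow> re l (\<lambda>s. f s - g s)"
  by (rule computable_binop[where h = "(-)"]) (auto intro!: writer_rtmp[of "RSub (tR m) (tR (Suc m))" for m] simp: rtmp_def)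

lemma re_mult: "re l f \<Longrightarrow> re l g \<Longrightarrow> re l (\<lambda>s. f s * g s)"
  by (rule computable_binop[where h = "(*)"]) (auto intro!: writer_rtmp[of "RMul (tR m) (tR (Suc m))" for m] simp: rtmp_def)

lemma re_divide: "re l f \<Longrightarrow> re l g \<Longrightarrow> re l (\<lambda>s. f s / g s)"
  by (rule computable_binop[where h = "(/)"]) (auto intro!: writer_rtmp[of "RDiv (tR m) (tR (Suc m))" for m] simp: rtmp_def)

lemma be_less: "ne l f \<Longrightarrow> ne l g \<Longrightarrow> be l (\<lambda>s. f s < g s)"
  by (rule computable_binop[where h = "(<)"]) (auto intro!: writer_btmp[of "NLess (tN m) (tN (Suc m))" for m] simp: ntmp_def)

lemma be_less_real: "re l f \<Longrightarrow> re l g \<Longrightarrow> be l (\<lambda>s. f s < g s)"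
  by (rule computable_binop[where h = "(<)"]) (auto intro!: writer_btmp[of "RLess (tR m) (tR (Suc m))" for m] simp: rtmp_def)

abbreviation (input) "tB m \<equiv> NLess (NConst 0) (tN m)"

lemma be_conj: "be l f \<Longrightarrow> be l g \<Longrightarrow> be l (\<lambda>s. f s \<and> g s)"
  by (rule computable_binop[where h = "(\<and>)"]) (auto intro!: writer_btmp[of "BAnd (tB m) (tB (Suc m))" for m] simp: btmp_def)

lemma be_not: "be l f \<Longrightarrow> be l (\<lambda>s. \<not> f s)"
  by (rule computable_binop[of btmp l f btmp f, where h = "\<lambda>x y. \<not> x"])
     (auto intro!: writer_btmp[of "BNot (tB m)" for m] simp: btmp_def)

lemma be_disj: "be l f \<Longrightarrow> be l g \<Longrightarrow> be l (\<lambda>s. f s \<or> g s)"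
  using be_not[OF be_conj[OF be_not be_not]] by simp

lemma be_imp: "be l f \<Longrightarrow> be l g \<Longrightarrow> be l (\<lambda>s. f s \<longrightarrow> g s)"
  using be_not[OF be_conj[OF _ be_not]] by simp

lemma be_le: "ne l f \<Longrightarrow> ne l g \<Longrightarrow> be l (\<lambda>s. f s \<le> g s)"
  using be_not[OF be_less, of l g f] by (simp add: not_less)

lemma be_le_real: "re l f \<Longrightarrow> re l g \<Longrightarrow> be l (\<lambda>s. f s \<le> g s)"
  using be_not[OF be_less_real, of l g f] by (simp add: not_less)

lemma be_eq: "ne l f \<Longrightarrow> ne l g \<Longrightarrow> be l (\<lambda>s. f s = g s)"
  using be_conj[OF be_le be_le, of l f g g f] by (simp add: eq_iff)

lemma be_eq_real: "re l f \<Longrightarrow> re l g \<Longrightarrow> be l (\<lambda>s. f s = g s)"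
  using be_conj[OF be_le_real be_le_real, of l f g g f] by (simp add: eq_iff)

lemma computable_if:
  assumes b: "be l b" and f: "computable T l f" and g: "computable T l g"
  shows "computable T l (\<lambda>s. if b s then f s else g s)"
  unfolding computable_def
proof (intro conjI allI impI)
  fix a b' assume "agree l a b'"
  then show "(if b a then f a else g a) = (if b b' then f b' else g b')"
    using computable_resp b f g by metis
next
  fix m assume m: "l \<le> m"
  obtain B cb where B: "\<And>s. \<exists>s'. runs B cb s s' \<and> agree m s s' \<and> btmp s' m = b s"
    using computableE[OF b m] by blast
  obtain P c where P: "\<And>s. \<exists>s'. runs P c s s' \<and> agree m s s' \<and> T s' m = f s"
    using computableE[OF f m] by blast
  obtain Q c' where Q: "\<And>s. \<exists>s'. runs Q c' s s' \<and> agree m s s' \<and> T s' m = g s"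
    using computableE[OF g m] by blast
  show "\<exists>P c. \<forall>s. \<exists>s'. runs P c s s' \<and> agree m s s' \<and> T s' m = (if b s then f s else g s)"
  proof (rule exI, rule exI, rule allI)
    fix s
    obtain s1 where 1: "runs B cb s s1" "agree m s s1" "btmp s1 m = b s" using B by blast
    have r: "f s1 = f s" "g s1 = g s" using computable_resp[OF _ agree_mono[OF 1(2) m]] f g by auto
    obtain s2 where 2: "b s \<Longrightarrow> runs P c s1 s2" "\<not> b s \<Longrightarrow> runs Q c' s1 s2" "agree m s1 s2"
        "T s2 m = (if b s then f s else g s)"
      using P[of s1] Q[of s1] r by metis
    have "bval (tB m) s1 = b s" using 1 by (simp add: btmp_def)
    then have "runs (Cond (tB m) P Q) (1 + btime (tB m) + (c + c') + 1) s1 s2"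
      using runs_Cond_uniform 2 by blast
    then have "runs (Seq B (Cond (tB m) P Q)) (cb + (1 + btime (tB m) + (c + c') + 1) + 1) s s2 \<and>
        agree m s s2 \<and> T s2 m = (if b s then f s else g s)"
      using runs_Seq[OF 1(1) _ size_of_agree[OF 1(2)]] agree_trans[OF 1(2) 2(3)] 2(4) by blast
    then show "\<exists>s'. runs (Seq B (Cond (tB m) P Q)) (cb + (1 + btime (tB m) + (c + c') + 1) + 1) s s' \<and> agree m s s' \<and> T s' m = (if b s then f s else g s)" by blast
  qed
qed

definition bnd :: "(state \<Rightarrow> nat) \<Rightarrow> bool" where
  "bnd n \<longleftrightarrow> (\<exists>b. \<forall>s. n s \<le> size_of s ^ b)"

text \<open>In the hypothesis on \<open>g\<close>, the loop index is an arbitrary computable \<open>e\<close>: it is instantiated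
  with a constant, to see that \<open>g\<close> does not depend on temporaries, and with the loop counter.\<close>

lemma computable_fold:
  assumes n: "ne l n" "bnd n"
    and g: "\<And>i e. l \<le> i \<Longrightarrow> ne i e \<Longrightarrow> computable T i (\<lambda>s. g s (e s))"
    and T3: "reader T3" and init: "\<And>m. writer T3 m (\<lambda>s. z)"
    and step: "\<And>m. writer T3 m (\<lambda>s. h (T3 s m) (T s (m + 3)))"
  shows "computable T3 l (\<lambda>s. fold (\<lambda>x a. h a (g s x)) [0..<n s] z)"
proof -
  have gr: "g b x = g a x" if "agree l a b" for a b x
    using computable_resp[OF g[OF order_refl ne_const[of l x]] that] .
  have nr: "n b = n a" if "agree l a b" for a b
    using computable_resp[OF n(1) that] .
  show ?thesis
    unfolding computable_def
  proof (intro conjI allI impI)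
    fix a b assume ab: "agree l a b"
    have "g b = g a" using gr[OF ab] by blast
    then show "fold (\<lambda>x c. h c (g a x)) [0..<n a] z = fold (\<lambda>x c. h c (g b x)) [0..<n b] z"
      using nr[OF ab] by simp
  next
    fix m assume m: "l \<le> m"
    \<comment> \<open>Stack layout: row m holds the accumulator, m + 1 the loop bound, m + 2 the
      counter and m + 3 the current term. The program for g starts at row m + 3 and therefore
      preserves the other three.\<close>
    have "l \<le> Suc m" using m by simp
    then obtain Pn cn where Pn: "\<And>s. \<exists>s'. runs Pn cn s s' \<and> agree (Suc m) s s' \<and> ntmp s' (Suc m) = n s"
      using computableE[OF n(1)] by blast
    obtain Pi ci where Pi: "\<And>s. \<exists>s'. runs Pi ci s s' \<and> changes_only m s s' \<and> T3 s' m = z"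
      using writerE[OF init[of m]] by blast
    have W: "writer ntmp (m + 2) (\<lambda>s. 0)" by (rule writer_ntmp[of "NConst 0"]) simp
    obtain Pz cz where Pz: "\<And>s. \<exists>s'. runs Pz cz s s' \<and> changes_only (m + 2) s s' \<and> ntmp s' (m + 2) = 0"
      using writerE[OF W] by blast
    have "computable T (m + 3) (\<lambda>s. g s (ntmp s (m + 2)))" using m by (intro g ne_tmp) auto
    then obtain Pg cg where Pg: "\<And>s. \<exists>s'. runs Pg cg s s' \<and> agree (m + 3) s s' \<and> T s' (m + 3) = g s (ntmp s (m + 2))"
      using computableE[OF _ order_refl] by blast
    obtain Ps cs where Ps: "\<And>s. \<exists>s'. runs Ps cs s s' \<and> changes_only m s s' \<and> T3 s' m = h (T3 s m) (T s (m + 3))"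
      using writerE[OF step[of m]] by blast
    have W: "writer ntmp (m + 2) (\<lambda>s. Suc (ntmp s (m + 2)))"
      by (rule writer_ntmp[of "NAdd (tN (m + 2)) (NConst 1)"]) (simp add: ntmp_def)
    obtain Pc cc where Pc: "\<And>s. \<exists>s'. runs Pc cc s s' \<and> changes_only (m + 2) s s' \<and> ntmp s' (m + 2) = Suc (ntmp s (m + 2))"
      using writerE[OF W] by blast
    obtain b where b: "\<And>s. n s \<le> size_of s ^ b" using n(2) unfolding bnd_def by blast
    let ?g = "NLess (tN (m + 2)) (tN (Suc m))"
    let ?B = "Seq (Seq Pg Ps) Pc"
    let ?c = "cg + cs + 1 + cc + 1"
    let ?cw = "b + (1 + btime ?g + ?c + 1) + 1"
    let ?f = "\<lambda>s x. fold (\<lambda>x a. h a (g s x)) [0..<x] z"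
    show "\<exists>P c. \<forall>s. \<exists>s'. runs P c s s' \<and> agree m s s' \<and> T3 s' m = ?f s (n s)"
    proof (rule exI, rule exI, rule allI)
      fix s
      define Inv where "Inv = (\<lambda>x \<sigma>. agree m s \<sigma> \<and> ntmp \<sigma> (Suc m) = n s \<and> ntmp \<sigma> (m + 2) = x \<and> T3 \<sigma> m = ?f s x)"
      obtain s1 where 1: "runs Pn cn s s1" "agree (Suc m) s s1" "ntmp s1 (Suc m) = n s" using Pn by blast
      obtain s2 where 2: "runs Pi ci s1 s2" "changes_only m s1 s2" "T3 s2 m = z" using Pi by blast
      obtain s3 where 3: "runs Pz cz s2 s3" "changes_only (m + 2) s2 s3" "ntmp s3 (m + 2) = 0" using Pz by blast
      have r: "runs (Seq (Seq Pn Pi) Pz) (cn + ci + 1 + cz + 1) s s3"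
        by (rule runs_Seq3[OF 1(1) 2(1) 3(1) size_of_agree[OF 1(2)] size_of_changes_only[OF 2(2)]])
      have "agree m s s3"
        using agree_mono[OF 1(2), of m] agree_changes_only[OF 2(2), of m] agree_changes_only[OF 3(2), of m]
        by (meson agree_trans le_add1 lessI order_refl less_imp_le)
      moreover have "T3 s3 m = z" "ntmp s3 (Suc m) = n s"
        using 1 2 3 T3 reader_changes_only[of T3 "m + 2" s2 s3 m] reader_changes_only[of ntmp "m + 2" s2 s3 "Suc m"]
          reader_changes_only[of ntmp m s1 s2 "Suc m"] by auto
      ultimately have i0: "Inv 0 s3" using 3 by (simp add: Inv_def)
      have body: "\<exists>\<sigma>'. runs ?B ?c \<sigma> \<sigma>' \<and> Inv (Suc x) \<sigma>'" if "Inv x \<sigma>" for x \<sigma>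
      proof -
        have I: "agree m s \<sigma>" "ntmp \<sigma> (Suc m) = n s" "ntmp \<sigma> (m + 2) = x" "T3 \<sigma> m = ?f s x"
          using that by (auto simp: Inv_def)
        obtain a1 where 1: "runs Pg cg \<sigma> a1" "agree (m + 3) \<sigma> a1" "T a1 (m + 3) = g \<sigma> (ntmp \<sigma> (m + 2))" using Pg by blast
        obtain a2 where 2: "runs Ps cs a1 a2" "changes_only m a1 a2" "T3 a2 m = h (T3 a1 m) (T a1 (m + 3))" using Ps by blast
        obtain a3 where 3: "runs Pc cc a2 a3" "changes_only (m + 2) a2 a3" "ntmp a3 (m + 2) = Suc (ntmp a2 (m + 2))" using Pc by blast
        have r: "runs ?B ?c \<sigma> a3" 
        by (rule runs_Seq3[OF 1(1) 2(1) 3(1) size_of_agree[OF 1(2)] size_of_changes_only[OF 2(2)]])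
        have a: "agree m s a3"
          using I(1) agree_mono[OF 1(2), of m] agree_changes_only[OF 2(2), of m] agree_changes_only[OF 3(2), of m]
          by (meson agree_trans le_add1 order_refl)
        have "T3 a3 m = h (T3 \<sigma> m) (g \<sigma> x)"
          using 1 2 3 I T3 reader_changes_only[of T3 "m + 2" a2 a3 m] reader_agree[of T3 "m + 3" \<sigma> a1 m] by simp
        also have "\<dots> = ?f s (Suc x)" using I gr[OF agree_mono[OF I(1) m]] by simp
        finally have t: "T3 a3 m = ?f s (Suc x)" .
        have "ntmp a3 (Suc m) = n s" "ntmp a3 (m + 2) = Suc x"
          using I 3 reader_changes_only[of ntmp "m + 2" a2 a3 "Suc m"] reader_changes_only[of ntmp m a1 a2 "Suc m"]
            reader_changes_only[of ntmp m a1 a2 "m + 2"] reader_agree[of ntmp "m + 3" \<sigma> a1 "Suc m"]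
            reader_agree[of ntmp "m + 3" \<sigma> a1 "m + 2"] 1(2) 2(2) by auto
        then show ?thesis using r a t by (auto simp: Inv_def)
      qed
      have "\<exists>s'. runs (While ?g ?B) ?cw s3 s' \<and> Inv (n s) s'"
      proof (rule runs_While[where N = "size_of s"])
        show "\<And>x \<sigma>. x \<le> n s \<Longrightarrow> Inv x \<sigma> \<Longrightarrow> bval ?g \<sigma> = (x < n s)" by (auto simp: Inv_def ntmp_def)
        show "\<And>x \<sigma>. Inv x \<sigma> \<Longrightarrow> size_of \<sigma> = size_of s" using size_of_agree by (auto simp: Inv_def)
      qed (use body b i0 in auto)
      then obtain s' where s': "runs (While ?g ?B) ?cw s3 s'" "Inv (n s) s'" by blast
      have "size_of s3 = size_of s" using i0 size_of_agree by (auto simp: Inv_def)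
      then have "runs (Seq (Seq (Seq Pn Pi) Pz) (While ?g ?B)) (cn + ci + 1 + cz + 1 + ?cw + 1) s s'"
        using runs_Seq[OF r s'(1)] by simp
      moreover have "agree m s s' \<and> T3 s' m = ?f s (n s)" using s'(2) by (auto simp: Inv_def)
      ultimately have "runs (Seq (Seq (Seq Pn Pi) Pz) (While ?g ?B)) (cn + ci + 1 + cz + 1 + ?cw + 1) s s' \<and>
          agree m s s' \<and> T3 s' m = ?f s (n s)" by blast
      then show "\<exists>s'. runs (Seq (Seq (Seq Pn Pi) Pz) (While ?g ?B)) (cn + ci + 1 + cz + 1 + ?cw + 1) s s' \<and> agree m s s' \<and> T3 s' m = ?f s (n s)" by blast
    qed
  qed
qed

lemma fold_add_eq_sum:
  fixes f :: "nat \<Rightarrow> 'a::comm_monoid_add"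
  shows "fold (\<lambda>x a. a + f x) [0..<n] 0 = (\<Sum>x<n. f x)"
  by (induction n) auto

lemma fold_conj_eq_all: "fold (\<lambda>x a. a \<and> f x) [0..<n] True = (\<forall>x<n. f x)"
  by (induction n) (auto simp: less_Suc_eq)

lemma ne_sum:
  assumes "ne l n" "bnd n" "\<And>i e. l \<le> i \<Longrightarrow> ne i e \<Longrightarrow> ne i (\<lambda>s. g s (e s))"
  shows "ne l (\<lambda>s. \<Sum>x<n s. g s x)"
  unfolding fold_add_eq_sum[symmetric]
  by (rule computable_fold[where h = "(+)", OF assms])
     (auto intro: writer_ntmp[of "NConst 0"] writer_ntmp[of "NAdd (tN m) (tN (m + 3))" for m] simp: ntmp_def)

lemma re_sum:
  assumes "ne l n" "bnd n" "\<And>i e. l \<le> i \<Longrightarrow> ne i e \<Longrightarrow> re i (\<lambda>s. g s (e s))"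
  shows "re l (\<lambda>s. \<Sum>x<n s. g s x)"
  unfolding fold_add_eq_sum[symmetric]
  by (rule computable_fold[where h = "(+)", OF assms])
     (auto intro: writer_rtmp[of "OfNat (NConst 0)"] writer_rtmp[of "RAdd (tR m) (tR (m + 3))" for m] simp: rtmp_def)

lemma be_all:
  assumes "ne l n" "bnd n" "\<And>i e. l \<le> i \<Longrightarrow> ne i e \<Longrightarrow> be i (\<lambda>s. g s (e s))"
  shows "be l (\<lambda>s. \<forall>x<n s. g s x)"
  unfolding fold_conj_eq_all[symmetric]
  by (rule computable_fold[where h = "(\<and>)", OF assms])
     (auto intro: writer_btmp[of "NLess (NConst 0) (NConst 1)"] writer_btmp[of "BAnd (tB m) (tB (m + 3))" for m] simp: btmp_def)

lemma be_ex:
  assumes "ne l n" "bnd n" "\<And>i e. l \<le> i \<Longrightarrow> ne i e \<Longrightarrow> be i (\<lambda>s. g s (e s))"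
  shows "be l (\<lambda>s. \<exists>x<n s. g s x)"
  using be_not[OF be_all[OF assms(1,2) be_not[OF assms(3)]]] by simp

text \<open>The number of indices up to and including which P fails, that is, the least witness, or
  n if there is none. The form as a bounded sum makes it computable by the rules at hand.\<close>

definition first :: "nat \<Rightarrow> (nat \<Rightarrow> bool) \<Rightarrow> nat" where
  "first n P = (\<Sum>x<n. if \<forall>x'<Suc x. \<not> P x' then 1 else 0)"

lemma first_eq: "first n P = (if \<exists>x<n. P x then LEAST x. P x else n)"
proof (induction n)
  case (Suc n)
  show ?case
  proof (cases "\<exists>x<n. P x")
    case True
    then have "first (Suc n) P = first n P" by (auto simp: first_def intro: less_SucI)
    then show ?thesis using Suc True by (auto simp: less_Suc_eq)
  next
    case False
    then have *: "first (Suc n) P = n + (if P n then 0 else 1)" using Suc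
      by (auto simp: first_def less_Suc_eq)
    show ?thesis
    proof (cases "P n")
      case True
      then have "(LEAST x. P x) = n" using False by (intro Least_equality) (auto simp: not_less[symmetric])
      then show ?thesis using * True by auto
    qed (use * False in \<open>auto simp: less_Suc_eq\<close>)
  qed
qed (simp add: first_def)

lemma firstI:
  assumes "x < n" "P x"
  shows "first n P < n" "P (first n P)"
  using assms Least_le[of P x] LeastI[of P x] by (auto simp: first_eq)

lemma first_less_iff: "first n P < n \<longleftrightarrow> (\<exists>x<n. P x)"
proof
  assume "\<exists>x<n. P x"
  then show "first n P < n" using firstI(1)[of _ n P] by blast
qed (metis first_eq less_irrefl)

section \<open>Statements as state transformers\<close>

definition nset :: "var \<Rightarrow> nat \<Rightarrow> nat \<Rightarrow> state \<Rightarrow> state" where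
  "nset v i x s = s\<lparr>nmem := upd (nmem s) v i 0 x\<rparr>"

definition rset :: "var \<Rightarrow> nat \<Rightarrow> real \<Rightarrow> state \<Rightarrow> state" where
  "rset v i x s = s\<lparr>rmem := upd (rmem s) v i 0 x\<rparr>"

text \<open>Keeping \<open>nF\<close> and \<open>nD\<close> out of W makes the size invariant;
  keeping \<open>#\<close> out makes the intended effect leave the stack alone.\<close>

definition frame :: "var set \<Rightarrow> (state \<Rightarrow> state) \<Rightarrow> bool" where
  "frame W F \<longleftrightarrow> {''#'', ''nF'', ''nD''} \<inter> W = {} \<and>
     (\<forall>s v. v \<notin> W \<longrightarrow> nmem (F s) v = nmem s v \<and> rmem (F s) v = rmem s v)"

definition respectful :: "(state \<Rightarrow> state) \<Rightarrow> bool" where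
  "respectful F \<longleftrightarrow> (\<forall>a b m. agree m a b \<longrightarrow> agree m (F a) (F b))"

text \<open>F is the intended effect; the program may also overwrite stack rows from m on, and since
  F is \<open>respectful\<close> this residue is invisible to whatever follows. The level m is
  arbitrary because an enclosing loop keeps its bound and counter in lower rows.\<close>

definition stm :: "var set \<Rightarrow> (state \<Rightarrow> state) \<Rightarrow> bool" where
  "stm W F \<longleftrightarrow> frame W F \<and> respectful F \<and>
     (\<forall>m. \<exists>P c. \<forall>s. \<exists>s'. runs P c s s' \<and> agree m (F s) s')"

lemma stm_frame: "stm W F \<Longrightarrow> v \<notin> W \<Longrightarrow> nmem (F s) v = nmem s v \<and> rmem (F s) v = rmem s v"
  by (simp add: stm_def frame_def)

lemma stmE:
  assumes "stm W F"
  obtains P c where "\<And>s. \<exists>s'. runs P c s s' \<and> agree m (F s) s'"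
  using assms unfolding stm_def by blast

lemma frame_size: "frame W F \<Longrightarrow> size_of (F s) = size_of s"
  by (simp add: frame_def size_of_def)

lemma frame_ntmp: "frame W F \<Longrightarrow> ntmp (F s) m = ntmp s m"
  by (simp add: frame_def ntmp_def)

lemma nset_program:
  assumes i: "ne m i" and e: "ne m e" and v: "v \<noteq> ''#''"
  shows "\<exists>P c. \<forall>s. \<exists>s'. runs P c s s' \<and> agree m (nset v (i s) (e s) s) s'"
proof -
  obtain P c where P: "\<And>s. \<exists>s'. runs P c s s' \<and> agree m s s' \<and> ntmp s' m = i s"
    using computableE[OF i order_refl] by blast
  have "m \<le> Suc m" by simp
  then obtain Q b where Q: "\<And>s. \<exists>s'. runs Q b s s' \<and> agree (Suc m) s s' \<and> ntmp s' (Suc m) = e s"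
    using computableE[OF e] by blast
  let ?R = "NSet v (tN m) (NConst 0) (tN (Suc m))"
  have "\<exists>s'. runs (Seq (Seq P Q) ?R) (c + b + 1 + (1 + ntime (tN m) + ntime (NConst 0) + ntime (tN (Suc m))) + 1) s s' \<and>
      agree m (nset v (i s) (e s) s) s'" for s
  proof -
    obtain s1 where 1: "runs P c s s1" "agree m s s1" "ntmp s1 m = i s" using P by blast
    obtain s2 where 2: "runs Q b s1 s2" "agree (Suc m) s1 s2" "ntmp s2 (Suc m) = e s1" using Q by blast
    let ?s = "nset v (ntmp s2 m) (ntmp s2 (Suc m)) s2"
    have 3: "runs ?R (1 + ntime (tN m) + ntime (NConst 0) + ntime (tN (Suc m))) s2 ?s"
      using runs_NSet[of v "tN m" "NConst 0" "tN (Suc m)" s2] by (simp add: ntmp_def nset_def)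
    have 4: "ntmp s2 m = i s" "e s1 = e s"
      using 1 2 reader_agree[of ntmp "Suc m" s1 s2 m] computable_resp[OF e 1(2)] by auto
    have "agree m s s2" using agree_trans[OF 1(2) agree_mono[OF 2(2), of m]] by simp
    then have "agree m (nset v (i s) (e s) s) ?s"
      using 2(3) 4 v by (auto simp: agree_def nset_def upd_def)
    then show ?thesis
      using runs_Seq3[OF 1(1) 2(1) 3 size_of_agree[OF 1(2)] size_of_agree[OF 2(2)]] by blast
  qed
  then show ?thesis by blast
qed

lemma rset_program:
  assumes i: "ne m i" and e: "re m e" and v: "v \<noteq> ''#''"
  shows "\<exists>P c. \<forall>s. \<exists>s'. runs P c s s' \<and> agree m (rset v (i s) (e s) s) s'"
proof -
  obtain P c where P: "\<And>s. \<exists>s'. runs P c s s' \<and> agree m s s' \<and> ntmp s' m = i s"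
    using computableE[OF i order_refl] by blast
  have "m \<le> Suc m" by simp
  then obtain Q b where Q: "\<And>s. \<exists>s'. runs Q b s s' \<and> agree (Suc m) s s' \<and> rtmp s' (Suc m) = e s"
    using computableE[OF e] by blast
  let ?R = "RSet v (tN m) (NConst 0) (tR (Suc m))"
  have "\<exists>s'. runs (Seq (Seq P Q) ?R) (c + b + 1 + (1 + ntime (tN m) + ntime (NConst 0) + rtime (tR (Suc m))) + 1) s s' \<and>
      agree m (rset v (i s) (e s) s) s'" for s
  proof -
    obtain s1 where 1: "runs P c s s1" "agree m s s1" "ntmp s1 m = i s" using P by blast
    obtain s2 where 2: "runs Q b s1 s2" "agree (Suc m) s1 s2" "rtmp s2 (Suc m) = e s1" using Q by blast
    let ?s = "rset v (ntmp s2 m) (rtmp s2 (Suc m)) s2"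
    have 3: "runs ?R (1 + ntime (tN m) + ntime (NConst 0) + rtime (tR (Suc m))) s2 ?s"
      using runs_RSet[of v "tN m" "NConst 0" "tR (Suc m)" s2] by (simp add: ntmp_def rtmp_def rset_def)
    have 4: "ntmp s2 m = i s" "e s1 = e s"
      using 1 2 reader_agree[of ntmp "Suc m" s1 s2 m] computable_resp[OF e 1(2)] by auto
    have "agree m s s2" using agree_trans[OF 1(2) agree_mono[OF 2(2), of m]] by simp
    then have "agree m (rset v (i s) (e s) s) ?s"
      using 2(3) 4 v by (auto simp: agree_def rset_def upd_def)
    then show ?thesis
      using runs_Seq3[OF 1(1) 2(1) 3 size_of_agree[OF 1(2)] size_of_agree[OF 2(2)]] by blast
  qed
  then show ?thesis by blast
qed

lemma agree_nset: "agree m a b \<Longrightarrow> agree m (nset v i x a) (nset v i x b)"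
  by (auto simp: agree_def nset_def upd_def)

lemma agree_rset: "agree m a b \<Longrightarrow> agree m (rset v i x a) (rset v i x b)"
  by (auto simp: agree_def rset_def upd_def)

definition writable :: "var \<Rightarrow> var set \<Rightarrow> bool" where
  "writable v W \<longleftrightarrow> v \<in> W \<and> {''#'', ''nF'', ''nD''} \<inter> W = {}"

lemma writable_neq: "writable v W \<Longrightarrow> v \<noteq> ''#''"
  by (auto simp: writable_def)

lemma frame_nset: "writable v W \<Longrightarrow> frame W (\<lambda>s. nset v (i s) (e s) s)"
  by (auto simp: frame_def writable_def nset_def upd_def)

lemma frame_rset: "writable v W \<Longrightarrow> frame W (\<lambda>s. rset v (i s) (e s) s)"
  by (auto simp: frame_def writable_def rset_def upd_def)

lemma stm_nset:
  assumes v: "writable v W" and i: "ne 0 i" and e: "ne 0 e"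
  shows "stm W (\<lambda>s. nset v (i s) (e s) s)"
  unfolding stm_def respectful_def
proof (intro conjI allI impI frame_nset[OF v])
  fix a b :: state and m assume ab: "agree m a b"
  show "agree m (nset v (i a) (e a) a) (nset v (i b) (e b) b)"
    using agree_nset[OF ab] computable_resp[OF i agree_mono[OF ab]] computable_resp[OF e agree_mono[OF ab]] by simp
qed (rule nset_program[OF computable_mono[OF i] computable_mono[OF e] writable_neq[OF v]], simp_all)

lemma stm_rset:
  assumes v: "writable v W" and i: "ne 0 i" and e: "re 0 e"
  shows "stm W (\<lambda>s. rset v (i s) (e s) s)"
  unfolding stm_def respectful_def
proof (intro conjI allI impI frame_rset[OF v])
  fix a b :: state and m assume ab: "agree m a b"
  show "agree m (rset v (i a) (e a) a) (rset v (i b) (e b) b)"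
    using agree_rset[OF ab] computable_resp[OF i agree_mono[OF ab]] computable_resp[OF e agree_mono[OF ab]] by simp
qed (rule rset_program[OF computable_mono[OF i] computable_mono[OF e] writable_neq[OF v]], simp_all)

definition skip :: "state \<Rightarrow> state" where "skip s = s"

definition sequence :: "(state \<Rightarrow> state) \<Rightarrow> (state \<Rightarrow> state) \<Rightarrow> state \<Rightarrow> state" (infixr ";;" 60) where
  "(F ;; G) s = G (F s)"

lemma stm_sequence:
  assumes F: "stm W F" and G: "stm W G"
  shows "stm W (F ;; G)"
  unfolding stm_def
proof (intro conjI allI)
  show "frame W (F ;; G)" using F G by (auto simp: stm_def frame_def sequence_def)
  show "respectful (F ;; G)" using F G by (auto simp: stm_def respectful_def sequence_def)
  fix m
  obtain P c where P: "\<And>s. \<exists>s'. runs P c s s' \<and> agree m (F s) s'" using stmE[OF F] by blast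
  obtain Q b where Q: "\<And>s. \<exists>s'. runs Q b s s' \<and> agree m (G s) s'" using stmE[OF G] by blast
  have "\<exists>s'. runs (Seq P Q) (c + b + 1) s s' \<and> agree m ((F ;; G) s) s'" for s
  proof -
    obtain s1 where 1: "runs P c s s1" "agree m (F s) s1" using P by blast
    obtain s2 where 2: "runs Q b s1 s2" "agree m (G s1) s2" using Q by blast
    have "frame W F" using F by (simp add: stm_def)
    then have "size_of s1 = size_of s" using size_of_agree[OF 1(2)] frame_size by simp
    moreover have "agree m (G (F s)) (G s1)" using G 1(2) by (simp add: stm_def respectful_def)
    ultimately show ?thesis using runs_Seq[OF 1(1) 2(1)] agree_trans[OF _ 2(2)] by (auto simp: sequence_def)
  qed
  then show "\<exists>P c. \<forall>s. \<exists>s'. runs P c s s' \<and> agree m ((F ;; G) s) s'" by blast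
qed

definition ifs :: "(state \<Rightarrow> bool) \<Rightarrow> (state \<Rightarrow> state) \<Rightarrow> (state \<Rightarrow> state) \<Rightarrow> state \<Rightarrow> state" where
  "ifs b F G s = (if b s then F s else G s)"

lemma stm_ifs:
  assumes b: "be 0 b" and F: "stm W F" and G: "stm W G"
  shows "stm W (ifs b F G)"
  unfolding stm_def
proof (intro conjI allI)
  show "frame W (ifs b F G)" using F G by (auto simp: stm_def frame_def ifs_def)
  have br: "b t = b s" if "agree m s t" for m s t
    using computable_resp[OF b agree_mono[OF that, of 0]] by simp
  show "respectful (ifs b F G)" using F G by (auto simp: stm_def respectful_def ifs_def br)
  fix m
  obtain B d where B: "\<And>s. \<exists>s'. runs B d s s' \<and> agree m s s' \<and> btmp s' m = b s"
    using computableE[OF b, of m] by blast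
  obtain P c where P: "\<And>s. \<exists>s'. runs P c s s' \<and> agree m (F s) s'" using stmE[OF F] by blast
  obtain Q c' where Q: "\<And>s. \<exists>s'. runs Q c' s s' \<and> agree m (G s) s'" using stmE[OF G] by blast
  let ?C = "Seq B (Cond (tB m) P Q)" and ?c = "d + (1 + btime (tB m) + (c + c') + 1) + 1"
  have "\<exists>s'. runs ?C ?c s s' \<and> agree m (ifs b F G s) s'" for s
  proof -
    obtain s1 where 1: "runs B d s s1" "agree m s s1" "btmp s1 m = b s" using B by blast
    have r: "agree m (F s) (F s1)" "agree m (G s) (G s1)"
      using F G 1(2) by (auto simp: stm_def respectful_def)
    obtain s2 where 2: "b s \<Longrightarrow> runs P c s1 s2" "\<not> b s \<Longrightarrow> runs Q c' s1 s2" "agree m (ifs b F G s) s2"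
      using P[of s1] Q[of s1] agree_trans[OF r(1)] agree_trans[OF r(2)] unfolding ifs_def by metis
    have "bval (tB m) s1 = b s" using 1 by (simp add: btmp_def)
    then have "runs (Cond (tB m) P Q) (1 + btime (tB m) + (c + c') + 1) s1 s2"
      using runs_Cond_uniform 2 by blast
    then show ?thesis using runs_Seq[OF 1(1) _ size_of_agree[OF 1(2)]] 2(3) by blast
  qed
  then show "\<exists>P c. \<forall>s. \<exists>s'. runs P c s s' \<and> agree m (ifs b F G s) s'" by blast
qed

text \<open>In \<open>prog\<close> the loop index is read from a protected stack row, so that one
  program with one exponent serves all iterations.\<close>

lemma stm_loop:
  assumes frame: "\<And>x. frame W (B x)" and resp: "\<And>x. respectful (B x)"
    and prog: "\<And>m i. i < m \<Longrightarrow> \<exists>P c. \<forall>s. \<exists>s'. runs P c s s' \<and> agree m (B (ntmp s i) s) s'"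
    and n: "ne 0 n" "bnd n"
  shows "stm W (\<lambda>s. fold B [0..<n s] s)"
  unfolding stm_def
proof (intro conjI allI)
  have fr: "frame W (\<lambda>s. fold B [0..<k] s)" for k
    using frame by (induction k) (auto simp: frame_def)
  then show "frame W (\<lambda>s. fold B [0..<n s] s)" by (auto simp: frame_def)
  have re: "agree m (fold B [0..<k] a) (fold B [0..<k] b)" if "agree m a b" for m k a b
    using that resp by (induction k) (auto simp: respectful_def)
  have nr: "n b = n a" if "agree m a b" for a b m
    using computable_resp[OF n(1) agree_mono[OF that, of 0]] by simp
  show "respectful (\<lambda>s. fold B [0..<n s] s)"
    unfolding respectful_def using re nr by metis
  fix m
  obtain Pn cn where Pn: "\<And>s. \<exists>s'. runs Pn cn s s' \<and> agree m s s' \<and> ntmp s' m = n s"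
    using computableE[OF n(1), of m] by blast
  have W: "writer ntmp (Suc m) (\<lambda>s. 0)" by (rule writer_ntmp[of "NConst 0"]) simp
  obtain Pz cz where Pz: "\<And>s. \<exists>s'. runs Pz cz s s' \<and> changes_only (Suc m) s s' \<and> ntmp s' (Suc m) = 0"
    using writerE[OF W] by blast
  obtain Pb cb where Pb: "\<And>s. \<exists>s'. runs Pb cb s s' \<and> agree (m + 2) (B (ntmp s (Suc m)) s) s'"
    using prog[of "Suc m" "m + 2"] by auto
  have W: "writer ntmp (Suc m) (\<lambda>s. Suc (ntmp s (Suc m)))"
    by (rule writer_ntmp[of "NAdd (tN (Suc m)) (NConst 1)"]) (simp add: ntmp_def)
  obtain Pc cc where Pc: "\<And>s. \<exists>s'. runs Pc cc s s' \<and> changes_only (Suc m) s s' \<and> ntmp s' (Suc m) = Suc (ntmp s (Suc m))"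
    using writerE[OF W] by blast
  obtain b where b: "\<And>s. n s \<le> size_of s ^ b" using n(2) unfolding bnd_def by blast
  let ?g = "NLess (tN (Suc m)) (tN m)"
  let ?B = "Seq Pb Pc"
  let ?c = "cb + cc + 1"
  let ?cw = "b + (1 + btime ?g + ?c + 1) + 1"
  have "\<exists>s'. runs (Seq (Seq Pn Pz) (While ?g ?B)) (cn + cz + 1 + ?cw + 1) s s' \<and> agree m (fold B [0..<n s] s) s'" for s
  proof -
    define Inv where "Inv = (\<lambda>x \<sigma>. agree m (fold B [0..<x] s) \<sigma> \<and> ntmp \<sigma> m = n s \<and> ntmp \<sigma> (Suc m) = x)"
    obtain s1 where 1: "runs Pn cn s s1" "agree m s s1" "ntmp s1 m = n s" using Pn by blast
    obtain s2 where 2: "runs Pz cz s1 s2" "changes_only (Suc m) s1 s2" "ntmp s2 (Suc m) = 0" using Pz by blast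
    have r: "runs (Seq Pn Pz) (cn + cz + 1) s s2" using runs_Seq[OF 1(1) 2(1) size_of_agree[OF 1(2)]] .
    have i0: "Inv 0 s2"
      using 1 2 agree_trans[OF 1(2) agree_changes_only[OF 2(2)]] reader_changes_only[of ntmp "Suc m" s1 s2 m]
      by (simp add: Inv_def)
    have sz: "size_of \<sigma> = size_of s" if "Inv x \<sigma>" for x \<sigma>
      using that size_of_agree[of m "fold B [0..<x] s" \<sigma>] frame_size[OF fr] by (auto simp: Inv_def)
    have body: "\<exists>\<sigma>'. runs ?B ?c \<sigma> \<sigma>' \<and> Inv (Suc x) \<sigma>'" if "Inv x \<sigma>" for x \<sigma>
    proof -
      have I: "agree m (fold B [0..<x] s) \<sigma>" "ntmp \<sigma> m = n s" "ntmp \<sigma> (Suc m) = x"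
        using that by (auto simp: Inv_def)
      obtain a1 where 1: "runs Pb cb \<sigma> a1" "agree (m + 2) (B (ntmp \<sigma> (Suc m)) \<sigma>) a1" using Pb by blast
      obtain a2 where 2: "runs Pc cc a1 a2" "changes_only (Suc m) a1 a2" "ntmp a2 (Suc m) = Suc (ntmp a1 (Suc m))" using Pc by blast
      have 3: "size_of a1 = size_of \<sigma>" using size_of_agree[OF 1(2)] frame_size[OF frame] by simp
      have 4: "ntmp a1 i = ntmp \<sigma> i" if "i < m + 2" for i
        using reader_agree[OF _ 1(2) that, of ntmp] frame_ntmp[OF frame] by simp
      have "agree m (fold B [0..<Suc x] s) (B x \<sigma>)" using I(1) resp by (simp add: respectful_def)
      also have "agree m (B x \<sigma>) a1" using agree_mono[OF 1(2), of m] I by simp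
      also (agree_trans) have "agree m a1 a2" using agree_changes_only[OF 2(2)] by simp
      finally (agree_trans) have "agree m (fold B [0..<Suc x] s) a2" .
      moreover have "ntmp a2 m = n s" using I 4[of m] reader_changes_only[OF _ 2(2), of ntmp m] by simp
      moreover have "ntmp a2 (Suc m) = Suc x" using 2(3) 4[of "Suc m"] I by simp
      ultimately have "Inv (Suc x) a2" by (simp add: Inv_def)
      then show ?thesis using runs_Seq[OF 1(1) 2(1) 3] by blast
    qed
    have "\<exists>s'. runs (While ?g ?B) ?cw s2 s' \<and> Inv (n s) s'"
    proof (rule runs_While[where N = "size_of s"])
      show "\<And>x \<sigma>. x \<le> n s \<Longrightarrow> Inv x \<sigma> \<Longrightarrow> bval ?g \<sigma> = (x < n s)" by (auto simp: Inv_def ntmp_def)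
    qed (use body b i0 sz in auto)
    then obtain s' where s': "runs (While ?g ?B) ?cw s2 s'" "Inv (n s) s'" by blast
    then show ?thesis using runs_Seq[OF r s'(1) sz[OF i0]] by (auto simp: Inv_def)
  qed
  then show "\<exists>P c. \<forall>s. \<exists>s'. runs P c s s' \<and> agree m (fold B [0..<n s] s) s'" by blast
qed

text \<open>A body is a transformer without parameters, so the index reaches it through the program
  variable v. The bound is evaluated once, before the loop.\<close>

definition forv :: "var \<Rightarrow> (state \<Rightarrow> nat) \<Rightarrow> (state \<Rightarrow> state) \<Rightarrow> state \<Rightarrow> state" where
  "forv v n B s = fold (\<lambda>x s. B (nset v 0 x s)) [0..<n s] s"

lemma stm_forv:
  assumes v: "writable v W" and n: "ne 0 n" "bnd n" and B: "stm W B"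
  shows "stm W (forv v n B)"
  unfolding forv_def
proof (rule stm_loop)
  have fB: "frame W B" and rB: "respectful B" using B by (auto simp: stm_def)
  fix x
  show "frame W (\<lambda>s. B (nset v 0 x s))"
    using fB frame_nset[OF v, of "\<lambda>s. 0" "\<lambda>s. x"] by (auto simp: frame_def)
  show "respectful (\<lambda>s. B (nset v 0 x s))" using rB agree_nset by (simp add: respectful_def)
next
  fix m i :: nat assume i: "i < m"
  have rB: "respectful B" using B by (auto simp: stm_def)
  obtain P c where P: "\<And>s. \<exists>s'. runs P c s s' \<and> agree m (nset v 0 (ntmp s i) s) s'"
    using nset_program[OF ne_const ne_tmp[OF i] writable_neq[OF v]] by blast
  obtain Q b where Q: "\<And>s. \<exists>s'. runs Q b s s' \<and> agree m (B s) s'" using stmE[OF B] by blast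
  have "\<exists>s'. runs (Seq P Q) (c + b + 1) s s' \<and> agree m (B (nset v 0 (ntmp s i) s)) s'" for s
  proof -
    obtain s1 where 1: "runs P c s s1" "agree m (nset v 0 (ntmp s i) s) s1" using P by blast
    obtain s2 where 2: "runs Q b s1 s2" "agree m (B s1) s2" using Q by blast
    have "size_of s1 = size_of s"
      using size_of_agree[OF 1(2)] frame_size[OF frame_nset[OF v, of "\<lambda>s. 0" "\<lambda>s. ntmp s i"]] by simp
    then show ?thesis
      using runs_Seq[OF 1(1) 2(1)] agree_trans[OF _ 2(2)] rB 1(2) by (auto simp: respectful_def)
  qed
  then show "\<exists>P c. \<forall>s. \<exists>s'. runs P c s s' \<and> agree m (B (nset v 0 (ntmp s i) s)) s'" by blast
qed (use n in auto)

lemma forv_induct: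
  assumes "Inv 0 s" "\<And>x t. x < n s \<Longrightarrow> Inv x t \<Longrightarrow> Inv (Suc x) (B (nset v 0 x t))"
  shows "Inv (n s) (forv v n B s)"
proof -
  have "Inv k (fold (\<lambda>x s. B (nset v 0 x s)) [0..<k] s)" if "k \<le> n s" for k
    using that by (induction k) (use assms in auto)
  then show ?thesis by (simp add: forv_def)
qed

definition nfill :: "var \<Rightarrow> (state \<Rightarrow> nat) \<Rightarrow> (state \<Rightarrow> nat \<Rightarrow> nat) \<Rightarrow> state \<Rightarrow> state" where
  "nfill v n f s = s\<lparr>nmem := (nmem s)(v := \<lambda>i j. if j = 0 \<and> i < n s then f s i else nmem s v i j)\<rparr>"

definition rfill :: "var \<Rightarrow> (state \<Rightarrow> nat) \<Rightarrow> (state \<Rightarrow> nat \<Rightarrow> real) \<Rightarrow> state \<Rightarrow> state" where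
  "rfill v n f s = s\<lparr>rmem := (rmem s)(v := \<lambda>i j. if j = 0 \<and> i < n s then f s i else rmem s v i j)\<rparr>"

text \<open>The entries are written one after the other. By \<open>indep\<close> the values do not
  see the entries already written, so the result is the simultaneous assignment.\<close>

lemma stm_nfill:
  assumes v: "writable v W" and n: "ne 0 n" "bnd n"
    and f: "\<And>i e. 0 \<le> i \<Longrightarrow> ne i e \<Longrightarrow> ne i (\<lambda>s. f s (e s))"
    and indep: "\<And>s g. f (s\<lparr>nmem := (nmem s)(v := g)\<rparr>) = f s"
  shows "stm W (nfill v n f)"
proof -
  have 1: "fold (\<lambda>x s. nset v x (f s x) s) [0..<k] s =
      s\<lparr>nmem := (nmem s)(v := \<lambda>i j. if j = 0 \<and> i < k then f s i else nmem s v i j)\<rparr>" for k s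
  proof (induction k)
    case 0
    show ?case by (rule state.equality) (auto simp: fun_eq_iff)
  next
    case (Suc k)
    let ?S = "\<lambda>k. s\<lparr>nmem := (nmem s)(v := \<lambda>i j. if j = 0 \<and> i < k then f s i else nmem s v i j)\<rparr>"
    have "fold (\<lambda>x s. nset v x (f s x) s) [0..<Suc k] s = nset v k (f (?S k) k) (?S k)"
      unfolding upt_Suc_append[OF le0] fold_append comp_apply Suc by simp
    also have "f (?S k) k = f s k" using indep by simp
    also have "nset v k (f s k) (?S k) = ?S (Suc k)"
      by (rule state.equality) (auto simp: nset_def upd_def fun_eq_iff)
    finally show ?case .
  qed
  have fr: "f b x = f a x" if "agree m a b" for m a b x
    using computable_resp[OF f[OF _ ne_const[of 0 x]] agree_mono[OF that, of 0]] by simp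
  have "stm W (\<lambda>s. fold (\<lambda>x s. nset v x (f s x) s) [0..<n s] s)"
  proof (rule stm_loop)
    fix x
    show "frame W (\<lambda>s. nset v x (f s x) s)" using frame_nset[OF v] .
    show "respectful (\<lambda>s. nset v x (f s x) s)" using agree_nset fr by (fastforce simp: respectful_def)
  next
    fix m i :: nat assume i: "i < m"
    show "\<exists>P c. \<forall>s. \<exists>s'. runs P c s s' \<and> agree m (nset v (ntmp s i) (f s (ntmp s i)) s) s'"
      by (rule nset_program[OF ne_tmp[OF i] f[OF _ ne_tmp[OF i]] writable_neq[OF v]]) simp
  qed (use n in auto)
  then show ?thesis unfolding 1 nfill_def[symmetric] by (simp add: nfill_def[abs_def])
qed

lemma stm_rfill:
  assumes v: "writable v W" and n: "ne 0 n" "bnd n"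
    and f: "\<And>i e. 0 \<le> i \<Longrightarrow> ne i e \<Longrightarrow> re i (\<lambda>s. f s (e s))"
    and indep: "\<And>s g. f (s\<lparr>rmem := (rmem s)(v := g)\<rparr>) = f s"
  shows "stm W (rfill v n f)"
proof -
  have 1: "fold (\<lambda>x s. rset v x (f s x) s) [0..<k] s =
      s\<lparr>rmem := (rmem s)(v := \<lambda>i j. if j = 0 \<and> i < k then f s i else rmem s v i j)\<rparr>" for k s
  proof (induction k)
    case 0
    show ?case by (rule state.equality) (auto simp: fun_eq_iff)
  next
    case (Suc k)
    let ?S = "\<lambda>k. s\<lparr>rmem := (rmem s)(v := \<lambda>i j. if j = 0 \<and> i < k then f s i else rmem s v i j)\<rparr>"
    have "fold (\<lambda>x s. rset v x (f s x) s) [0..<Suc k] s = rset v k (f (?S k) k) (?S k)"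
      unfolding upt_Suc_append[OF le0] fold_append comp_apply Suc by simp
    also have "f (?S k) k = f s k" using indep by simp
    also have "rset v k (f s k) (?S k) = ?S (Suc k)"
      by (rule state.equality) (auto simp: rset_def upd_def fun_eq_iff)
    finally show ?case .
  qed
  have fr: "f b x = f a x" if "agree m a b" for m a b x
    using computable_resp[OF f[OF _ ne_const[of 0 x]] agree_mono[OF that, of 0]] by simp
  have "stm W (\<lambda>s. fold (\<lambda>x s. rset v x (f s x) s) [0..<n s] s)"
  proof (rule stm_loop)
    fix x
    show "frame W (\<lambda>s. rset v x (f s x) s)" using frame_rset[OF v] .
    show "respectful (\<lambda>s. rset v x (f s x) s)" using agree_rset fr by (fastforce simp: respectful_def)
  next
    fix m i :: nat assume i: "i < m"
    show "\<exists>P c. \<forall>s. \<exists>s'. runs P c s s' \<and> agree m (rset v (ntmp s i) (f s (ntmp s i)) s) s'"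
      by (rule rset_program[OF ne_tmp[OF i] f[OF _ ne_tmp[OF i]] writable_neq[OF v]]) simp
  qed (use n in auto)
  then show ?thesis unfolding 1 rfill_def[symmetric] by (simp add: rfill_def[abs_def])
qed

lemma bnd_const: "bnd (\<lambda>s. k)"
  unfolding bnd_def using le_pow_self[OF size_of_ge_2] by blast

lemma bnd_nF: "bnd (\<lambda>s. nmem s ''nF'' 0 0)"
  unfolding bnd_def by (rule exI[of _ 1]) (simp add: size_of_def)

lemma bnd_nD: "bnd (\<lambda>s. nmem s ''nD'' 0 0)"
  unfolding bnd_def by (rule exI[of _ 1]) (simp add: size_of_def)

lemma bnd_add:
  assumes "bnd f" "bnd g"
  shows "bnd (\<lambda>s. f s + g s)"
proof -
  obtain a b where "\<And>s. f s \<le> size_of s ^ a" "\<And>s. g s \<le> size_of s ^ b"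
    using assms unfolding bnd_def by blast
  then have "f s + g s \<le> size_of s ^ (a + b + 1)" for s
    using pow_add_le[OF size_of_ge_2] by blast
  then show ?thesis unfolding bnd_def by blast
qed

lemma stm_program:
  assumes "stm W F"
  shows "\<exists>P c. \<forall>s. \<exists>t s'. exec P s t s' \<and> t \<le> size_of s ^ c \<and> (\<forall>v. v \<noteq> ''#'' \<longrightarrow> nmem s' v = nmem (F s) v)"
proof -
  obtain P c where P: "\<And>s. \<exists>s'. runs P c s s' \<and> agree 0 (F s) s'" using stmE[OF assms] by blast
  have "\<exists>t s'. exec P s t s' \<and> t \<le> size_of s ^ c \<and> (\<forall>v. v \<noteq> ''#'' \<longrightarrow> nmem s' v = nmem (F s) v)" for s
  proof -
    obtain s' t where "exec P s t s'" "t \<le> size_of s ^ c" "agree 0 (F s) s'"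
      using P[of s] unfolding runs_def by blast
    then show ?thesis by (intro exI[of _ t] exI[of _ s']) (simp add: agree_def fun_eq_iff)
  qed
  then show ?thesis by blast
qed

section \<open>Primal-dual rounding\<close>

text \<open>The maximum of \<open>3 (3 + b) / (3 - 2 b + 3 b\<^sup>2)\<close> over \<open>b\<close>, attained at \<open>b = 2 sqrt 3 - 3\<close>, is about 3.8235.\<close>

lemma bipoint_min:
  fixes X Y b :: real
  assumes "0 \<le> X" "0 \<le> Y" "0 \<le> b" "b \<le> 1"
  shows "3 * Y \<le> 3.825 * ((1 - b) * X + b * Y) \<or>
         3 * X + b * (2 * Y + X) \<le> 3.825 * ((1 - b) * X + b * Y)"
proof (rule ccontr)
  assume "\<not> ?thesis"
  then have n: "3.825 * ((1 - b) * X + b * Y) < 3 * Y" "3.825 * ((1 - b) * X + b * Y) < 3 * X + b * (2 * Y + X)"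
    by linarith+
  \<comment> \<open>Equating the two costs gives (3 - 2 b) Y = (3 + b) X, whence the quotient in the
    text above. Here Y is eliminated: the first inequality is scaled by 1.825 b and the second by 3
    - 3.825 b.\<close>
  have 1: "3.825 * (1 - b) * X < (3 - 3.825 * b) * Y" using n(1) by (simp add: field_simps)
  have 2: "1.825 * b * Y < (3 + b - 3.825 * (1 - b)) * X" using n(2) by (simp add: field_simps)
  have "0 \<le> 3.825 * (1 - b) * X" "0 \<le> 1.825 * b * Y" using assms by simp_all
  then have "0 < (3 - 3.825 * b) * Y" "0 < (3 + b - 3.825 * (1 - b)) * X" using 1 2 by linarith+
  then have pos: "0 < 3 - 3.825 * b" "0 < X"
    using assms by (auto simp: zero_less_mult_iff)
  have "1.825 * b * (3.825 * (1 - b) * X) \<le> 1.825 * b * ((3 - 3.825 * b) * Y)"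
    using 1 assms by (intro mult_left_mono) auto
  also have "\<dots> = (3 - 3.825 * b) * (1.825 * b * Y)" by simp
  also have "\<dots> < (3 - 3.825 * b) * ((3 + b - 3.825 * (1 - b)) * X)"
    using 2 pos by (intro mult_strict_left_mono)
  finally have "X * (1.825 * b * (3.825 * (1 - b))) < X * ((3 - 3.825 * b) * (3 + b - 3.825 * (1 - b)))"
    by (simp add: algebra_simps)
  then have "1.825 * b * (3.825 * (1 - b)) < (3 - 3.825 * b) * (3 + b - 3.825 * (1 - b))"
    by (simp only: mult_less_cancel_left_pos[OF pos(2)])
  moreover have "1.825 * b * (3.825 * (1 - b)) - (3 - 3.825 * b) * (3 + b - 3.825 * (1 - b)) =
      11.475 * b\<^sup>2 - 10.65 * b + 2.475"
    by (simp add: power2_eq_square field_simps)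
  \<comment> \<open>Completing the square shows that the quadratic is positive: its discriminant
    10.65^2 - 4 * 11.475 * 2.475 is negative, though barely.\<close>
  moreover have "11.475 * (b - 10.65 / 22.95)\<^sup>2 = 11.475 * b\<^sup>2 - 10.65 * b + 10.65\<^sup>2 / 45.9"
    by (simp add: power2_eq_square field_simps)
  moreover have "10.65\<^sup>2 / 45.9 \<le> (2.475::real)" by (simp add: power2_eq_square)
  moreover have "0 \<le> 11.475 * (b - 10.65 / 22.95)\<^sup>2" by simp
  ultimately show False by linarith
qed

text \<open>The greedy argument for fractional knapsack: among the prefixes of the order by price
  per unit, take a shortest one of size at least N. Without its last item u its size is below N and
  its price per unit is at most the average, which is the second conjunct with denominators cleared.
  Ties are broken by the index, so that u alone determines the prefix.\<close>

lemma knapsack_prefix: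
  fixes w :: "nat \<Rightarrow> real" and s :: "nat \<Rightarrow> nat"
  assumes T: "finite T" and s: "\<And>b. b \<in> T \<Longrightarrow> 0 < s b" and N: "0 < N" "N \<le> sum s T"
    and le_def: "\<And>b u. le b u \<longleftrightarrow> w b / s b < w u / s u \<or> w b / s b = w u / s u \<and> b \<le> u"
    and w: "\<And>b. b \<in> T \<Longrightarrow> 0 \<le> w b"
  shows "\<exists>u\<in>T. N \<le> sum s {b \<in> T. le b u} \<and>
     sum w ({b \<in> T. le b u} - {u}) * real (sum s T) \<le> real N * sum w T"
proof -
  have trans: "le a c" if "le a b" "le b c" for a b c using that by (auto simp: le_def)
  have refl: "le a a" for a by (simp add: le_def)
  have total: "le a b \<or> le b a" for a b by (auto simp: le_def)
  have antisym: "a = b" if "le a b" "le b a" for a b using that by (auto simp: le_def)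
  have greatest: "\<exists>u\<in>V. \<forall>c\<in>V. le c u" if "finite V" "V \<noteq> {}" for V
    using that
  proof (induction V rule: finite_ne_induct)
    case (insert x V)
    then obtain u where "u \<in> V" "\<forall>c\<in>V. le c u" by blast
    then show ?case using total[of x u] trans refl by (metis insert_iff)
  qed (simp add: refl)
  define Q where "Q = {u \<in> T. N \<le> sum s {b \<in> T. le b u}}"
  have "T \<noteq> {}" using N by auto
  then obtain t where t: "t \<in> T" "\<forall>c\<in>T. le c t" using greatest[OF T] by blast
  then have "{b \<in> T. le b t} = T" by auto
  then have "t \<in> Q" using t N by (simp add: Q_def)
  \<comment> \<open>A shortest sufficient prefix. If dropping u left size N, the prefix ending just
    before u would be sufficient and shorter.\<close>
  then obtain u where u: "u \<in> Q" "\<And>v. v \<in> Q \<Longrightarrow> card {b \<in> T. le b u} \<le> card {b \<in> T. le b v}"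
    using ex_has_least_nat[of "\<lambda>u. u \<in> Q" t "\<lambda>u. card {b \<in> T. le b u}"] by blast
  let ?M = "{b \<in> T. le b u} - {u}"
  have fin: "finite ?M" using T by simp
  have less: "sum s ?M < N"
  proof (cases "?M = {}")
    case False
    then obtain v where v: "v \<in> ?M" "\<forall>c\<in>?M. le c v" using greatest[OF fin] by blast
    have "{b \<in> T. le b v} = ?M" using v trans antisym by blast
    moreover have "card ?M < card {b \<in> T. le b u}"
      using u(1) refl T by (intro psubset_card_mono) (auto simp: Q_def)
    ultimately have "v \<notin> Q" using u(2)[of v] by auto
    then show ?thesis using v \<open>{b \<in> T. le b v} = ?M\<close> by (auto simp: Q_def)
  next
    case True
    show ?thesis unfolding True using N by simp
  qed
  have "w b * s c \<le> w c * s b" if "b \<in> ?M" "c \<in> T - ?M" for b c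
  proof -
    have "le u c" using that total[of u c] refl antisym by auto
    then have "le b c" using that trans by blast
    then have "w b / s b \<le> w c / s c" by (auto simp: le_def)
    then show ?thesis using s that by (simp add: field_simps)
  qed
  \<comment> \<open>Summing the pairwise comparison over items inside and outside the prefix
    compares the two average prices.\<close>
  then have "(\<Sum>b\<in>?M. \<Sum>c\<in>T - ?M. w b * s c) \<le> (\<Sum>b\<in>?M. \<Sum>c\<in>T - ?M. w c * s b)"
    by (intro sum_mono)
  then have *: "sum w ?M * sum s (T - ?M) \<le> sum w (T - ?M) * sum s ?M"
    unfolding sum_product of_nat_sum by (subst (2) sum.swap) simp
  have "sum s T = sum s (T - ?M) + sum s ?M" "sum w T = sum w (T - ?M) + sum w ?M"
    using sum.subset_diff[OF _ T, of ?M] by auto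
  then have "sum w ?M * real (sum s T) \<le> sum w T * real (sum s ?M)"
    using * by (simp add: algebra_simps)
  also have "\<dots> \<le> sum w T * real N"
  proof (rule mult_left_mono)
    show "real (sum s ?M) \<le> real N" using less by (simp only: of_nat_le_iff)
  qed (use w in \<open>auto intro: sum_nonneg\<close>)
  finally show ?thesis using u(1) by (auto simp: Q_def mult.commute)
qed

text \<open>Facilities and clients are numbered separately and only facility-client distances occur,
  so the triangle inequality is stated along the path x, y', x', y. Later R caps the radii and U
  consists of the clients outside the guessed balls.\<close>

locale cover_instance =
  fixes p q :: nat and d :: "nat \<Rightarrow> nat \<Rightarrow> real" and L :: "nat \<Rightarrow> nat" and R :: real and U :: "nat set"
  assumes d_nonneg: "x < p \<Longrightarrow> y < q \<Longrightarrow> 0 \<le> d x y"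
    and d_triangle: "x < p \<Longrightarrow> x' < p \<Longrightarrow> y < q \<Longrightarrow> y' < q \<Longrightarrow> d x y \<le> d x y' + d x' y' + d x' y"
begin

definition ball :: "nat \<Rightarrow> real \<Rightarrow> nat set" where
  "ball x r = {y. y < q \<and> d x y \<le> r}"

lemma finite_ball [simp]: "finite (ball x r)" by (simp add: ball_def)

text \<open>A ball is named by its centre and a client that determines the radius, which leaves p *
  q candidates. The lower bound counts all clients in the ball, also those outside U, since a core
  reserves all of them.\<close>

definition valid :: "nat \<Rightarrow> nat \<Rightarrow> bool" where
  "valid x z \<longleftrightarrow> x < p \<and> z < q \<and> d x z \<le> R \<and> L x \<le> card (ball x (d x z))"

text \<open>Slack of the dual constraint \<open>sum al (ball x r) \<le> r + lam\<close> for r = d x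
  z, when only the clients below n have been raised.\<close>

definition slack :: "(nat \<Rightarrow> real) \<Rightarrow> real \<Rightarrow> nat \<Rightarrow> nat \<Rightarrow> nat \<Rightarrow> real" where
  "slack al lam n x z = d x z + lam - (\<Sum>y<n. if d x y \<le> d x z then al y else 0)"

definition tight :: "(nat \<Rightarrow> real) \<Rightarrow> real \<Rightarrow> nat \<Rightarrow> nat \<Rightarrow> bool" where
  "tight al lam x z \<longleftrightarrow> valid x z \<and> slack al lam q x z \<le> 0"

text \<open>The clients raise their dual variables one after the other, each until a ball becomes tight.
  Unlike in a simultaneous ascent, the result depends on \<open>lam\<close> in a Lipschitz way.\<close>

definition ascent :: "real \<Rightarrow> (nat \<Rightarrow> real) \<Rightarrow> bool" where
  "ascent lam al \<longleftrightarrow> (\<forall>y<q.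
     if y \<in> U \<and> (\<exists>x z. valid x z \<and> d x y \<le> d x z)
     then (\<exists>x z. valid x z \<and> d x y \<le> d x z \<and> al y = slack al lam y x z) \<and>
          (\<forall>x z. valid x z \<and> d x y \<le> d x z \<longrightarrow> al y \<le> slack al lam y x z)
     else al y = 0)"

lemma slack_Suc: "slack al lam (Suc n) x z = slack al lam n x z - (if d x n \<le> d x z then al n else 0)"
  by (simp add: slack_def)

lemma slack_q: "slack al lam q x z = d x z + lam - sum al (ball x (d x z))"
proof -
  have "sum al (ball x (d x z)) = (\<Sum>y<q. if d x y \<le> d x z then al y else 0)"
    by (subst sum.inter_filter[symmetric]) (auto simp: ball_def intro!: sum.cong)
  then show ?thesis by (simp add: slack_def)
qed

context
  fixes lam al
  assumes lam: "0 \<le> lam" and asc: "ascent lam al"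
begin

text \<open>Dual feasibility at every stage: a client inside the ball stops at the minimum slack
  over all valid balls that contain it.\<close>

lemma slack_nonneg:
  assumes "valid x z" "n \<le> q"
  shows "0 \<le> slack al lam n x z"
  using assms(2)
proof (induction n)
  case 0
  then show ?case using lam assms(1) d_nonneg by (simp add: slack_def valid_def)
next
  case (Suc n)
  then have n: "n < q" "0 \<le> slack al lam n x z" by auto
  show ?case
  proof (cases "d x n \<le> d x z")
    case True
    then have "al n \<le> slack al lam n x z"
      using asc n assms(1) unfolding ascent_def by (metis (no_types, lifting))
    then show ?thesis using True by (simp add: slack_Suc)
  qed (use n in \<open>simp add: slack_Suc\<close>)
qed

lemma al_nonneg: "y < q \<Longrightarrow> 0 \<le> al y"
  using asc slack_nonneg[of _ _ y] unfolding ascent_def by (metis less_imp_le order_refl)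

lemma al_zero: "y < q \<Longrightarrow> y \<notin> U \<Longrightarrow> al y = 0"
  using asc unfolding ascent_def by metis

lemma slack_antimono:
  assumes "m \<le> n" "n \<le> q"
  shows "slack al lam n x z \<le> slack al lam m x z"
  using assms
proof (induction n rule: dec_induct)
  case (step n)
  then show ?case using al_nonneg[of n] by (auto simp: slack_Suc)
qed simp

text \<open>The ball that stops y has slack 0 right after y, and clients raised later only lower
  slacks.\<close>

lemma tight_ex:
  assumes "y < q" "y \<in> U" "\<exists>x z. valid x z \<and> d x y \<le> d x z"
  shows "\<exists>x z. tight al lam x z \<and> d x y \<le> d x z"
proof -
  obtain x z where xz: "valid x z" "d x y \<le> d x z" "al y = slack al lam y x z"
    using asc assms unfolding ascent_def by metis
  then have "slack al lam (Suc y) x z \<le> 0" by (simp add: slack_Suc)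
  then have "slack al lam q x z \<le> 0" using slack_antimono[of "Suc y" q x z] assms(1) by simp
  then show ?thesis using xz by (auto simp: tight_def)
qed

end

text \<open>In one run client y is bounded by the slack of the ball that stops it in the other run.
  That slack moves by the change of \<open>lam\<close> plus the changes of the earlier clients, and
  1 + (1 + 2 + ... + 2^(y-1)) = 2^y.\<close>

lemma ascent_lipschitz:
  assumes "ascent lam al" "ascent lam' al'" "y < q"
  shows "\<bar>al y - al' y\<bar> \<le> 2 ^ y * \<bar>lam - lam'\<bar>"
  using assms(3)
proof (induction y rule: less_induct)
  case (less y)
  have one: "b y - a y \<le> 2 ^ y * \<bar>lam - lam'\<bar>"
    if a: "ascent l a" and b: "ascent l' b" and l: "\<bar>l - l'\<bar> = \<bar>lam - lam'\<bar>"
      and IH: "\<And>y'. y' < y \<Longrightarrow> \<bar>a y' - b y'\<bar> \<le> 2 ^ y' * \<bar>lam - lam'\<bar>" for l l' a b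
  proof (cases "y \<in> U \<and> (\<exists>x z. valid x z \<and> d x y \<le> d x z)")
    case True
    then obtain x z where xz: "valid x z" "d x y \<le> d x z" "a y = slack a l y x z"
      using a less.prems unfolding ascent_def by metis
    have "b y \<le> slack b l' y x z"
      using b less.prems xz True unfolding ascent_def by (metis (no_types, lifting))
    then have "b y - a y \<le> slack b l' y x z - slack a l y x z" using xz by simp
    also have "\<dots> = (l' - l) + (\<Sum>y'<y. (if d x y' \<le> d x z then a y' - b y' else 0))"
    proof -
      have "(\<Sum>y'<y. (if d x y' \<le> d x z then a y' - b y' else 0)) =
          (\<Sum>y'<y. (if d x y' \<le> d x z then a y' else 0) - (if d x y' \<le> d x z then b y' else 0))"
        by (rule sum.cong) auto
      then show ?thesis by (simp add: slack_def sum_subtractf)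
    qed
    also have "\<dots> \<le> \<bar>lam - lam'\<bar> + (\<Sum>y'<y. 2 ^ y' * \<bar>lam - lam'\<bar>)"
    proof (intro add_mono sum_mono)
      fix y' assume "y' \<in> {..<y}"
      then show "(if d x y' \<le> d x z then a y' - b y' else 0) \<le> 2 ^ y' * \<bar>lam - lam'\<bar>"
        using IH[of y'] by auto
    qed (use l in auto)
    also have "(\<Sum>y'<y. 2 ^ y' * \<bar>lam - lam'\<bar>) = (2 ^ y - 1) * \<bar>lam - lam'\<bar>"
      using geometric_sum[of "2::real" y] by (simp add: sum_distrib_right[symmetric])
    finally show ?thesis by (simp add: algebra_simps)
  next
    case False
    then have "a y = 0" "b y = 0" using a b less.prems unfolding ascent_def by metis+
    then show ?thesis by simp
  qed
  have IH: "\<bar>al y' - al' y'\<bar> \<le> 2 ^ y' * \<bar>lam - lam'\<bar>" if "y' < y" for y'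
    using less.IH[OF that] that less.prems by simp
  have "al' y - al y \<le> 2 ^ y * \<bar>lam - lam'\<bar>"
    using one[OF assms(1,2)] IH by simp
  moreover have "al y - al' y \<le> 2 ^ y * \<bar>lam - lam'\<bar>"
    using one[OF assms(2,1)] IH by (simp add: abs_minus_commute)
  ultimately show ?case by linarith
qed

text \<open>Disjointness as sets of clients: this is what reserves clients for lower bounds and lets
  every dual value be charged only once.\<close>

definition disjoint_balls :: "nat set \<Rightarrow> (nat \<Rightarrow> real) \<Rightarrow> bool" where
  "disjoint_balls X r \<longleftrightarrow> (\<forall>x\<in>X. \<forall>x'\<in>X. x \<noteq> x' \<longrightarrow> ball x (r x) \<inter> ball x' (r x') = {})"

lemma packing:
  fixes al c r :: "nat \<Rightarrow> real"
  assumes "finite X" "disjoint_balls X r" "\<And>y. y < q \<Longrightarrow> 0 \<le> al y"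
    and "\<And>x. x \<in> X \<Longrightarrow> c x \<le> sum al (ball x (r x))"
  shows "sum c X \<le> sum al {..<q}"
proof -
  have "sum c X \<le> (\<Sum>x\<in>X. sum al (ball x (r x)))" by (rule sum_mono) (rule assms(4))
  also have "\<dots> = sum al (\<Union>x\<in>X. ball x (r x))"
    using assms(1,2) by (subst sum.UNION_disjoint) (auto simp: disjoint_balls_def)
  also have "\<dots> \<le> sum al {..<q}" using assms(3) by (intro sum_mono2) (auto simp: ball_def)
  finally show ?thesis .
qed

text \<open>Certificate for a feasible solution of cost at most the sum of \<open>fr\<close>: the
  clients in the core of x go to x, the others to any centre whose final ball contains them. The
  cores alone meet the lower bounds.\<close>

definition admissible :: "nat set \<Rightarrow> (nat \<Rightarrow> real) \<Rightarrow> (nat \<Rightarrow> real) \<Rightarrow> bool" where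
  "admissible X cr fr \<longleftrightarrow> X \<subseteq> {..<p} \<and> disjoint_balls X cr \<and>
     (\<forall>x\<in>X. L x \<le> card (ball x (cr x)) \<and> 0 \<le> fr x \<and> cr x \<le> fr x) \<and>
     (\<forall>y<q. \<exists>x\<in>X. d x y \<le> fr x)"

end

text \<open>\<open>G\<close> is the disjoint subfamily of the guessed largest balls of a solution; \<open>Op\<close> are its
  remaining facilities, \<open>zs\<close> gives a client determining the radius.\<close>

locale guessed = cover_instance +
  fixes G :: "nat set" and rG :: "nat \<Rightarrow> real" and Op :: "nat set" and zs :: "nat \<Rightarrow> nat" and kk :: nat
  assumes R_nonneg: "0 \<le> R" and U_sub: "U \<subseteq> {..<q}"
    and G_sub: "G \<subseteq> {..<p}" and G_disjoint: "disjoint_balls G rG"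
    and G_radius: "x \<in> G \<Longrightarrow> R \<le> rG x" and G_core: "x \<in> G \<Longrightarrow> L x \<le> card (ball x (rG x))"
    and G_cover: "y < q \<Longrightarrow> y \<notin> U \<Longrightarrow> \<exists>x\<in>G. d x y \<le> 3 * rG x"
    and Op_finite: "finite Op" and Op_valid: "x \<in> Op \<Longrightarrow> valid x (zs x)"
    and Op_cover: "y \<in> U \<Longrightarrow> \<exists>x\<in>Op. d x y \<le> d x (zs x)"
    and Op_kk: "card Op \<le> kk" and Op_q: "card Op \<le> q"
begin

definition S where "S = (\<Sum>x\<in>Op. d x (zs x))"

lemma S_nonneg: "0 \<le> S"
  unfolding S_def using Op_valid d_nonneg by (intro sum_nonneg) (auto simp: valid_def)

text \<open>The dual vanishes outside U, the balls of the remaining facilities cover U, and each of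
  these balls is valid, so that its dual constraint holds.\<close>

lemma weak_duality:
  assumes "0 \<le> lam" "ascent lam al"
  shows "sum al {..<q} \<le> S + real (card Op) * lam"
proof -
  have "sum al {..<q} = sum al U"
    using U_sub al_zero[OF assms] by (intro sum.mono_neutral_right) auto
  also have "\<dots> \<le> sum al (\<Union>x\<in>Op. ball x (d x (zs x)))"
    using Op_finite Op_cover U_sub al_nonneg[OF assms]
    by (intro sum_mono2) (fastforce simp: ball_def)+
  also have "\<dots> \<le> (\<Sum>x\<in>Op. sum al (ball x (d x (zs x))))"
    using Op_finite
  proof (induction Op rule: finite_induct)
    case (insert x X)
    let ?V = "\<Union>x\<in>X. ball x (d x (zs x))"
    have "sum al (ball x (d x (zs x)) \<union> ?V) + sum al (ball x (d x (zs x)) \<inter> ?V) =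
        sum al (ball x (d x (zs x))) + sum al ?V"
      using insert by (intro sum.union_inter) auto
    moreover have "0 \<le> sum al (ball x (d x (zs x)) \<inter> ?V)"
      using al_nonneg[OF assms] by (intro sum_nonneg) (auto simp: ball_def)
    ultimately show ?case using insert by simp
  qed simp
  also have "\<dots> \<le> (\<Sum>x\<in>Op. d x (zs x) + lam)"
  proof (rule sum_mono)
    fix x assume "x \<in> Op"
    then show "sum al (ball x (d x (zs x))) \<le> d x (zs x) + lam"
      using slack_nonneg[OF assms Op_valid[of x], of q] by (simp add: slack_q)
  qed
  also have "\<dots> = S + real (card Op) * lam" by (simp add: S_def sum.distrib)
  finally show ?thesis .
qed

text \<open>The loss from accounting at multiplier \<open>lo\<close> for balls tight at
  \<open>hi\<close>: q (hi - lo) from at most q multiplier terms, and 2^q (hi - lo) from the sum of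
  the Lipschitz bounds of all clients.\<close>

definition err :: "real \<Rightarrow> real \<Rightarrow> real" where
  "err lo hi = (real q + 2 ^ q) * (hi - lo)"

lemma err_nonneg: "lo \<le> hi \<Longrightarrow> 0 \<le> err lo hi"
  by (simp add: err_def)

text \<open>The extended family mixes balls tight at \<open>hi\<close> with balls tight at
  \<open>lo\<close>. The weight \<open>al2 y + \<bar>al y - al2 y\<bar>\<close> dominates both
  duals, so one packing argument pays for all of them, and its excess over \<open>al2\<close> is
  controlled by the Lipschitz bounds.\<close>

lemma mixed_packing:
  assumes lo: "0 \<le> lo" "ascent lo al" and hi: "lo \<le> hi" "ascent hi al2"
    and X: "finite X" "disjoint_balls X r"
    and t: "\<And>x. x \<in> X \<Longrightarrow> \<exists>z. r x = d x z \<and> (tight al lo x z \<or> tight al2 hi x z)"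
  shows "sum r X + real (card X) * lo \<le> S + real (card Op) * lo + err lo hi"
proof -
  have hi0: "0 \<le> hi" using lo hi by simp
  let ?c = "\<lambda>y. al2 y + \<bar>al y - al2 y\<bar>"
  have lip: "\<bar>al y - al2 y\<bar> \<le> 2 ^ y * (hi - lo)" if "y < q" for y
    using ascent_lipschitz[OF lo(2) hi(2) that] hi(1) by simp
  have "sum r X + real (card X) * lo = (\<Sum>x\<in>X. r x + lo)" by (simp add: sum.distrib)
  also have "\<dots> \<le> sum ?c {..<q}"
  proof (rule packing[OF X])
    show "0 \<le> ?c y" if "y < q" for y using al_nonneg[OF hi0 hi(2) that] by simp
    fix x assume "x \<in> X"
    then obtain z where z: "r x = d x z" "tight al lo x z \<or> tight al2 hi x z" using t by blast
    have "sum al (ball x (r x)) \<le> sum ?c (ball x (r x))" "sum al2 (ball x (r x)) \<le> sum ?c (ball x (r x))"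
      by (intro sum_mono; linarith)+
    then show "r x + lo \<le> sum ?c (ball x (r x))"
      using z hi(1) by (auto simp: tight_def slack_q)
  qed
  also have "\<dots> = sum al2 {..<q} + (\<Sum>y<q. \<bar>al y - al2 y\<bar>)" by (simp add: sum.distrib)
  also have "\<dots> \<le> (S + real (card Op) * hi) + (\<Sum>y<q. 2 ^ y * (hi - lo))"
    using weak_duality[OF hi0 hi(2)] lip by (intro add_mono sum_mono) auto
  also have "(\<Sum>y<q. 2 ^ y * (hi - lo)) = (2 ^ q - 1) * (hi - lo)"
    using geometric_sum[of "2::real" q] by (simp add: sum_distrib_right[symmetric])
  also have "S + real (card Op) * hi + (2 ^ q - 1) * (hi - lo) \<le> S + real (card Op) * lo + err lo hi"
  proof -
    have "real (card Op) * (hi - lo) \<le> q * (hi - lo)" using Op_q hi(1) by (intro mult_right_mono) auto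
    then show ?thesis using hi(1) by (simp add: err_def algebra_simps)
  qed
  finally show ?thesis by simp
qed

text \<open>The last conjunct records the greedy choice by decreasing radius: each tight ball is
  blocked by a chosen ball that is at least as large.\<close>

definition selection :: "real \<Rightarrow> (nat \<Rightarrow> real) \<Rightarrow> nat set \<Rightarrow> (nat \<Rightarrow> real) \<Rightarrow> bool" where
  "selection lam al X r \<longleftrightarrow> G \<subseteq> X \<and> X \<subseteq> {..<p} \<and> (\<forall>x\<in>G. r x = rG x) \<and> disjoint_balls X r \<and>
     (\<forall>x\<in>X - G. \<exists>z. r x = d x z \<and> tight al lam x z) \<and>
     (\<forall>x z. tight al lam x z \<longrightarrow> (\<exists>x'\<in>X. ball x (d x z) \<inter> ball x' (r x') \<noteq> {} \<and> d x z \<le> r x'))"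

definition covering :: "nat set \<Rightarrow> (nat \<Rightarrow> real) \<Rightarrow> bool" where
  "covering X r \<longleftrightarrow> G \<subseteq> X \<and> X \<subseteq> {..<p} \<and> (\<forall>x\<in>G. r x = rG x) \<and> disjoint_balls X r \<and>
     (\<forall>x\<in>X - G. \<exists>z. r x = d x z \<and> valid x z) \<and> (\<forall>y<q. \<exists>x\<in>X. d x y \<le> 3 * r x)"

text \<open>A client of U lies in a tight ball, which meets a chosen ball that is no smaller. The
  path through a common client has length at most three chosen radii. The other clients are within
  tripled guessed balls.\<close>

lemma selection_covering:
  assumes lam: "0 \<le> lam" "ascent lam al" and sel: "selection lam al X r"
  shows "covering X r"
proof -
  have "\<exists>x\<in>X. d x y \<le> 3 * r x" if y: "y < q" for y
  proof (cases "y \<in> U")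
    case False
    then obtain x where "x \<in> G" "d x y \<le> 3 * rG x" using G_cover y by blast
    then show ?thesis using sel by (intro bexI[of _ x]) (auto simp: selection_def)
  next
    case True
    then have "\<exists>x z. valid x z \<and> d x y \<le> d x z" using Op_cover Op_valid by blast
    then obtain x z where xz: "tight al lam x z" "d x y \<le> d x z" using tight_ex[OF lam y True] by blast
    then obtain x' w where x': "x' \<in> X" "w \<in> ball x (d x z)" "w \<in> ball x' (r x')" "d x z \<le> r x'"
      using sel unfolding selection_def by blast
    have "x < p" "x' < p" using xz x' sel by (auto simp: tight_def valid_def selection_def)
    then have "d x' y \<le> d x' w + d x w + d x y" using d_triangle y x' by (auto simp: ball_def)
    also have "\<dots> \<le> 3 * r x'" using xz x' by (auto simp: ball_def)
    finally show ?thesis using x' by blast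
  qed
  then show ?thesis using sel by (auto simp: selection_def covering_def tight_def)
qed

lemma covering_valid: "covering X r \<Longrightarrow> x \<in> X \<Longrightarrow> x \<notin> G \<Longrightarrow> \<exists>z. r x = d x z \<and> valid x z"
  by (simp add: covering_def)

lemma covering_radius:
  assumes "covering X r" "x \<in> X"
  shows "0 \<le> r x" "x \<notin> G \<Longrightarrow> r x \<le> R" "L x \<le> card (ball x (r x))" "x < p"
proof -
  show "0 \<le> r x"
  proof (cases "x \<in> G")
    case True
    then have "r x = rG x" using assms by (simp add: covering_def)
    then show ?thesis using G_radius[OF True] R_nonneg by simp
  next
    case False
    then obtain z where "r x = d x z" "valid x z" using covering_valid[OF assms] by blast
    then show ?thesis using d_nonneg[of x z] by (simp add: valid_def)
  qed
  show "r x \<le> R" if xG: "x \<notin> G"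
  proof -
    obtain z where "r x = d x z" "valid x z" using covering_valid[OF assms xG] by blast
    then show ?thesis by (simp add: valid_def)
  qed
  show "L x \<le> card (ball x (r x))"
  proof (cases "x \<in> G")
    case False
    then obtain z where "r x = d x z" "valid x z" using covering_valid[OF assms] by blast
    then show ?thesis by (simp add: valid_def)
  qed (use assms G_core in \<open>simp add: covering_def\<close>)
  show "x < p" using assms unfolding covering_def by blast
qed

lemma covering_admissible: "covering X r \<Longrightarrow> admissible X r (\<lambda>x. 3 * r x)"
  using covering_radius[of X r] by (auto simp: admissible_def covering_def)

lemma covering_extend:
  assumes "covering X r" "X \<subseteq> Y" "Y \<subseteq> {..<p}" "\<And>x. x \<in> X \<Longrightarrow> r' x = r x" "disjoint_balls Y r'"
    "\<And>x. x \<in> Y - X \<Longrightarrow> \<exists>z. r' x = d x z \<and> valid x z"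
  shows "covering Y r'"
  unfolding covering_def
proof (intro conjI ballI allI impI)
  fix x assume x: "x \<in> Y - G"
  show "\<exists>z. r' x = d x z \<and> valid x z"
  proof (cases "x \<in> X")
    case True
    then show ?thesis using x assms(1,4) by (auto simp: covering_def)
  qed (use x assms(6) in auto)
next
  fix y assume "y < q"
  then obtain x where "x \<in> X" "d x y \<le> 3 * r x" using assms(1) by (auto simp: covering_def)
  then show "\<exists>x\<in>Y. d x y \<le> 3 * r' x" using assms(2,4) by (intro bexI[of _ x]) auto
qed (use assms in \<open>auto simp: covering_def\<close>)

section \<open>Merging groups of balls\<close>

text \<open>A ball may replace all balls of \<open>A\<close> that meet a ball \<open>b\<close> of \<open>B\<close>: \<open>gp\<close> assigns to each ball
  of \<open>A\<close> such a \<open>b\<close>, the groups in \<open>M\<close> are merged, and \<open>fm b\<close> is the new centre for group \<open>b\<close>.\<close>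

definition members :: "nat set \<Rightarrow> (nat \<Rightarrow> nat) \<Rightarrow> nat \<Rightarrow> nat set" where
  "members A gp b = {a \<in> A - G. gp a = b}"

definition merge_cost :: "nat set \<Rightarrow> (nat \<Rightarrow> nat) \<Rightarrow> (nat \<Rightarrow> real) \<Rightarrow> (nat \<Rightarrow> real) \<Rightarrow> nat \<Rightarrow> real" where
  "merge_cost A gp rA rB b = 2 * rB b + sum rA (members A gp b)"

text \<open>The path from the new centre a' through b and a to a client within
  \<open>3 * rA a\<close> of a has length at most \<open>rA a' + 2 * rB b + 4 * rA a\<close>. The
  first bound exceeds three times the radii of the group by exactly \<open>merge_cost\<close>. The
  second bound holds because all radii involved are at most R; it serves the one group whose cost is
  not amortised.\<close>

definition merged_radius :: "nat set \<Rightarrow> (nat \<Rightarrow> nat) \<Rightarrow> (nat \<Rightarrow> real) \<Rightarrow> (nat \<Rightarrow> real) \<Rightarrow> nat \<Rightarrow> real" where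
  "merged_radius A gp rA rB b = min (2 * rB b + 4 * sum rA (members A gp b)) (7 * R)"

definition kept :: "nat set \<Rightarrow> (nat \<Rightarrow> nat) \<Rightarrow> nat set \<Rightarrow> (nat \<Rightarrow> nat) \<Rightarrow> nat set" where
  "kept A gp M fm = G \<union> {a \<in> A - G. gp a \<notin> M \<or> a = fm (gp a)}"

definition kept_radius :: "nat set \<Rightarrow> (nat \<Rightarrow> nat) \<Rightarrow> (nat \<Rightarrow> real) \<Rightarrow> (nat \<Rightarrow> real) \<Rightarrow> nat set \<Rightarrow> nat \<Rightarrow> real" where
  "kept_radius A gp rA rB M a = (if a \<in> G \<or> gp a \<notin> M then 3 * rA a else merged_radius A gp rA rB (gp a))"

context
  fixes A B :: "nat set" and rA rB :: "nat \<Rightarrow> real" and gp :: "nat \<Rightarrow> nat"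
  assumes A: "covering A rA" and B: "covering B rB"
    and gp: "\<And>a. a \<in> A - G \<Longrightarrow> gp a \<in> B - G \<and> ball a (rA a) \<inter> ball (gp a) (rB (gp a)) \<noteq> {}"
begin

lemma finite_A: "finite A" and finite_B: "finite B"
  using A B finite_subset[of _ "{..<p}"] by (auto simp: covering_def)

lemma rA_le_sum: "a \<in> A - G \<Longrightarrow> rA a \<le> sum rA (members A gp (gp a))"
  using finite_A covering_radius(1)[OF A] by (intro member_le_sum) (auto simp: members_def)

lemma two_rA_le_sum: "a \<in> A - G \<Longrightarrow> a' \<in> A - G \<Longrightarrow> gp a' = gp a \<Longrightarrow> a \<noteq> a' \<Longrightarrow>
    rA a + rA a' \<le> sum rA (members A gp (gp a))"
  using sum_mono2[of "members A gp (gp a)" "{a, a'}" rA] finite_A covering_radius(1)[OF A]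
  by (auto simp: members_def)

text \<open>Merging leaves the cores of the surviving centres as they were, hence disjoint and large
  enough. Only the final radius grows, until the new centre reaches every client that a closed
  centre of its group reached.\<close>

lemma kept_admissible:
  assumes fm: "\<And>a. a \<in> A - G \<Longrightarrow> fm (gp a) \<in> A - G \<and> gp (fm (gp a)) = gp a"
  shows "admissible (kept A gp M fm) rA (kept_radius A gp rA rB M)"
  unfolding admissible_def
proof (intro conjI ballI allI impI)
  have sub: "kept A gp M fm \<subseteq> A" using A by (auto simp: kept_def covering_def)
  show "kept A gp M fm \<subseteq> {..<p}" using sub A by (auto simp: covering_def)
  show "disjoint_balls (kept A gp M fm) rA"
    using sub A unfolding covering_def disjoint_balls_def by blast
  fix x assume "x \<in> kept A gp M fm"
  then have x: "x \<in> A" using sub by blast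
  show "L x \<le> card (ball x (rA x))" using covering_radius(3)[OF A x] .
  have le: "rA x \<le> kept_radius A gp rA rB M x"
  proof (cases "x \<in> G \<or> gp x \<notin> M")
    case True
    then show ?thesis using covering_radius(1)[OF A x] by (auto simp: kept_radius_def)
  next
    case False
    then have "0 \<le> rB (gp x)" using gp[of x] x covering_radius(1)[OF B] by auto
    then show ?thesis
      using False x rA_le_sum[of x] covering_radius(1,2)[OF A x] R_nonneg
      by (auto simp: kept_radius_def merged_radius_def)
  qed
  then show "rA x \<le> kept_radius A gp rA rB M x" .
  show "0 \<le> kept_radius A gp rA rB M x" using le covering_radius(1)[OF A x] by simp
next
  fix y assume y: "y < q"
  then obtain a where a: "a \<in> A" "d a y \<le> 3 * rA a" using A by (auto simp: covering_def)
  show "\<exists>x\<in>kept A gp M fm. d x y \<le> kept_radius A gp rA rB M x"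
  proof (cases "a \<in> G \<or> gp a \<notin> M")
    case True
    then have "a \<in> kept A gp M fm" "kept_radius A gp rA rB M a = 3 * rA a"
      using a by (auto simp: kept_def kept_radius_def)
    then show ?thesis using a by (intro bexI[of _ a]) auto
  next
    case False
    define b a' where "b = gp a" and "a' = fm b"
    have aG: "a \<in> A - G" using a False by blast
    then have a': "a' \<in> A - G" "gp a' = b" using fm by (auto simp: b_def a'_def)
    have b: "b \<in> B" "b \<notin> G" using gp[OF aG] by (auto simp: b_def)
    obtain w where w: "w \<in> ball a (rA a)" "w \<in> ball b (rB b)" using gp[OF aG] by (auto simp: b_def)
    obtain w' where w': "w' \<in> ball a' (rA a')" "w' \<in> ball b (rB b)" using gp[OF a'(1)] a'(2) by auto
    have lt: "a < p" "a' < p" "b < p" using covering_radius(4)[OF A] covering_radius(4)[OF B] a' aG b by auto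
    have "d a' y \<le> d a' w' + d b w' + d b y" "d b y \<le> d b w + d a w + d a y"
      using d_triangle lt w w' y by (auto simp: ball_def)
    then have dist: "d a' y \<le> rA a' + 2 * rB b + 4 * rA a" using w w' a by (auto simp: ball_def)
    have R: "rA a' \<le> R" "rA a \<le> R" "rB b \<le> R" "0 \<le> rB b" "0 \<le> rA a" "0 \<le> rA a'"
      using covering_radius(1,2)[OF A] covering_radius(1,2)[OF B] a' aG b by auto
    have s: "rA a \<le> sum rA (members A gp b)" using rA_le_sum[OF aG] by (simp add: b_def)
    have "d a' y \<le> 2 * rB b + 4 * sum rA (members A gp b)"
    proof (cases "a = a'")
      case True
      then show ?thesis using a(2) R s by simp
    next
      case False
      then show ?thesis using dist two_rA_le_sum[OF aG a'(1)] a'(2) R by (simp add: b_def)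
    qed
    moreover have "d a' y \<le> 7 * R" using dist R by linarith
    moreover have "a' \<in> kept A gp M fm" using a' by (auto simp: kept_def a'_def b_def)
    moreover have "kept_radius A gp rA rB M a' = merged_radius A gp rA rB b"
      using a' False by (auto simp: kept_radius_def b_def)
    ultimately show ?thesis by (intro bexI[of _ a']) (auto simp: merged_radius_def)
  qed
qed

text \<open>Merging a group of c balls frees c - 1 centres, and |A| - (|G| + kk) centres must be
  freed. All groups together can free at least |A| - |B|, so by \<open>knapsack_prefix\<close> the
  merged groups other than u cost at most the fraction t of the total merge cost. The group u is
  charged \<open>7 * R\<close> instead.\<close>

lemma merge_exists:
  assumes N: "card G + kk < card A" "card B < card G + kk"
    and fm: "\<And>a. a \<in> A - G \<Longrightarrow> fm (gp a) \<in> A - G \<and> gp (fm (gp a)) = gp a"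
    and \<kappa>: "\<And>b. \<kappa> b = merge_cost A gp rA rB b / (real (card (members A gp b)) - 1)"
    and M: "\<And>u. M u = {b \<in> B - G. 2 \<le> card (members A gp b) \<and> (\<kappa> b < \<kappa> u \<or> \<kappa> b = \<kappa> u \<and> b \<le> u)}"
    and t: "t = (real (card A) - real (card G + kk)) / (real (card A) - real (card B))"
  shows "\<exists>u\<in>B - G. card (kept A gp (M u) fm) \<le> card G + kk \<and>
     sum (kept_radius A gp rA rB (M u)) (kept A gp (M u) fm) \<le>
       3 * sum rG G + 3 * sum rA (A - G) + t * (2 * sum rB (B - G) + sum rA (A - G)) + 7 * R"
proof -
  define c where "c b = card (members A gp b)" for b
  define T where "T = {b \<in> B - G. 2 \<le> c b}"
  define N where "N = card A - (card G + kk)"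
  let ?s = "\<lambda>b. c b - 1" and ?w = "merge_cost A gp rA rB"
  have fin: "finite T" "finite (B - G)" "finite (A - G)" "finite G" "\<And>b. finite (members A gp b)"
    using finite_A finite_B G_sub finite_subset[of G "{..<p}"] by (auto simp: T_def members_def)
  have GA: "G \<subseteq> A" "G \<subseteq> B" using A B by (auto simp: covering_def)
  have mem: "sum f (A - G) = (\<Sum>b\<in>B - G. sum f (members A gp b))" for f :: "nat \<Rightarrow> real"
  proof -
    have "gp ` (A - G) \<subseteq> B - G" using gp by blast
    then show ?thesis using sum.group[of "A - G" "B - G" gp f] fin by (simp add: members_def)
  qed
  have cA: "card (A - G) = (\<Sum>b\<in>B - G. c b)"
    using mem[of "\<lambda>_. 1"] by (simp add: c_def flip: of_nat_sum)
  have cards: "card A = card (A - G) + card G" "card B = card (B - G) + card G"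
    using GA finite_A finite_B by (simp_all add: card_Diff_subset card_mono finite_subset)
  \<comment> \<open>A group of size 0 or 1 frees nothing; the summand 1 per ball of B - G accounts
    for it and for the survivor of each larger group.\<close>
  have "(\<Sum>b\<in>B - G. c b) \<le> (\<Sum>b\<in>B - G. (if 2 \<le> c b then ?s b else 0) + 1)"
    by (intro sum_mono) auto
  also have "\<dots> = (\<Sum>b\<in>B - G. if 2 \<le> c b then ?s b else 0) + card (B - G)" unfolding sum.distrib by simp
  also have "(\<Sum>b\<in>B - G. if 2 \<le> c b then ?s b else 0) = sum ?s T"
    unfolding T_def using fin by (subst sum.inter_filter) auto
  finally have sT: "card A - card B \<le> sum ?s T" using cA cards by linarith
  have wpos: "0 \<le> ?w b" if "b \<in> B" for b
    using covering_radius(1)[OF B that] covering_radius(1)[OF A]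
    by (auto simp: merge_cost_def members_def intro!: add_nonneg_nonneg sum_nonneg)
  have \<kappa>': "\<kappa> b = ?w b / ?s b" if "1 \<le> c b" for b
    using that \<kappa>[of b] by (simp add: c_def of_nat_diff)
  define le where "le b u \<longleftrightarrow> ?w b / ?s b < ?w u / ?s u \<or> ?w b / ?s b = ?w u / ?s u \<and> b \<le> u" for b u
  obtain u where u: "u \<in> T" "N \<le> sum ?s {b \<in> T. le b u}"
      "sum ?w ({b \<in> T. le b u} - {u}) * real (sum ?s T) \<le> real N * sum ?w T"
    using knapsack_prefix[OF fin(1), of ?s N le ?w] N sT wpos unfolding le_def T_def N_def by fastforce
  define V where "V = M u"
  have V: "V = {b \<in> T. le b u}"
    using u(1) \<kappa>' by (auto simp: V_def M T_def le_def c_def[symmetric])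
  have finV: "finite V" and VB: "V \<subseteq> B - G" and uV: "u \<in> V"
    using fin u(1) by (auto simp: V T_def le_def)
  have pos: "0 < real (card A) - real (card B)" using N by simp
  have wT: "sum ?w T \<le> 2 * sum rB (B - G) + sum rA (A - G)"
  proof -
    have "sum ?w T \<le> sum ?w (B - G)" using fin wpos by (intro sum_mono2) (auto simp: T_def)
    also have "\<dots> = 2 * sum rB (B - G) + sum rA (A - G)"
      by (simp add: merge_cost_def sum.distrib sum_distrib_left mem)
    finally show ?thesis .
  qed
  have wV: "sum ?w (V - {u}) \<le> t * (2 * sum rB (B - G) + sum rA (A - G))"
  proof -
    have w0: "0 \<le> sum ?w (V - {u})" using wpos VB by (intro sum_nonneg) auto
    have "real (card A) - real (card B) \<le> real (sum ?s T)" using sT by linarith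
    then have "sum ?w (V - {u}) * (real (card A) - real (card B)) \<le> sum ?w (V - {u}) * real (sum ?s T)"
      using w0 by (rule mult_left_mono)
    also have "\<dots> \<le> real N * sum ?w T" using u(3) by (simp add: V)
    also have "\<dots> \<le> real N * (2 * sum rB (B - G) + sum rA (A - G))" using wT by (intro mult_left_mono) auto
    also have "real N = t * (real (card A) - real (card B))" using pos N by (simp add: t N_def of_nat_diff)
    finally have "sum ?w (V - {u}) * (real (card A) - real (card B)) \<le>
        t * (2 * sum rB (B - G) + sum rA (A - G)) * (real (card A) - real (card B))" by (simp add: mult_ac)
    then show ?thesis using pos by simp
  qed
  let ?K = "{a \<in> A - G. gp a \<notin> V}"
  have mV: "members A gp b \<noteq> {}" if "b \<in> V" for b
    using that by (auto simp: V T_def c_def)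
  have gpfm: "gp (fm b) = b" "fm b \<in> A - G" if bV: "b \<in> V" for b
  proof -
    obtain a where "a \<in> A - G" "gp a = b" using mV[OF bV] by (auto simp: members_def)
    then show "gp (fm b) = b" "fm b \<in> A - G" using fm by auto
  qed
  have inj: "inj_on fm V" using gpfm by (metis inj_onI)
  have kept: "kept A gp V fm = G \<union> ?K \<union> fm ` V"
    using gpfm by (auto simp: kept_def)
  have disj: "G \<inter> ?K = {}" "(G \<union> ?K) \<inter> fm ` V = {}" using gpfm by auto
  have finK: "finite ?K" using fin by simp
  have K: "sum f (A - G) = sum f ?K + (\<Sum>b\<in>V. sum f (members A gp b))" for f :: "nat \<Rightarrow> real"
  proof -
    have "sum f (A - G) = sum f ?K + sum f {a \<in> A - G. gp a \<in> V}"
      using fin by (subst sum.union_disjoint[symmetric]) (auto intro!: sum.cong)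
    also have "sum f {a \<in> A - G. gp a \<in> V} = (\<Sum>b\<in>V. sum f {a \<in> {a \<in> A - G. gp a \<in> V}. gp a = b})"
      using finV fin by (intro sum.group[symmetric]) auto
    also have "\<dots> = (\<Sum>b\<in>V. sum f (members A gp b))"
      by (intro sum.cong) (auto simp: members_def intro!: arg_cong[of _ _ "sum f"])
    finally show ?thesis .
  qed
  have "real (card (A - G)) = real (card ?K) + real (\<Sum>b\<in>V. c b)"
    using K[of "\<lambda>_. 1"] by (simp add: c_def)
  then have c1: "card (A - G) = card ?K + (\<Sum>b\<in>V. c b)" by linarith
  have "(\<Sum>b\<in>V. c b) = (\<Sum>b\<in>V. ?s b + 1)" by (intro sum.cong) (auto simp: V T_def)
  then have c2: "(\<Sum>b\<in>V. c b) = (\<Sum>b\<in>V. ?s b) + card V" unfolding sum.distrib by simp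
  have "card (kept A gp V fm) = card G + card ?K + card V"
    unfolding kept using disj fin finK finV inj by (simp add: card_Un_disjoint card_image)
  also have "\<dots> \<le> card G + kk" using c1 c2 u(2) cards N by (simp add: V N_def)
  finally have card: "card (kept A gp V fm) \<le> card G + kk" .
  let ?f = "kept_radius A gp rA rB V"
  have "sum ?f (kept A gp V fm) = sum ?f G + sum ?f ?K + sum ?f (fm ` V)"
    unfolding kept using disj fin finK finV by (simp add: sum.union_disjoint)
  also have "sum ?f G = 3 * sum rG G"
    unfolding sum_distrib_left using A by (intro sum.cong) (auto simp: kept_radius_def covering_def)
  also have "sum ?f ?K = 3 * sum rA ?K"
    unfolding sum_distrib_left by (intro sum.cong) (auto simp: kept_radius_def)
  also have "sum ?f (fm ` V) = (\<Sum>b\<in>V. merged_radius A gp rA rB b)"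
    unfolding sum.reindex[OF inj] using gpfm by (intro sum.cong) (auto simp: kept_radius_def)
  \<comment> \<open>For u the second bound in the minimum is used, for all other merged groups the
    first.\<close>
  also have "\<dots> \<le> (\<Sum>b\<in>V. 3 * sum rA (members A gp b)) + sum ?w (V - {u}) + 7 * R"
  proof -
    have "(\<Sum>b\<in>V. merged_radius A gp rA rB b) =
        merged_radius A gp rA rB u + (\<Sum>b\<in>V - {u}. merged_radius A gp rA rB b)"
      using finV uV by (rule sum.remove)
    also have "\<dots> \<le> 7 * R + (\<Sum>b\<in>V - {u}. 3 * sum rA (members A gp b) + ?w b)"
      by (intro add_mono sum_mono) (auto simp: merged_radius_def merge_cost_def)
    also have "\<dots> = 7 * R + (\<Sum>b\<in>V - {u}. 3 * sum rA (members A gp b)) + sum ?w (V - {u})"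
      by (simp add: sum.distrib)
    also have "(\<Sum>b\<in>V - {u}. 3 * sum rA (members A gp b)) \<le> (\<Sum>b\<in>V. 3 * sum rA (members A gp b))"
      using finV covering_radius(1)[OF A] by (intro sum_mono2) (auto simp: members_def intro!: sum_nonneg)
    finally show ?thesis by simp
  qed
  also have "3 * sum rG G + 3 * sum rA ?K + ((\<Sum>b\<in>V. 3 * sum rA (members A gp b)) + sum ?w (V - {u}) + 7 * R)
      = 3 * sum rG G + 3 * sum rA (A - G) + sum ?w (V - {u}) + 7 * R"
    using K[of rA] by (simp add: sum_distrib_left[symmetric])
  finally have "sum ?f (kept A gp V fm) \<le> 3 * sum rG G + 3 * sum rA (A - G) +
      t * (2 * sum rB (B - G) + sum rA (A - G)) + 7 * R" using wV by linarith
  then show ?thesis using card u(1) by (auto simp: V_def T_def)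
qed

end

lemma sum_split_G: "covering X r \<Longrightarrow> sum r X = sum rG G + sum r (X - G)"
  using finite_subset[of X "{..<p}"] sum.subset_diff[of G X r]
  by (auto simp: covering_def)

lemma card_split_G: "covering X r \<Longrightarrow> card X = card G + card (X - G)"
  using finite_subset[of X "{..<p}"] card_mono[of X G] finite_subset[of G X]
  by (auto simp: covering_def card_Diff_subset)

text \<open>The case \<open>lo = hi\<close> of \<open>mixed_packing\<close>, in which the error term
  vanishes.\<close>

lemma selection_packing:
  assumes lam: "0 \<le> lam" "ascent lam al" and sel: "selection lam al X r"
  shows "sum r (X - G) + real (card (X - G)) * lam \<le> S + real (card Op) * lam"
proof -
  have "finite (X - G)" "disjoint_balls (X - G) r"
    using sel finite_subset[of X "{..<p}"] by (auto simp: selection_def disjoint_balls_def)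
  then show ?thesis
    using mixed_packing[OF lam order_refl lam(2), of "X - G" r] sel by (auto simp: selection_def err_def)
qed

text \<open>More than |Op| balls would contribute at least (|Op| + 1) lam to the packing bound S +
  |Op| lam, although S is at most |Op| R and hence below lam. This provides a multiplier at which
  the family is small enough.\<close>

lemma selection_card:
  assumes lam: "ascent lam al" and sel: "selection lam al X r" and big: "real (card Op) * R < lam"
  shows "card (X - G) \<le> card Op"
proof -
  have 0: "0 \<le> real (card Op) * R" using R_nonneg by simp
  then have lam0: "0 < lam" using big by linarith
  have "S \<le> real (card Op) * R"
    unfolding S_def using Op_valid by (intro sum_bounded_above) (auto simp: valid_def)
  moreover have "0 \<le> sum r (X - G)"
    using covering_radius(1)[OF selection_covering[OF _ lam sel]] lam0 by (intro sum_nonneg) auto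
  ultimately have "real (card (X - G)) * lam < (real (card Op) + 1) * lam"
    using selection_packing[OF _ lam sel] lam0 big by (simp add: algebra_simps)
  then show ?thesis using lam0 by simp
qed

lemma selection_empty:
  assumes "ascent lam al" "selection lam al X r" "0 < lam" "Op = {}"
  shows "card (X - G) = 0"
  using selection_card[OF assms(1,2)] assms(3,4) by simp

text \<open>If B uses the budget exactly, both sides of its packing bound contain the same multiple
  of \<open>lo\<close>, and tripling B costs at most 3 (S + err) outside G. Otherwise every ball of
  A meets B, so the groups exhaust A - G, and the better of tripling and merging is given by
  \<open>bipoint_min\<close>.\<close>

lemma rounding:
  assumes lo: "0 \<le> lo" "ascent lo al" "selection lo al A rA"
    and hi: "lo \<le> hi" "ascent hi al2" "selection hi al2 B0 rB0"
    and cA: "card G + kk < card A"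
    and B: "B0 \<subseteq> B" "B \<subseteq> {..<p}" "\<And>x. x \<in> B0 \<Longrightarrow> rB x = rB0 x" "\<And>x. x \<in> B - B0 \<Longrightarrow> x \<in> A \<and> rB x = rA x"
      "disjoint_balls B rB" "card B \<le> card G + kk"
      "card B = card G + kk \<or> (\<forall>a\<in>A. \<exists>b\<in>B. ball a (rA a) \<inter> ball b (rB b) \<noteq> {})"
    and gp: "\<And>a b. a \<in> A - G \<Longrightarrow> b \<in> B - G \<Longrightarrow> ball a (rA a) \<inter> ball b (rB b) \<noteq> {} \<Longrightarrow>
      gp a \<in> B - G \<and> ball a (rA a) \<inter> ball (gp a) (rB (gp a)) \<noteq> {}"
    and fm: "\<And>a. a \<in> A - G \<Longrightarrow> fm (gp a) \<in> A - G \<and> gp (fm (gp a)) = gp a"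
    and \<kappa>: "\<And>b. \<kappa> b = merge_cost A gp rA rB b / (real (card (members A gp b)) - 1)"
    and M: "\<And>u. M u = {b \<in> B - G. 2 \<le> card (members A gp b) \<and> (\<kappa> b < \<kappa> u \<or> \<kappa> b = \<kappa> u \<and> b \<le> u)}"
  shows "covering B rB"
    and "3 * sum rB B \<le> 3 * sum rG G + 3.825 * (S + err lo hi) \<or>
      (\<exists>u<p. admissible (kept A gp (M u) fm) rA (kept_radius A gp rA rB (M u)) \<and>
        card (kept A gp (M u) fm) \<le> card G + kk \<and>
        sum (kept_radius A gp rA rB (M u)) (kept A gp (M u) fm) \<le>
          3 * sum rG G + 3.825 * (S + err lo hi) + 7 * R)"
proof -
  have hi0: "0 \<le> hi" using lo hi by simp
  have covA: "covering A rA" using selection_covering[OF lo] .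
  have covB0: "covering B0 rB0" using selection_covering[OF hi0 hi(2,3)] .
  have GB: "G \<subseteq> B0" "G \<subseteq> A" "\<And>x. x \<in> G \<Longrightarrow> rB x = rG x" "\<And>x. x \<in> G \<Longrightarrow> rA x = rG x"
    using covB0 covA B(3) by (auto simp: covering_def)
  have tB: "\<exists>z. rB x = d x z \<and> (tight al lo x z \<or> tight al2 hi x z)" if "x \<in> B - G" for x
  proof (cases "x \<in> B0")
    case True
    then show ?thesis using hi(3) that B(3) unfolding selection_def by (metis DiffD2 DiffI)
  next
    case False
    then show ?thesis using lo(3) that B(4)[of x] unfolding selection_def by (metis DiffD1 DiffD2 DiffI)
  qed
  show covB: "covering B rB"
  proof (rule covering_extend[OF covB0 B(1,2)])
    fix x assume "x \<in> B - B0"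
    then have "x \<in> B - G" using GB by blast
    then show "\<exists>z. rB x = d x z \<and> valid x z" using tB by (auto simp: tight_def)
  qed (use B in auto)
  have finite: "finite (A - G)" "finite (B - G)"
    using covA B(2) finite_subset[of _ "{..<p}"] by (auto simp: covering_def)
  let ?e = "err lo hi" and ?C1 = "sum rA (A - G)" and ?C2 = "sum rB (B - G)"
  have e: "0 \<le> ?e" using err_nonneg[OF hi(1)] .
  have kk: "real (card Op) * lo \<le> real kk * lo" using Op_kk lo(1) by (intro mult_right_mono) auto
  have "?C2 + real (card (B - G)) * lo \<le> S + real (card Op) * lo + ?e"
    using tB B(5) finite by (intro mixed_packing[OF lo(1,2) hi(1,2)]) (auto simp: disjoint_balls_def)
  then have C2: "?C2 + real (card (B - G)) * lo \<le> S + real kk * lo + ?e" using kk by linarith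
  have C1: "?C1 + real (card (A - G)) * lo \<le> S + real kk * lo + ?e"
    using selection_packing[OF lo] kk e by linarith
  have nn: "0 \<le> ?C1" "0 \<le> ?C2"
    using covering_radius(1)[OF covA] covering_radius(1)[OF covB] by (auto intro!: sum_nonneg)
  have cards: "card A = card G + card (A - G)" "card B = card G + card (B - G)"
    using card_split_G[OF covA] card_split_G[OF covB] by auto
  show "3 * sum rB B \<le> 3 * sum rG G + 3.825 * (S + ?e) \<or>
      (\<exists>u<p. admissible (kept A gp (M u) fm) rA (kept_radius A gp rA rB (M u)) \<and>
        card (kept A gp (M u) fm) \<le> card G + kk \<and>
        sum (kept_radius A gp rA rB (M u)) (kept A gp (M u) fm) \<le>
          3 * sum rG G + 3.825 * (S + ?e) + 7 * R)"
  proof (cases "card B = card G + kk")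
    case True
    then have "?C2 \<le> S + ?e" using C2 cards by simp
    then show ?thesis using sum_split_G[OF covB] S_nonneg e by simp
  next
    case False
    then have cB: "card B < card G + kk" and meet: "\<And>a. a \<in> A \<Longrightarrow> \<exists>b\<in>B. ball a (rA a) \<inter> ball b (rB b) \<noteq> {}"
      using B(6,7) by auto
    have gp': "gp a \<in> B - G \<and> ball a (rA a) \<inter> ball (gp a) (rB (gp a)) \<noteq> {}" if a: "a \<in> A - G" for a
    proof -
      obtain b where b: "b \<in> B" "ball a (rA a) \<inter> ball b (rB b) \<noteq> {}" using meet a by blast
      \<comment> \<open>A ball of G belongs to A with the same radius, so it cannot meet another
        ball of A.\<close>
      have "b \<notin> G"
      proof
        assume "b \<in> G"
        then have "b \<in> A" "b \<noteq> a" "rB b = rA b" using GB a by auto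
        then show False using b covA a by (auto simp: covering_def disjoint_balls_def)
      qed
      then show ?thesis using gp[OF a] b by blast
    qed
    \<comment> \<open>The weight with (1 - t) |A - G| + t |B - G| = kk: in the corresponding
      combination of the two packing bounds the multiplier drops out.\<close>
    define t where "t = (real (card A) - real (card G + kk)) / (real (card A) - real (card B))"
    have pos: "0 < real (card A) - real (card B)" using cA cB by simp
    have t: "0 \<le> t" "t \<le> 1" using cA cB pos by (auto simp: t_def field_simps)
    obtain u where u: "u \<in> B - G" "card (kept A gp (M u) fm) \<le> card G + kk"
        "sum (kept_radius A gp rA rB (M u)) (kept A gp (M u) fm) \<le>
          3 * sum rG G + 3 * ?C1 + t * (2 * ?C2 + ?C1) + 7 * R"
      using merge_exists[OF covA covB gp' cA cB fm \<kappa> M t_def] by blast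
    have adm: "admissible (kept A gp (M u) fm) rA (kept_radius A gp rA rB (M u))"
      using kept_admissible[OF covA covB gp' fm] by blast
    have tk: "t * (real (card (A - G)) - real (card (B - G))) = real (card (A - G)) - real kk"
      using pos by (simp add: t_def cards)
    have "(1 - t) * (?C1 + real (card (A - G)) * lo) + t * (?C2 + real (card (B - G)) * lo) \<le>
        (1 - t) * (S + real kk * lo + ?e) + t * (S + real kk * lo + ?e)"
      by (intro add_mono[OF mult_left_mono[OF C1] mult_left_mono[OF C2]]) (use t in auto)
    also have "\<dots> = S + real kk * lo + ?e" by (simp add: algebra_simps)
    also have "(1 - t) * (?C1 + real (card (A - G)) * lo) + t * (?C2 + real (card (B - G)) * lo) =
        (1 - t) * ?C1 + t * ?C2 + (real (card (A - G)) - t * (real (card (A - G)) - real (card (B - G)))) * lo"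
      by (simp add: algebra_simps)
    finally have "(1 - t) * ?C1 + t * ?C2 \<le> S + ?e" unfolding tk by simp
    moreover have "3 * ?C2 \<le> 3.825 * ((1 - t) * ?C1 + t * ?C2) \<or>
        3 * ?C1 + t * (2 * ?C2 + ?C1) \<le> 3.825 * ((1 - t) * ?C1 + t * ?C2)"
      using bipoint_min[OF nn t] .
    moreover have "3.825 * z \<le> 3.825 * (S + ?e)" if "z \<le> S + ?e" for z :: real
      using that by simp
    ultimately have "3 * ?C2 \<le> 3.825 * (S + ?e) \<or> 3 * ?C1 + t * (2 * ?C2 + ?C1) \<le> 3.825 * (S + ?e)"
      using order_trans by blast
    then show ?thesis
    proof
      assume "3 * ?C2 \<le> 3.825 * (S + ?e)"
      then show ?thesis using sum_split_G[OF covB] by simp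
    next
      assume "3 * ?C1 + t * (2 * ?C2 + ?C1) \<le> 3.825 * (S + ?e)"
      then have "sum (kept_radius A gp rA rB (M u)) (kept A gp (M u) fm) \<le>
          3 * sum rG G + 3.825 * (S + ?e) + 7 * R" using u(3) by linarith
      moreover have "u < p" using u(1) B(2) by auto
      ultimately show ?thesis using u(2) adm by blast
    qed
  qed
qed

end

section \<open>The algorithm\<close>

definition nP :: "state \<Rightarrow> nat" where "nP s = nmem s ''nF'' 0 0"
definition nQ :: "state \<Rightarrow> nat" where "nQ s = nmem s ''nD'' 0 0"
definition dst :: "state \<Rightarrow> nat \<Rightarrow> nat \<Rightarrow> real" where
  "dst s x y = rmem s ''c'' (nmem s ''F'' x 0) (nmem s ''D'' y 0)"
definition lbd :: "state \<Rightarrow> nat \<Rightarrow> nat" where "lbd s x = nmem s ''L'' (nmem s ''F'' x 0) 0"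
abbreviation na :: "var \<Rightarrow> state \<Rightarrow> nat \<Rightarrow> nat" where "na v s i \<equiv> nmem s v i 0"
abbreviation ra :: "var \<Rightarrow> state \<Rightarrow> nat \<Rightarrow> real" where "ra v s i \<equiv> rmem s v i 0"

text \<open>Ten centres are set aside for the guess; for k below ten the truncated difference is
  0.\<close>

definition spare :: "state \<Rightarrow> nat" where "spare s = na ''k'' s 0 - 10"

lemma bnd_nP: "bnd (\<lambda>s. nP s)" and bnd_nQ: "bnd (\<lambda>s. nQ s)"
  using bnd_nF bnd_nD by (simp_all add: nP_def[abs_def] nQ_def[abs_def])

lemmas basic_intros = ne_const ne_get re_get ne_add ne_diff re_of_nat re_numeral re_add re_diff
  re_mult re_divide be_less be_less_real be_conj be_not be_disj be_imp be_le be_le_real be_eq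
  be_eq_real computable_if ne_sum re_sum be_all be_ex bnd_const bnd_nP bnd_nQ bnd_add

lemma ne_nP: "ne l (\<lambda>s. nP s)" and ne_nQ: "ne l (\<lambda>s. nQ s)" and ne_spare: "ne l (\<lambda>s. spare s)"
  unfolding nP_def nQ_def spare_def by (intro basic_intros; simp)+

lemma re_dst: "ne l e \<Longrightarrow> ne l f \<Longrightarrow> re l (\<lambda>s. dst s (e s) (f s))"
  unfolding dst_def by (intro basic_intros; simp)

lemma ne_lbd: "ne l e \<Longrightarrow> ne l (\<lambda>s. lbd s (e s))"
  unfolding lbd_def by (intro basic_intros; simp)

lemma ne_first:
  assumes "ne l n" "bnd n" "\<And>i e. l \<le> i \<Longrightarrow> ne i e \<Longrightarrow> be i (\<lambda>s. P s (e s))"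
  shows "ne l (\<lambda>s. first (n s) (\<lambda>x. P s x))"
proof -
  have *: "first (n s) (\<lambda>x. P s x) = (\<Sum>x<n s. if \<forall>x'<n s. x' \<le> x \<longrightarrow> \<not> P s x' then 1 else 0)" for s
    unfolding first_def by (intro sum.cong) (auto simp: less_Suc_eq_le)
  show ?thesis
    unfolding * by (intro basic_intros assms; (assumption | (rule computable_mono[OF assms(1)], linarith) | (erule computable_mono, linarith) | simp))
qed

text \<open>Expressions return single numbers, so a minimising pair is found in two parts: the first
  x that occurs in such a pair, and then in \<open>min_snd\<close> the first z that completes
  it.\<close>

definition min_fst :: "nat \<Rightarrow> nat \<Rightarrow> (nat \<Rightarrow> nat \<Rightarrow> bool) \<Rightarrow> (nat \<Rightarrow> nat \<Rightarrow> real) \<Rightarrow> nat" where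
  "min_fst p q C V = first p (\<lambda>x. \<exists>z<q. C x z \<and> (\<forall>x'<p. \<forall>z'<q. C x' z' \<longrightarrow> V x z \<le> V x' z'))"

definition min_snd :: "nat \<Rightarrow> nat \<Rightarrow> (nat \<Rightarrow> nat \<Rightarrow> bool) \<Rightarrow> (nat \<Rightarrow> nat \<Rightarrow> real) \<Rightarrow> nat" where
  "min_snd p q C V = first q (\<lambda>z. C (min_fst p q C V) z \<and>
     (\<forall>x'<p. \<forall>z'<q. C x' z' \<longrightarrow> V (min_fst p q C V) z \<le> V x' z'))"

lemma min_fst_snd:
  assumes "\<exists>x<p. \<exists>z<q. C x z"
  shows "min_fst p q C V < p" "min_snd p q C V < q" "C (min_fst p q C V) (min_snd p q C V)"
    "\<And>x z. x < p \<Longrightarrow> z < q \<Longrightarrow> C x z \<Longrightarrow> V (min_fst p q C V) (min_snd p q C V) \<le> V x z"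
proof -
  let ?A = "{(x, z). x < p \<and> z < q \<and> C x z}"
  have "finite ?A" by (rule finite_subset[of _ "{..<p} \<times> {..<q}"]) auto
  moreover have "?A \<noteq> {}" using assms by auto
  ultimately obtain a where a: "a \<in> ?A" "\<And>b. b \<in> ?A \<Longrightarrow> (case a of (x, z) \<Rightarrow> V x z) \<le> (case b of (x, z) \<Rightarrow> V x z)"
    using arg_min_if_finite[of ?A "\<lambda>(x, z). V x z"] by (metis (no_types, lifting) not_le)
  obtain x0 z0 where [simp]: "a = (x0, z0)" by (cases a)
  have "V x0 z0 \<le> V x' z'" if "x' < p" "z' < q" "C x' z'" for x' z' using a(2)[of "(x', z')"] that by simp
  then have "\<exists>z<q. C x0 z \<and> (\<forall>x'<p. \<forall>z'<q. C x' z' \<longrightarrow> V x0 z \<le> V x' z')" using a(1) by auto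
  moreover have "x0 < p" using a(1) by simp
  ultimately have 1: "min_fst p q C V < p"
      "\<exists>z<q. C (min_fst p q C V) z \<and> (\<forall>x'<p. \<forall>z'<q. C x' z' \<longrightarrow> V (min_fst p q C V) z \<le> V x' z')"
    unfolding min_fst_def
    using firstI[of x0 p "\<lambda>x. \<exists>z<q. C x z \<and> (\<forall>x'<p. \<forall>z'<q. C x' z' \<longrightarrow> V x z \<le> V x' z')"] by blast+
  then obtain z where "z < q" "C (min_fst p q C V) z \<and> (\<forall>x'<p. \<forall>z'<q. C x' z' \<longrightarrow> V (min_fst p q C V) z \<le> V x' z')"
    by blast
  from firstI[of z q "\<lambda>z. C (min_fst p q C V) z \<and> (\<forall>x'<p. \<forall>z'<q. C x' z' \<longrightarrow> V (min_fst p q C V) z \<le> V x' z')", OF this]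
  show "min_fst p q C V < p" "min_snd p q C V < q" "C (min_fst p q C V) (min_snd p q C V)"
    "\<And>x z. x < p \<Longrightarrow> z < q \<Longrightarrow> C x z \<Longrightarrow> V (min_fst p q C V) (min_snd p q C V) \<le> V x z"
    using 1(1) unfolding min_snd_def[symmetric] by auto
qed

lemma ne_min_fst:
  assumes C: "\<And>i e f. l \<le> i \<Longrightarrow> ne i e \<Longrightarrow> ne i f \<Longrightarrow> be i (\<lambda>s. C s (e s) (f s))"
    and V: "\<And>i e f. l \<le> i \<Longrightarrow> ne i e \<Longrightarrow> ne i f \<Longrightarrow> re i (\<lambda>s. V s (e s) (f s))"
  shows "ne l (\<lambda>s. min_fst (nP s) (nQ s) (\<lambda>x z. C s x z) (\<lambda>x z. V s x z))"
  unfolding min_fst_def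
  by (intro ne_first basic_intros C V ne_nP ne_nQ; (assumption | (erule computable_mono, linarith) | linarith))

lemma ne_min_snd:
  assumes C: "\<And>i e f. l \<le> i \<Longrightarrow> ne i e \<Longrightarrow> ne i f \<Longrightarrow> be i (\<lambda>s. C s (e s) (f s))"
    and V: "\<And>i e f. l \<le> i \<Longrightarrow> ne i e \<Longrightarrow> ne i f \<Longrightarrow> re i (\<lambda>s. V s (e s) (f s))"
  shows "ne l (\<lambda>s. min_snd (nP s) (nQ s) (\<lambda>x z. C s x z) (\<lambda>x z. V s x z))"
proof -
  have m: "ne i (\<lambda>s. min_fst (nP s) (nQ s) (\<lambda>x z. C s x z) (\<lambda>x z. V s x z))" if "l \<le> i" for i
    using that by (intro ne_min_fst C V) auto
  show ?thesis
    unfolding min_snd_def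
    by (intro ne_first basic_intros C V ne_nP ne_nQ m; (assumption | (erule computable_mono, linarith) | linarith))
qed

lemmas expr_intros = basic_intros ne_nP ne_nQ ne_spare re_dst ne_lbd ne_first ne_min_fst ne_min_snd

section \<open>Dual ascent on the memory\<close>

definition guess_radius :: "state \<Rightarrow> real" where
  "guess_radius s = dst s (na ''gx'' s 9) (na ''gz'' s 9)"

lemma re_guess_radius: "re l (\<lambda>s. guess_radius s)"
  unfolding guess_radius_def by (intro expr_intros; simp)

definition uncovered :: "state \<Rightarrow> nat \<Rightarrow> bool" where
  "uncovered s y \<longleftrightarrow> (\<forall>i<10. \<not> dst s (na ''gx'' s i) y \<le> dst s (na ''gx'' s i) (na ''gz'' s i))"

lemma be_uncovered: "ne l e \<Longrightarrow> be l (\<lambda>s. uncovered s (e s))"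
  unfolding uncovered_def by (intro expr_intros; (assumption | (erule computable_mono, linarith) | simp))

definition valid_pair :: "state \<Rightarrow> nat \<Rightarrow> nat \<Rightarrow> bool" where
  "valid_pair s x z \<longleftrightarrow> dst s x z \<le> guess_radius s \<and>
     lbd s x \<le> (\<Sum>y<nQ s. if dst s x y \<le> dst s x z then 1 else 0)"

lemma be_valid_pair: "ne l e \<Longrightarrow> ne l f \<Longrightarrow> be l (\<lambda>s. valid_pair s (e s) (f s))"
  unfolding valid_pair_def
  by (intro expr_intros re_guess_radius; (assumption | (erule computable_mono, linarith) | simp))

text \<open>The sum runs over all clients with the guard \<open>y < n\<close>, because the rule for
  sums wants a loop count that is polynomially bounded in every state.\<close>

definition pair_slack :: "state \<Rightarrow> nat \<Rightarrow> nat \<Rightarrow> nat \<Rightarrow> real" where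
  "pair_slack s n x z = dst s x z + ra ''lam'' s 0 -
     (\<Sum>y<nQ s. if y < n \<and> dst s x y \<le> dst s x z then ra ''al'' s y else 0)"

lemma re_pair_slack: "ne l n \<Longrightarrow> ne l e \<Longrightarrow> ne l f \<Longrightarrow> re l (\<lambda>s. pair_slack s (n s) (e s) (f s))"
  unfolding pair_slack_def by (intro expr_intros; (assumption | (erule computable_mono, linarith) | simp))

definition raisable :: "state \<Rightarrow> nat \<Rightarrow> nat \<Rightarrow> nat \<Rightarrow> bool" where
  "raisable s y x z \<longleftrightarrow> valid_pair s x z \<and> dst s x y \<le> dst s x z"

lemma be_raisable: "ne l n \<Longrightarrow> ne l e \<Longrightarrow> ne l f \<Longrightarrow> be l (\<lambda>s. raisable s (n s) (e s) (f s))"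
  unfolding raisable_def by (intro expr_intros be_valid_pair; (assumption | (erule computable_mono, linarith)))

definition raised :: "state \<Rightarrow> nat \<Rightarrow> real" where
  "raised s y = (if uncovered s y \<and> (\<exists>x<nP s. \<exists>z<nQ s. raisable s y x z)
     then pair_slack s y (min_fst (nP s) (nQ s) (\<lambda>x z. raisable s y x z) (\<lambda>x z. pair_slack s y x z))
       (min_snd (nP s) (nQ s) (\<lambda>x z. raisable s y x z) (\<lambda>x z. pair_slack s y x z))
     else 0)"

lemma re_raised: "ne l e \<Longrightarrow> re l (\<lambda>s. raised s (e s))"
  unfolding raised_def
  by (intro expr_intros re_pair_slack be_raisable be_uncovered; (assumption | (erule computable_mono, linarith)))

definition ascend :: "state \<Rightarrow> state" where
  "ascend = forv ''y'' nQ (\<lambda>s. rset ''al'' (na ''y'' s 0) (raised s (na ''y'' s 0)) s)"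

definition tight_pair :: "state \<Rightarrow> nat \<Rightarrow> nat \<Rightarrow> bool" where
  "tight_pair s x z \<longleftrightarrow> valid_pair s x z \<and> pair_slack s (nQ s) x z \<le> 0"

lemma be_tight_pair: "ne l e \<Longrightarrow> ne l f \<Longrightarrow> be l (\<lambda>s. tight_pair s (e s) (f s))"
  unfolding tight_pair_def
  by (intro expr_intros re_pair_slack be_valid_pair; (assumption | (erule computable_mono, linarith)))

text \<open>A family of balls is stored as an array \<open>fl\<close> of flags marking the centres and an array \<open>r\<close> of radii:
  \<open>go\<close>, \<open>gr\<close> for the disjoint guessed balls, \<open>mo\<close>, \<open>mr\<close> for the selection at the current multiplier \<open>lam\<close>,
  \<open>ao\<close>, \<open>ar\<close> and \<open>bo\<close>, \<open>br\<close> for the selections at the ends \<open>lo\<close> and \<open>hi\<close> of the search interval. A candidate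
  solution consists of centres \<open>co\<close>, disjoint cores of radii \<open>cr\<close> that meet the lower bounds, and final
  radii \<open>fr\<close>.\<close>

definition separate :: "var \<Rightarrow> var \<Rightarrow> state \<Rightarrow> nat \<Rightarrow> real \<Rightarrow> bool" where
  "separate fl r s x t \<longleftrightarrow> (\<forall>x'<nP s. na fl s x' \<noteq> 0 \<longrightarrow>
     (\<forall>y<nQ s. \<not> (dst s x y \<le> t \<and> dst s x' y \<le> ra r s x')))"

lemma be_separate: "fl \<noteq> ''#'' \<Longrightarrow> r \<noteq> ''#'' \<Longrightarrow> ne l e \<Longrightarrow> re l t \<Longrightarrow> be l (\<lambda>s. separate fl r s (e s) (t s))"
  unfolding separate_def by (intro expr_intros; (assumption | (erule computable_mono, linarith)))

definition members_count :: "var \<Rightarrow> state \<Rightarrow> nat" where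
  "members_count fl s = (\<Sum>x<nP s. if na fl s x \<noteq> 0 then 1 else 0)"

lemma ne_members_count: "fl \<noteq> ''#'' \<Longrightarrow> ne l (\<lambda>s. members_count fl s)"
  unfolding members_count_def by (intro expr_intros; (assumption | (erule computable_mono, linarith)))

definition insert_ball :: "var \<Rightarrow> var \<Rightarrow> (state \<Rightarrow> nat) \<Rightarrow> (state \<Rightarrow> real) \<Rightarrow> state \<Rightarrow> state" where
  "insert_ball fl r x t = (\<lambda>s. rset r (x s) (t s) s) ;; (\<lambda>s. nset fl (x s) 1 s)"

definition copy_family :: "var \<Rightarrow> var \<Rightarrow> var \<Rightarrow> var \<Rightarrow> state \<Rightarrow> state" where
  "copy_family fl r fl' r' = nfill fl' nP (\<lambda>s x. na fl s x) ;; rfill r' nP (\<lambda>s x. ra r s x)"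

definition guess_family :: "state \<Rightarrow> state" where
  "guess_family = nfill ''go'' nP (\<lambda>s x. 0) ;;
     forv ''i'' (\<lambda>s. 10) (ifs (\<lambda>s. separate ''go'' ''gr'' s (na ''gx'' s (na ''i'' s 0))
         (dst s (na ''gx'' s (na ''i'' s 0)) (na ''gz'' s (na ''i'' s 0))))
       (insert_ball ''go'' ''gr'' (\<lambda>s. na ''gx'' s (na ''i'' s 0))
         (\<lambda>s. dst s (na ''gx'' s (na ''i'' s 0)) (na ''gz'' s (na ''i'' s 0)))) skip)"

definition eligible :: "state \<Rightarrow> nat \<Rightarrow> nat \<Rightarrow> bool" where
  "eligible s x z \<longleftrightarrow> tight_pair s x z \<and> separate ''mo'' ''mr'' s x (dst s x z)"

lemma be_eligible: "ne l e \<Longrightarrow> ne l f \<Longrightarrow> be l (\<lambda>s. eligible s (e s) (f s))"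
  unfolding eligible_def
  by (intro expr_intros be_tight_pair be_separate; (assumption | (erule computable_mono, linarith) | simp))

definition largest_fst :: "state \<Rightarrow> nat" where
  "largest_fst s = min_fst (nP s) (nQ s) (\<lambda>x z. eligible s x z) (\<lambda>x z. 0 - dst s x z)"

definition largest_snd :: "state \<Rightarrow> nat" where
  "largest_snd s = min_snd (nP s) (nQ s) (\<lambda>x z. eligible s x z) (\<lambda>x z. 0 - dst s x z)"

lemma ne_largest: "ne l (\<lambda>s. largest_fst s)" "ne l (\<lambda>s. largest_snd s)"
  unfolding largest_fst_def largest_snd_def
  by (intro expr_intros be_eligible; (assumption | (erule computable_mono, linarith)))+

text \<open>Each successful round adds a new centre, so nP rounds exhaust the eligible
  balls.\<close>

definition select :: "state \<Rightarrow> state" where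
  "select = copy_family ''go'' ''gr'' ''mo'' ''mr'' ;;
     forv ''i'' nP (ifs (\<lambda>s. \<exists>x<nP s. \<exists>z<nQ s. eligible s x z)
       ((\<lambda>s. nset ''bx'' 0 (largest_fst s) s) ;; (\<lambda>s. nset ''bz'' 0 (largest_snd s) s) ;;
        insert_ball ''mo'' ''mr'' (\<lambda>s. na ''bx'' s 0) (\<lambda>s. dst s (na ''bx'' s 0) (na ''bz'' s 0))) skip)"

definition halve :: "state \<Rightarrow> state" where
  "halve = (\<lambda>s. rset ''lam'' 0 ((ra ''lo'' s 0 + ra ''hi'' s 0) / 2) s) ;; ascend ;; select ;;
     ifs (\<lambda>s. members_count ''go'' s + spare s < members_count ''mo'' s)
       ((\<lambda>s. rset ''lo'' 0 (ra ''lam'' s 0) s) ;; copy_family ''mo'' ''mr'' ''ao'' ''ar'')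
       ((\<lambda>s. rset ''hi'' 0 (ra ''lam'' s 0) s) ;; copy_family ''mo'' ''mr'' ''bo'' ''br'')"

text \<open>The upper end starts at twice a multiplier that forces a small family, so the very first
  midpoint fills \<open>bo\<close> and \<open>br\<close>. Twelve halvings per client outweigh the
  factor 2^q in \<open>err\<close>; their number is a repeated sum because naturals cannot be
  multiplied.\<close>

definition search :: "state \<Rightarrow> state" where
  "search = (\<lambda>s. rset ''lo'' 0 0 s) ;;
     (\<lambda>s. rset ''hi'' 0 (if 0 < guess_radius s then 2 * ((real (nQ s) + 1) * guess_radius s) else 2) s) ;;
     forv ''t'' (\<lambda>s. nQ s + nQ s + nQ s + nQ s + nQ s + nQ s + nQ s + nQ s + nQ s + nQ s + nQ s + nQ s + 1) halve"

text \<open>At \<open>lo = 0\<close> no family with too many balls need have been found, and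
  \<open>ao\<close>, \<open>ar\<close> may hold data of an earlier guess.\<close>

definition extend :: "state \<Rightarrow> state" where
  "extend = ifs (\<lambda>s. 0 < ra ''lo'' s 0)
     (forv ''i'' nP (ifs (\<lambda>s. members_count ''bo'' s < members_count ''go'' s + spare s \<and>
         na ''ao'' s (na ''i'' s 0) \<noteq> 0 \<and> separate ''bo'' ''br'' s (na ''i'' s 0) (ra ''ar'' s (na ''i'' s 0)))
       (insert_ball ''bo'' ''br'' (\<lambda>s. na ''i'' s 0) (\<lambda>s. ra ''ar'' s (na ''i'' s 0))) skip)) skip"

definition assigned :: "state \<Rightarrow> nat \<Rightarrow> nat" where
  "assigned s y = (if \<exists>x<nP s. na ''co'' s x \<noteq> 0 \<and> dst s x y \<le> ra ''cr'' s x
     then first (nP s) (\<lambda>x. na ''co'' s x \<noteq> 0 \<and> dst s x y \<le> ra ''cr'' s x)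
     else first (nP s) (\<lambda>x. na ''co'' s x \<noteq> 0 \<and> dst s x y \<le> ra ''fr'' s x))"

definition total_radius :: "state \<Rightarrow> real" where
  "total_radius s = (\<Sum>x<nP s. if na ''co'' s x \<noteq> 0 then ra ''fr'' s x else 0)"

text \<open>Feasibility is tested on the actual assignment, so that candidates from wrong guesses
  may be submitted as well: whatever is recorded is feasible.\<close>

definition acceptable :: "state \<Rightarrow> bool" where
  "acceptable s \<longleftrightarrow>
     (\<forall>y<nQ s. na ''as'' s y < nP s \<and> na ''co'' s (na ''as'' s y) \<noteq> 0 \<and> dst s (na ''as'' s y) y \<le> ra ''fr'' s (na ''as'' s y)) \<and>
     (\<forall>x<nP s. na ''co'' s x \<noteq> 0 \<longrightarrow> 0 \<le> ra ''fr'' s x \<and> lbd s x \<le> (\<Sum>y<nQ s. if na ''as'' s y = x then 1 else 0)) \<and>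
     members_count ''co'' s \<le> na ''k'' s 0"

definition record_solution :: "state \<Rightarrow> state" where
  "record_solution = (\<lambda>s. nset ''found'' 0 1 s) ;; (\<lambda>s. rset ''best'' 0 (total_radius s) s) ;;
     forv ''i'' nP (\<lambda>s. nset ''S'' (na ''F'' s (na ''i'' s 0)) (na ''co'' s (na ''i'' s 0)) s) ;;
     forv ''i'' nQ (\<lambda>s. nset ''sigma'' (na ''D'' s (na ''i'' s 0)) (na ''F'' s (na ''as'' s (na ''i'' s 0))) s)"

definition check_solution :: "state \<Rightarrow> state" where
  "check_solution = nfill ''as'' nQ assigned ;;
     ifs (\<lambda>s. acceptable s \<and> (na ''found'' s 0 = 0 \<or> total_radius s < ra ''best'' s 0)) record_solution skip"

definition tripled :: "state \<Rightarrow> state" where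
  "tripled = nfill ''co'' nP (\<lambda>s x. na ''bo'' s x) ;; rfill ''cr'' nP (\<lambda>s x. ra ''br'' s x) ;;
     rfill ''fr'' nP (\<lambda>s x. 3 * ra ''br'' s x) ;; check_solution"

section \<open>Merging on the memory\<close>

definition group_of :: "state \<Rightarrow> nat \<Rightarrow> nat" where
  "group_of s x = first (nP s) (\<lambda>b. na ''bo'' s b \<noteq> 0 \<and> na ''go'' s b = 0 \<and>
     (\<exists>y<nQ s. dst s x y \<le> ra ''ar'' s x \<and> dst s b y \<le> ra ''br'' s b))"

definition member :: "state \<Rightarrow> nat \<Rightarrow> nat \<Rightarrow> bool" where
  "member s b a \<longleftrightarrow> na ''ao'' s a \<noteq> 0 \<and> na ''go'' s a = 0 \<and> na ''gp'' s a = b"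

lemma be_member: "ne l e \<Longrightarrow> ne l f \<Longrightarrow> be l (\<lambda>s. member s (e s) (f s))"
  unfolding member_def by (intro expr_intros; (assumption | simp))

definition group_size :: "state \<Rightarrow> nat \<Rightarrow> nat" where
  "group_size s b = (\<Sum>a<nP s. if member s b a then 1 else 0)"

definition group_sum :: "state \<Rightarrow> nat \<Rightarrow> real" where
  "group_sum s b = (\<Sum>a<nP s. if member s b a then ra ''ar'' s a else 0)"

lemma ne_group_size: "ne l e \<Longrightarrow> ne l (\<lambda>s. group_size s (e s))"
  and re_group_sum: "ne l e \<Longrightarrow> re l (\<lambda>s. group_sum s (e s))"
  unfolding group_size_def group_sum_def
  by (intro expr_intros be_member; (assumption | (erule computable_mono, linarith) | simp))+

definition group_ratio :: "state \<Rightarrow> nat \<Rightarrow> real" where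
  "group_ratio s b = (2 * ra ''br'' s b + group_sum s b) / (real (group_size s b) - 1)"

lemma re_group_ratio: "ne l e \<Longrightarrow> re l (\<lambda>s. group_ratio s (e s))"
  unfolding group_ratio_def by (intro expr_intros ne_group_size re_group_sum; (assumption | simp))

definition merged :: "state \<Rightarrow> nat \<Rightarrow> nat \<Rightarrow> bool" where
  "merged s u b \<longleftrightarrow> b < nP s \<and> na ''bo'' s b \<noteq> 0 \<and> na ''go'' s b = 0 \<and> 2 \<le> group_size s b \<and>
     (group_ratio s b < group_ratio s u \<or> group_ratio s b = group_ratio s u \<and> b \<le> u)"

lemma be_merged: "ne l e \<Longrightarrow> ne l f \<Longrightarrow> be l (\<lambda>s. merged s (e s) (f s))"
  unfolding merged_def by (intro expr_intros ne_group_size re_group_ratio; (assumption | simp))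

definition merged_centre :: "state \<Rightarrow> nat \<Rightarrow> nat" where
  "merged_centre s x = (if na ''go'' s x \<noteq> 0 \<or> na ''ao'' s x \<noteq> 0 \<and>
     (\<not> merged s (na ''u'' s 0) (na ''gp'' s x) \<or> x = first (nP s) (member s (na ''gp'' s x))) then 1 else 0)"

definition merged_final :: "state \<Rightarrow> nat \<Rightarrow> real" where
  "merged_final s x = (if na ''go'' s x \<noteq> 0 \<or> \<not> merged s (na ''u'' s 0) (na ''gp'' s x) then 3 * ra ''ar'' s x
     else min (2 * ra ''br'' s (na ''gp'' s x) + 4 * group_sum s (na ''gp'' s x)) (7 * guess_radius s))"

definition merge :: "state \<Rightarrow> state" where
  "merge = nfill ''co'' nP merged_centre ;; rfill ''cr'' nP (\<lambda>s x. ra ''ar'' s x) ;;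
     rfill ''fr'' nP merged_final ;; check_solution"

definition trial :: "state \<Rightarrow> state" where
  "trial = guess_family ;; search ;; extend ;; tripled ;; nfill ''gp'' nP group_of ;; forv ''u'' nP merge"

text \<open>The recursion is over a constant of the program: \<open>guess_loop 10\<close> unfolds to
  a fixed nesting of twenty loops around a trial, which keeps the time polynomial.\<close>

primrec guess_loop :: "nat \<Rightarrow> state \<Rightarrow> state" where
  "guess_loop 0 = trial"
| "guess_loop (Suc j) = forv ''x'' nP ((\<lambda>s. nset ''gx'' j (na ''x'' s 0) s) ;;
     forv ''z'' nQ ((\<lambda>s. nset ''gz'' j (na ''z'' s 0) s) ;; guess_loop j))"

subsection \<open>Realizability\<close>

lemma ne_assigned: "ne l e \<Longrightarrow> ne l (\<lambda>s. assigned s (e s))"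
  unfolding assigned_def by (intro expr_intros; (assumption | (erule computable_mono, linarith) | simp))

lemma re_total_radius: "re l (\<lambda>s. total_radius s)"
  unfolding total_radius_def by (intro expr_intros; (assumption | (erule computable_mono, linarith) | simp))

lemma be_acceptable: "be l (\<lambda>s. acceptable s)"
  unfolding acceptable_def
  by (intro expr_intros ne_members_count; (assumption | (erule computable_mono, linarith) | simp))

lemma ne_group_of: "ne l e \<Longrightarrow> ne l (\<lambda>s. group_of s (e s))"
  unfolding group_of_def by (intro expr_intros; (assumption | (erule computable_mono, linarith) | simp))

lemma ne_merged_centre: "ne l e \<Longrightarrow> ne l (\<lambda>s. merged_centre s (e s))"
  unfolding merged_centre_def
  by (intro expr_intros be_merged be_member; (assumption | (erule computable_mono, linarith) | simp))

lemma re_merged_final: "ne l e \<Longrightarrow> re l (\<lambda>s. merged_final s (e s))"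
  unfolding merged_final_def min_def
  by (intro expr_intros be_merged re_group_sum re_guess_radius; (assumption | (erule computable_mono, linarith) | simp))

lemma writable_simps: "writable v W \<longleftrightarrow> v \<in> W \<and> ''#'' \<notin> W \<and> ''nF'' \<notin> W \<and> ''nD'' \<notin> W"
  by (auto simp: writable_def)

lemma stm_skip:
  assumes "''#'' \<notin> W" "''nF'' \<notin> W" "''nD'' \<notin> W"
  shows "stm W skip"
proof -
  have "runs com.Skip 1 s s" for s
    using exec.Skip[of s] size_of_ge_2[of s] unfolding runs_def by fastforce
  then have "\<exists>P c. \<forall>s. \<exists>s'. runs P c s s' \<and> agree m (skip s) s'" for m
    unfolding skip_def using agree_refl by metis
  then show ?thesis
    using assms by (simp add: stm_def respectful_def frame_def skip_def)
qed

lemmas stm_intros = stm_sequence stm_ifs stm_forv stm_nset stm_rset stm_skip expr_intros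

lemmas state_defs = nP_def nQ_def dst_def lbd_def spare_def guess_radius_def separate_def
  member_def[abs_def] group_size_def group_sum_def group_ratio_def merged_def

text \<open>Discharges the hypothesis of \<open>stm_nfill\<close> and \<open>stm_rfill\<close> that
  the entries do not depend on the array being filled.\<close>

lemma indep:
  "assigned (s\<lparr>nmem := (nmem s)(''as'' := g)\<rparr>) = assigned s"
  "merged_centre (s\<lparr>nmem := (nmem s)(''co'' := g)\<rparr>) = merged_centre s"
  "merged_final (s\<lparr>rmem := (rmem s)(''fr'' := h)\<rparr>) = merged_final s"
  "group_of (s\<lparr>nmem := (nmem s)(''gp'' := g)\<rparr>) = group_of s"
  by (simp_all add: assigned_def merged_centre_def merged_final_def group_of_def state_defs fun_eq_iff cong: if_cong)

lemma stm_ascend: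
  assumes "writable ''y'' W" "writable ''al'' W"
  shows "stm W ascend"
  unfolding ascend_def
  by (insert assms, (intro stm_intros re_raised; (assumption | simp add: writable_simps)))

lemma stm_copy_family:
  assumes "fl \<noteq> ''#''" "r \<noteq> ''#''" "writable fl' W" "writable r' W" "fl \<noteq> fl'" "r \<noteq> r'"
  shows "stm W (copy_family fl r fl' r')"
  unfolding copy_family_def
  by (insert assms, (intro stm_intros stm_nfill stm_rfill; (assumption | simp add: writable_simps)))

lemma stm_insert_ball:
  assumes "writable fl W" "writable r W" "ne 0 x" "re 0 t"
  shows "stm W (insert_ball fl r x t)"
  unfolding insert_ball_def
  by (insert assms, (intro stm_intros; (assumption | simp add: writable_simps)))

lemma stm_guess_family:
  assumes "writable ''i'' W" "writable ''go'' W" "writable ''gr'' W"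
  shows "stm W guess_family"
  unfolding guess_family_def
  by (insert assms, (intro stm_intros stm_nfill stm_insert_ball be_separate; (assumption | simp add: writable_simps)))

lemma stm_select:
  assumes "writable ''i'' W" "writable ''mo'' W" "writable ''mr'' W" "writable ''bx'' W" "writable ''bz'' W"
  shows "stm W select"
  unfolding select_def
  by (insert assms, (intro stm_intros stm_copy_family stm_insert_ball ne_largest be_eligible; (assumption | (erule computable_mono, linarith) | simp add: writable_simps)))

lemma stm_halve:
  assumes "{''i'', ''y'', ''al'', ''mo'', ''mr'', ''bx'', ''bz'', ''lam'', ''lo'', ''hi'', ''ao'', ''ar'', ''bo'', ''br''} \<subseteq> W"
    "''#'' \<notin> W" "''nF'' \<notin> W" "''nD'' \<notin> W"
  shows "stm W halve"
  unfolding halve_def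
  by (insert assms, (intro stm_intros stm_copy_family stm_ascend stm_select ne_members_count; simp add: writable_simps))

lemma stm_search:
  assumes "{''t'', ''i'', ''y'', ''al'', ''mo'', ''mr'', ''bx'', ''bz'', ''lam'', ''lo'', ''hi'', ''ao'', ''ar'', ''bo'', ''br''} \<subseteq> W"
    "''#'' \<notin> W" "''nF'' \<notin> W" "''nD'' \<notin> W"
  shows "stm W search"
  unfolding search_def
  by (insert assms, (intro stm_intros stm_halve re_guess_radius; simp add: writable_simps))

lemma stm_extend:
  assumes "writable ''i'' W" "writable ''bo'' W" "writable ''br'' W"
  shows "stm W extend"
  unfolding extend_def
  by (insert assms, (intro stm_intros stm_insert_ball ne_members_count be_separate; (assumption | simp add: writable_simps)))

lemma stm_record_solution:
  assumes "writable ''i'' W" "writable ''found'' W" "writable ''best'' W" "writable ''S'' W" "writable ''sigma'' W"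
  shows "stm W record_solution"
  unfolding record_solution_def
  by (insert assms, (intro stm_intros re_total_radius; (assumption | simp add: writable_simps)))

lemma stm_check_solution:
  assumes "{''i'', ''found'', ''best'', ''S'', ''sigma'', ''as''} \<subseteq> W" "''#'' \<notin> W" "''nF'' \<notin> W" "''nD'' \<notin> W"
  shows "stm W check_solution"
  unfolding check_solution_def
  by (insert assms, (intro stm_intros indep stm_nfill ne_assigned be_acceptable re_total_radius stm_record_solution;
      (assumption | simp add: writable_simps)))

lemma stm_tripled:
  assumes "{''i'', ''found'', ''best'', ''S'', ''sigma'', ''as'', ''co'', ''cr'', ''fr''} \<subseteq> W" "''#'' \<notin> W" "''nF'' \<notin> W" "''nD'' \<notin> W"
  shows "stm W tripled"
  unfolding tripled_def
  by (insert assms, (intro stm_intros stm_nfill stm_rfill stm_check_solution; (assumption | simp add: writable_simps)))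

lemma stm_merge:
  assumes "{''i'', ''found'', ''best'', ''S'', ''sigma'', ''as'', ''co'', ''cr'', ''fr''} \<subseteq> W" "''#'' \<notin> W" "''nF'' \<notin> W" "''nD'' \<notin> W"
  shows "stm W merge"
  unfolding merge_def
  by (insert assms, (intro stm_intros stm_nfill stm_rfill stm_check_solution indep ne_merged_centre re_merged_final;
      (assumption | simp add: writable_simps)))

text \<open>The guess \<open>gx\<close>, \<open>gz\<close> and the loop variables \<open>x\<close>,
  \<open>z\<close> are absent, as a trial must not disturb the guess it works on.\<close>

definition trial_vars :: "var set" where
  "trial_vars = {''i'', ''found'', ''best'', ''S'', ''sigma'', ''as'', ''co'', ''cr'', ''fr'', ''u'', ''gp'',
     ''go'', ''gr'', ''t'', ''y'', ''al'', ''mo'', ''mr'', ''bx'', ''bz'', ''lam'', ''lo'', ''hi'', ''ao'', ''ar'', ''bo'', ''br''}"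

lemma stm_trial:
  assumes "trial_vars \<subseteq> W" "''#'' \<notin> W" "''nF'' \<notin> W" "''nD'' \<notin> W"
  shows "stm W trial"
  unfolding trial_def using assms unfolding trial_vars_def
  by (intro stm_intros indep stm_nfill stm_guess_family stm_search stm_extend stm_tripled stm_merge ne_group_of;
      (assumption | simp add: writable_simps))

lemma stm_guess_loop:
  "stm (trial_vars \<union> {''x'', ''z'', ''gx'', ''gz''}) (guess_loop j)"
proof (induction j)
  case 0
  show ?case unfolding guess_loop.simps by (rule stm_trial) (auto simp: trial_vars_def)
next
  case (Suc j)
  then show ?case unfolding guess_loop.simps
    by (intro stm_intros; simp add: writable_simps trial_vars_def)
qed

section \<open>Correctness of a trial\<close>

lemma mem_nset [simp]:
  "nmem (nset v i x s) w a b = (if w = v \<and> a = i \<and> b = 0 then x else nmem s w a b)"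
  "rmem (nset v i x s) = rmem s"
  by (auto simp: nset_def upd_def)

lemma mem_rset [simp]:
  "rmem (rset v i x s) w a b = (if w = v \<and> a = i \<and> b = 0 then x else rmem s w a b)"
  "nmem (rset v i x s) = nmem s"
  by (auto simp: rset_def upd_def)

lemma mem_nfill [simp]:
  "nmem (nfill v n f s) w a b = (if w = v \<and> b = 0 \<and> a < n s then f s a else nmem s w a b)"
  "rmem (nfill v n f s) = rmem s"
  by (auto simp: nfill_def)

lemma mem_rfill [simp]:
  "rmem (rfill v n f s) w a b = (if w = v \<and> b = 0 \<and> a < n s then f s a else rmem s w a b)"
  "nmem (rfill v n f s) = nmem s"
  by (auto simp: rfill_def)

lemma mem_set_other [simp]:
  "w \<noteq> v \<Longrightarrow> nmem (nset v i x s) w = nmem s w" "w \<noteq> v \<Longrightarrow> rmem (rset v i y s) w = rmem s w"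
  "w \<noteq> v \<Longrightarrow> nmem (nfill v n f s) w = nmem s w" "w \<noteq> v \<Longrightarrow> rmem (rfill v n g s) w = rmem s w"
  by (simp_all add: nset_def rset_def nfill_def rfill_def upd_def)

definition flags :: "var \<Rightarrow> state \<Rightarrow> nat set" where
  "flags v s = {x. x < nP s \<and> na v s x \<noteq> 0}"

lemma finite_flags [simp]: "finite (flags v s)"
  by (rule finite_subset[of _ "{..<nP s}"]) (auto simp: flags_def)

lemma members_count_eq: "members_count v s = card (flags v s)"
proof -
  have "flags v s = {x \<in> {..<nP s}. na v s x \<noteq> 0}" by (auto simp: flags_def)
  then show ?thesis by (simp add: members_count_def sum.If_cases Int_def)
qed

text \<open>The variables that determine the mathematical instance seen by a trial: the input and
  the guess.\<close>

definition loads :: "var set" where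
  "loads = {''nF'', ''nD'', ''k'', ''F'', ''D'', ''L'', ''c'', ''gx'', ''gz''}"

locale run = guessed p q d L R U G rG Op zs kk
  for p q d L R U G rG Op zs kk +
  fixes gxs gzs :: "nat \<Rightarrow> nat" and k :: nat
  assumes R_eq: "R = d (gxs 9) (gzs 9)"
    and U_eq: "U = {y. y < q \<and> (\<forall>i<10. \<not> d (gxs i) y \<le> d (gxs i) (gzs i))}"
    and kk_eq: "kk = k - 10" and budget: "card G + kk \<le> k"
    and G_client: "x \<in> G \<Longrightarrow> ball x (rG x) \<noteq> {}"
begin

definition St :: "state \<Rightarrow> bool" where
  "St s \<longleftrightarrow> nP s = p \<and> nQ s = q \<and> dst s = d \<and> lbd s = L \<and> na ''k'' s 0 = k \<and>
     (\<forall>i<10. na ''gx'' s i = gxs i \<and> na ''gz'' s i = gzs i)"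

lemma St_simps:
  assumes "St s"
  shows "nP s = p" "nQ s = q" "dst s = d" "lbd s = L" "spare s = kk" "guess_radius s = R"
    "y < q \<Longrightarrow> uncovered s y \<longleftrightarrow> y \<in> U" "na ''k'' s 0 = k"
proof -
  have a: "nP s = p" "nQ s = q" "dst s = d" "lbd s = L" "na ''k'' s 0 = k"
    and g: "\<And>i. i < 10 \<Longrightarrow> na ''gx'' s i = gxs i" "\<And>i. i < 10 \<Longrightarrow> na ''gz'' s i = gzs i"
    using assms unfolding St_def by blast+
  show "nP s = p" "nQ s = q" "dst s = d" "lbd s = L" "na ''k'' s 0 = k" by (fact a)+
  show "spare s = kk" by (simp add: spare_def a kk_eq)
  show "guess_radius s = R" unfolding R_eq by (simp add: guess_radius_def a g)
  show "uncovered s y \<longleftrightarrow> y \<in> U" if "y < q" using that g by (simp add: uncovered_def a U_eq)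
qed

lemma St_cong:
  assumes "St s" "\<And>v. v \<in> loads \<Longrightarrow> nmem t v = nmem s v \<and> rmem t v = rmem s v"
  shows "St t"
proof -
  have e: "nmem t v = nmem s v" "rmem t v = rmem s v" if "v \<in> loads" for v
    using assms(2)[OF that] by auto
  have "nP t = nP s" "nQ t = nQ s" "dst t = dst s" "lbd t = lbd s"
    by (simp_all add: nP_def nQ_def dst_def lbd_def fun_eq_iff e loads_def)
  moreover have "nmem t v = nmem s v" if "v \<in> {''k'', ''gx'', ''gz''}" for v
    by (rule e(1)) (use that in \<open>auto simp: loads_def\<close>)
  ultimately show ?thesis using assms(1) unfolding St_def by simp
qed

lemma St_set [simp]:
  "v \<notin> loads \<Longrightarrow> St (nset v i x s) \<longleftrightarrow> St s" "v \<notin> loads \<Longrightarrow> St (rset v i y s) \<longleftrightarrow> St s"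
  "v \<notin> loads \<Longrightarrow> St (nfill v n f s) \<longleftrightarrow> St s" "v \<notin> loads \<Longrightarrow> St (rfill v n g s) \<longleftrightarrow> St s"
proof -
  have iff: "St t \<longleftrightarrow> St s" if "\<And>v. v \<in> loads \<Longrightarrow> nmem t v = nmem s v \<and> rmem t v = rmem s v" for s t
    using St_cong[of s t] St_cong[of t s] that by auto
  show "v \<notin> loads \<Longrightarrow> St (nset v i x s) \<longleftrightarrow> St s" "v \<notin> loads \<Longrightarrow> St (rset v i y s) \<longleftrightarrow> St s"
    "v \<notin> loads \<Longrightarrow> St (nfill v n f s) \<longleftrightarrow> St s" "v \<notin> loads \<Longrightarrow> St (rfill v n g s) \<longleftrightarrow> St s"
    by (rule iff, metis mem_set_other mem_nset(2) mem_rset(2) mem_nfill(2) mem_rfill(2))+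
qed

lemma St_stm:
  assumes "stm W F" "W \<inter> loads = {}" "St s"
  shows "St (F s)"
proof (rule St_cong[OF assms(3)])
  fix v assume "v \<in> loads"
  then have "v \<notin> W" using assms(2) by blast
  then show "nmem (F s) v = nmem s v \<and> rmem (F s) v = rmem s v" by (rule stm_frame[OF assms(1)])
qed

definition Gs :: "state \<Rightarrow> bool" where
  "Gs s \<longleftrightarrow> flags ''go'' s = G \<and> (\<forall>x\<in>G. ra ''gr'' s x = rG x)"

lemma Gs_cong:
  assumes "Gs s" "\<And>v. v \<in> {''go'', ''gr'', ''nF''} \<Longrightarrow> nmem t v = nmem s v \<and> rmem t v = rmem s v"
  shows "Gs t"
  using assms by (simp add: Gs_def flags_def nP_def)

lemma Gs_set [simp]:
  "v \<notin> {''go'', ''gr'', ''nF''} \<Longrightarrow> Gs (nset v i x s) \<longleftrightarrow> Gs s" "v \<notin> {''go'', ''gr'', ''nF''} \<Longrightarrow> Gs (rset v i y s) \<longleftrightarrow> Gs s"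
  "v \<notin> {''go'', ''gr'', ''nF''} \<Longrightarrow> Gs (nfill v n f s) \<longleftrightarrow> Gs s" "v \<notin> {''go'', ''gr'', ''nF''} \<Longrightarrow> Gs (rfill v n g s) \<longleftrightarrow> Gs s"
proof -
  have iff: "Gs t \<longleftrightarrow> Gs s"
    if "\<And>v. v \<in> {''go'', ''gr'', ''nF''} \<Longrightarrow> nmem t v = nmem s v \<and> rmem t v = rmem s v" for s t
    using Gs_cong[of s t] Gs_cong[of t s] that by auto
  show "v \<notin> {''go'', ''gr'', ''nF''} \<Longrightarrow> Gs (nset v i x s) \<longleftrightarrow> Gs s" "v \<notin> {''go'', ''gr'', ''nF''} \<Longrightarrow> Gs (rset v i y s) \<longleftrightarrow> Gs s"
    "v \<notin> {''go'', ''gr'', ''nF''} \<Longrightarrow> Gs (nfill v n f s) \<longleftrightarrow> Gs s" "v \<notin> {''go'', ''gr'', ''nF''} \<Longrightarrow> Gs (rfill v n g s) \<longleftrightarrow> Gs s"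
    by (rule iff, metis mem_set_other mem_nset(2) mem_rset(2) mem_nfill(2) mem_rfill(2))+
qed

lemma Gs_stm:
  assumes "stm W F" "W \<inter> {''go'', ''gr'', ''nF''} = {}" "Gs s"
  shows "Gs (F s)"
proof (rule Gs_cong[OF assms(3)])
  fix v assume "v \<in> {''go'', ''gr'', ''nF''}"
  then have "v \<notin> W" using assms(2) by blast
  then show "nmem (F s) v = nmem s v \<and> rmem (F s) v = rmem s v" by (rule stm_frame[OF assms(1)])
qed

section \<open>Program expressions in mathematical terms\<close>

lemma count_ball: "(\<Sum>y<q. if d x y \<le> r then 1 else 0) = card (ball x r)"
  by (simp add: sum.If_cases ball_def Int_def)

lemma valid_pair_eq: "St s \<Longrightarrow> x < p \<Longrightarrow> z < q \<Longrightarrow> valid_pair s x z \<longleftrightarrow> valid x z"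
  by (simp add: valid_pair_def St_simps count_ball valid_def)

lemma pair_slack_eq:
  assumes "St s" "n \<le> q"
  shows "pair_slack s n x z = slack (ra ''al'' s) (ra ''lam'' s 0) n x z"
proof -
  have "(\<Sum>y<q. if y < n \<and> d x y \<le> d x z then ra ''al'' s y else 0) =
      (\<Sum>y<n. if y < n \<and> d x y \<le> d x z then ra ''al'' s y else 0)"
    using assms(2) by (intro sum.mono_neutral_right) auto
  also have "\<dots> = (\<Sum>y<n. if d x y \<le> d x z then ra ''al'' s y else 0)" by (rule sum.cong) auto
  finally show ?thesis using assms by (simp add: pair_slack_def slack_def St_simps)
qed

lemma tight_pair_eq:
  "St s \<Longrightarrow> x < p \<Longrightarrow> z < q \<Longrightarrow> tight_pair s x z \<longleftrightarrow> tight (ra ''al'' s) (ra ''lam'' s 0) x z"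
  by (simp add: tight_pair_def tight_def valid_pair_eq pair_slack_eq St_simps)

lemma separate_eq:
  "St s \<Longrightarrow> separate fl r s x t \<longleftrightarrow> (\<forall>x'\<in>flags fl s. ball x t \<inter> ball x' (ra r s x') = {})"
  by (auto simp: separate_def flags_def ball_def St_simps)

text \<open>The condition on client y involves the dual values up to y only, so later assignments do
  not affect it. Hence the conditions on the clients treated so far form a loop invariant.\<close>

lemma ascend_correct:
  assumes s: "St s"
  shows "ascent (ra ''lam'' s 0) (ra ''al'' (ascend s))"
proof -
  let ?lam = "ra ''lam'' s 0"
  define c where "c al y \<longleftrightarrow> (if y \<in> U \<and> (\<exists>x z. valid x z \<and> d x y \<le> d x z)
     then (\<exists>x z. valid x z \<and> d x y \<le> d x z \<and> al y = slack al ?lam y x z) \<and>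
          (\<forall>x z. valid x z \<and> d x y \<le> d x z \<longrightarrow> al y \<le> slack al ?lam y x z)
     else al y = 0)" for al y
  define Inv where "Inv n t \<longleftrightarrow> St t \<and> ra ''lam'' t 0 = ?lam \<and> (\<forall>y<n. c (ra ''al'' t) y)" for n t
  have "Inv (nQ s) (ascend s)"
    unfolding ascend_def
  proof (rule forv_induct)
    show "Inv 0 s" using s by (simp add: Inv_def)
    fix n t assume n: "n < nQ s" and t: "Inv n t"
    let ?t1 = "nset ''y'' 0 n t"
    let ?v = "raised ?t1 n"
    let ?t2 = "rset ''al'' n ?v ?t1"
    have St: "St t" "St ?t1" "St ?t2" using t by (simp_all add: Inv_def loads_def)
    have nq: "n < q" using n s by (simp add: St_simps)
    have al: "ra ''al'' ?t2 = (ra ''al'' t)(n := ?v)" by (simp add: fun_eq_iff)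
    have sl: "slack (ra ''al'' ?t2) ?lam y x z = slack (ra ''al'' t) ?lam y x z" if "y \<le> n" for y x z
      unfolding slack_def al using that by (auto intro!: sum.cong)
    have "c (ra ''al'' ?t2) y" if y: "y < n" for y
    proof -
      have "ra ''al'' ?t2 y = ra ''al'' t y" using y by simp
      moreover have "c (ra ''al'' t) y" using t y by (simp add: Inv_def)
      ultimately show ?thesis using sl[of y] y unfolding c_def by simp
    qed
    moreover have "c (ra ''al'' ?t2) n"
    proof -
      have lam: "ra ''lam'' ?t1 0 = ?lam" and alt: "ra ''al'' ?t1 = ra ''al'' t"
        using t by (simp_all add: Inv_def)
      have ps: "pair_slack ?t1 n x z = slack (ra ''al'' t) ?lam n x z" for x z
        using pair_slack_eq[OF St(2), of n x z] nq lam alt by simp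
      have rs: "raisable ?t1 n x z \<longleftrightarrow> valid x z \<and> d x n \<le> d x z" if "x < p" "z < q" for x z
        using valid_pair_eq[OF St(2)] that by (simp add: raisable_def St_simps[OF St(2)])
      have ex: "(\<exists>x<p. \<exists>z<q. raisable ?t1 n x z) \<longleftrightarrow> (\<exists>x z. valid x z \<and> d x n \<le> d x z)"
        using rs by (auto simp: valid_def)
      show ?thesis
      proof (cases "n \<in> U \<and> (\<exists>x z. valid x z \<and> d x n \<le> d x z)")
        case True
        let ?x = "min_fst p q (\<lambda>x z. raisable ?t1 n x z) (\<lambda>x z. pair_slack ?t1 n x z)"
        let ?z = "min_snd p q (\<lambda>x z. raisable ?t1 n x z) (\<lambda>x z. pair_slack ?t1 n x z)"
        have v: "?v = slack (ra ''al'' t) ?lam n ?x ?z"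
        proof -
          have "?v = pair_slack ?t1 n ?x ?z"
            using True ex St_simps[OF St(2)] nq by (simp add: raised_def)
          also have "\<dots> = slack (ra ''al'' t) ?lam n ?x ?z" by (rule ps)
          finally show ?thesis .
        qed
        have "\<exists>x<p. \<exists>z<q. raisable ?t1 n x z" using True ex by blast
        note m = min_fst_snd[OF this, where V = "\<lambda>x z. pair_slack ?t1 n x z"]
        have "valid ?x ?z" "d ?x n \<le> d ?x ?z" using m(3) rs[OF m(1,2)] by blast+
        moreover have min: "?v \<le> slack (ra ''al'' t) ?lam n x z" if "valid x z" "d x n \<le> d x z" for x z
          using m(4)[of x z] rs[of x z] that ps v by (simp add: valid_def)
        ultimately have "(\<exists>x z. valid x z \<and> d x n \<le> d x z \<and> ?v = slack (ra ''al'' t) ?lam n x z) \<and>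
            (\<forall>x z. valid x z \<and> d x n \<le> d x z \<longrightarrow> ?v \<le> slack (ra ''al'' t) ?lam n x z)"
          using v by blast
        moreover have "slack ((ra ''al'' t)(n := ?v)) ?lam n x z = slack (ra ''al'' t) ?lam n x z" for x z
          using sl[OF order_refl] unfolding al .
        ultimately show ?thesis
          unfolding c_def al fun_upd_same if_P[OF True] by (simp only:) blast
      next
        case False
        then have "?v = 0" using ex St_simps[OF St(2)] nq by (auto simp: raised_def)
        then show ?thesis unfolding c_def al fun_upd_same if_not_P[OF False] by simp
      qed
    qed
    ultimately have "Inv (Suc n) ?t2" using t St by (auto simp: Inv_def less_Suc_eq)
    then show "Inv (Suc n) (rset ''al'' (na ''y'' ?t1 0) (raised ?t1 (na ''y'' ?t1 0)) ?t1)" by simp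
  qed
  then show ?thesis using s unfolding Inv_def ascent_def c_def by (simp add: St_simps)
qed

text \<open>Each radius is the distance to a client, or both are the same guessed radius; the client
  that determines the smaller ball lies in both. Thus \<open>extend\<close> never inserts a centre a
  second time.\<close>

lemma covering_meets:
  assumes "covering X r" "covering Y r'" "x \<in> X" "x \<in> Y"
  shows "ball x (r x) \<inter> ball x (r' x) \<noteq> {}"
proof (cases "x \<in> G")
  case True
  then show ?thesis using G_client assms by (simp add: covering_def)
next
  case False
  obtain z where z: "r x = d x z" "valid x z" using covering_valid[OF assms(1,3) False] by blast
  obtain z' where z': "r' x = d x z'" "valid x z'" using covering_valid[OF assms(2,4) False] by blast
  show ?thesis
  proof (cases "d x z \<le> d x z'")
    case True
    then have "z \<in> ball x (r x) \<inter> ball x (r' x)" using z z' by (simp add: ball_def valid_def)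
    then show ?thesis by blast
  next
    case False
    then have "z' \<in> ball x (r x) \<inter> ball x (r' x)" using z z' by (simp add: ball_def valid_def)
    then show ?thesis by blast
  qed
qed

lemma flags_insert:
  "flags fl (insert_ball fl r x t s) = (if x s < nP s then insert (x s) (flags fl s) else flags fl s)"
  if "fl \<noteq> ''nF''" "x (rset r (x s) (t s) s) = x s"
  using that by (auto simp: insert_ball_def sequence_def flags_def nP_def)

lemma ra_insert: "ra r (insert_ball fl r x t s) = (ra r s)(x s := t s)"
  by (auto simp: insert_ball_def sequence_def)

lemma copy_family_simps:
  assumes "fl \<noteq> fl'" "r \<noteq> r'" "fl \<noteq> ''nF''" "fl' \<noteq> ''nF''"
  shows "flags fl' (copy_family fl r fl' r' s) = flags fl s"
    "x < nP s \<Longrightarrow> ra r' (copy_family fl r fl' r' s) x = ra r s x"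
    "w \<noteq> fl' \<Longrightarrow> nmem (copy_family fl r fl' r' s) w = nmem s w"
    "w \<noteq> r' \<Longrightarrow> rmem (copy_family fl r fl' r' s) w = rmem s w"
  using assms by (auto simp: copy_family_def sequence_def flags_def nP_def fun_eq_iff)

text \<open>Invariant of the greedy choice: \<open>selection\<close>, with the further alternative
  that a tight ball is still free. It holds for G alone because every guessed radius is at least
  R.\<close>

definition partial :: "real \<Rightarrow> (nat \<Rightarrow> real) \<Rightarrow> nat set \<Rightarrow> (nat \<Rightarrow> real) \<Rightarrow> bool" where
  "partial lam al X r \<longleftrightarrow> G \<subseteq> X \<and> X \<subseteq> {..<p} \<and> (\<forall>x\<in>G. r x = rG x) \<and> disjoint_balls X r \<and>
     (\<forall>x\<in>X - G. \<exists>z. r x = d x z \<and> tight al lam x z) \<and>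
     (\<forall>x z. tight al lam x z \<longrightarrow> (\<forall>x'\<in>X. ball x (d x z) \<inter> ball x' (r x') = {}) \<or>
       (\<exists>x'\<in>X. ball x (d x z) \<inter> ball x' (r x') \<noteq> {} \<and> d x z \<le> r x'))"

text \<open>A chosen centre blocks all tight balls around itself, so every round of the selection
  adds a new centre.\<close>

lemma partial_meets:
  assumes "partial lam al X r" "tight al lam x z" "x \<in> X"
  shows "ball x (d x z) \<inter> ball x (r x) \<noteq> {}"
proof -
  have v: "z < q" "d x z \<le> R" using assms(2) by (auto simp: tight_def valid_def)
  show ?thesis
  proof (cases "x \<in> G")
    case True
    then have "r x = rG x" using assms(1) by (simp add: partial_def)
    then have "z \<in> ball x (d x z) \<inter> ball x (r x)" using v G_radius[OF True] by (simp add: ball_def)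
    then show ?thesis by blast
  next
    case False
    then obtain z' where "r x = d x z'" "z' < q"
      using assms(1,3) unfolding partial_def tight_def valid_def by blast
    then have "z \<in> ball x (d x z) \<inter> ball x (r x) \<or> z' \<in> ball x (d x z) \<inter> ball x (r x)"
      using v by (auto simp: ball_def)
    then show ?thesis by blast
  qed
qed

text \<open>A ball that gets blocked only now was free before, hence by \<open>max\<close> no larger
  than the ball that blocks it.\<close>

lemma partial_insert:
  assumes X: "partial lam al X r" and xz: "tight al lam x z" "\<forall>x'\<in>X. ball x (d x z) \<inter> ball x' (r x') = {}"
    and max: "\<And>x' z'. tight al lam x' z' \<Longrightarrow> (\<forall>y\<in>X. ball x' (d x' z') \<inter> ball y (r y) = {}) \<Longrightarrow> d x' z' \<le> d x z"
  shows "x \<notin> X" "partial lam al (insert x X) (r(x := d x z))"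
proof -
  show x: "x \<notin> X" using partial_meets[OF X xz(1)] xz(2) by blast
  have xG: "x \<notin> G" using X x by (auto simp: partial_def)
  show "partial lam al (insert x X) (r(x := d x z))"
    unfolding partial_def
  proof (intro conjI ballI allI impI)
    show "disjoint_balls (insert x X) (r(x := d x z))"
      using X xz(2) x by (fastforce simp: partial_def disjoint_balls_def)
    fix x' z' assume t: "tight al lam x' z'"
    let ?D = "\<lambda>y. ball x' (d x' z') \<inter> ball y ((r(x := d x z)) y) = {}"
    show "(\<forall>y\<in>insert x X. ?D y) \<or> (\<exists>y\<in>insert x X. \<not> ?D y \<and> d x' z' \<le> (r(x := d x z)) y)"
    proof (cases "\<forall>y\<in>X. ball x' (d x' z') \<inter> ball y (r y) = {}")
      case True
      then have D: "\<forall>y\<in>X. ?D y" using x by auto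
      show ?thesis
      proof (cases "?D x")
        case False
        then show ?thesis using max[OF t True] by (intro disjI2 bexI[of _ x]) auto
      qed (use D in auto)
    next
      case False
      then obtain y where y: "y \<in> X" "ball x' (d x' z') \<inter> ball y (r y) \<noteq> {}" "d x' z' \<le> r y"
        using X t unfolding partial_def by blast
      then have "y \<noteq> x" using x by auto
      then show ?thesis using y by (intro disjI2 bexI[of _ y]) auto
    qed
  next
    fix y assume "y \<in> insert x X - G"
    then show "\<exists>z'. (r(x := d x z)) y = d y z' \<and> tight al lam y z'"
      using X xz(1) by (cases "y = x") (auto simp: partial_def)
  qed (use X xz xG in \<open>auto simp: partial_def tight_def valid_def\<close>)
qed

lemma select_correct:
  assumes s: "St s" "Gs s"
  shows "selection (ra ''lam'' s 0) (ra ''al'' s) (flags ''mo'' (select s)) (ra ''mr'' (select s))"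
proof -
  let ?lam = "ra ''lam'' s 0" and ?al = "ra ''al'' s"
  let ?s1 = "copy_family ''go'' ''gr'' ''mo'' ''mr'' s"
  define stuck where "stuck X r \<longleftrightarrow> (\<forall>x z. tight ?al ?lam x z \<longrightarrow> \<not> (\<forall>x'\<in>X. ball x (d x z) \<inter> ball x' (r x') = {}))" for X r
  \<comment> \<open>The final disjunction measures progress: after n rounds there are at least n
    centres, or no tight ball is free.\<close>
  define Inv where "Inv n t \<longleftrightarrow> St t \<and> ra ''lam'' t 0 = ?lam \<and> ra ''al'' t = ?al \<and>
     partial ?lam ?al (flags ''mo'' t) (ra ''mr'' t) \<and>
     (n \<le> card (flags ''mo'' t) \<or> stuck (flags ''mo'' t) (ra ''mr'' t))" for n t
  have St1: "St ?s1"
    using s(1) by (simp add: copy_family_def sequence_def loads_def)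
  have G1: "flags ''mo'' ?s1 = G" "\<And>x. x \<in> G \<Longrightarrow> ra ''mr'' ?s1 x = rG x"
  proof -
    show "flags ''mo'' ?s1 = G" using s by (simp add: copy_family_simps Gs_def)
    fix x assume "x \<in> G"
    then show "ra ''mr'' ?s1 x = rG x"
      using s G_sub by (auto simp: copy_family_simps Gs_def St_simps)
  qed
  have part: "partial ?lam ?al G (ra ''mr'' ?s1)"
    unfolding partial_def
  proof (intro conjI ballI allI impI)
    show "disjoint_balls G (ra ''mr'' ?s1)" using G1 G_disjoint by (simp add: disjoint_balls_def)
    fix x z assume "tight ?al ?lam x z"
    then have "d x z \<le> R" by (simp add: tight_def valid_def)
    then have "d x z \<le> ra ''mr'' ?s1 x'" if "x' \<in> G" for x' using G1(2)[OF that] G_radius[OF that] by simp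
    then show "(\<forall>x'\<in>G. ball x (d x z) \<inter> ball x' (ra ''mr'' ?s1 x') = {}) \<or>
       (\<exists>x'\<in>G. ball x (d x z) \<inter> ball x' (ra ''mr'' ?s1 x') \<noteq> {} \<and> d x z \<le> ra ''mr'' ?s1 x')" by blast
  qed (use G1 G_sub in auto)
  have n1: "nP ?s1 = p" using St1 by (simp add: St_simps)
  define B where "B = ifs (\<lambda>s. \<exists>x<nP s. \<exists>z<nQ s. eligible s x z)
       ((\<lambda>s. nset ''bx'' 0 (largest_fst s) s) ;; (\<lambda>s. nset ''bz'' 0 (largest_snd s) s) ;;
        insert_ball ''mo'' ''mr'' (\<lambda>s. na ''bx'' s 0) (\<lambda>s. dst s (na ''bx'' s 0) (na ''bz'' s 0))) skip"
  have sel: "select s = forv ''i'' nP B ?s1" by (simp add: select_def B_def sequence_def)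
  have "Inv (nP ?s1) (select s)"
    unfolding sel
  proof (rule forv_induct)
    show "Inv 0 ?s1" using St1 G1 part by (simp add: Inv_def copy_family_simps)
    fix n t assume "n < nP ?s1" and t: "Inv n t"
    let ?t = "nset ''i'' 0 n t" and ?X = "flags ''mo'' t" and ?r = "ra ''mr'' t"
    have St: "St t" "St ?t" using t by (simp_all add: Inv_def loads_def)
    have fl: "flags ''mo'' ?t = ?X" "ra ''mr'' ?t = ?r" by (simp_all add: flags_def nP_def)
    have el: "eligible ?t x z \<longleftrightarrow> tight ?al ?lam x z \<and> (\<forall>x'\<in>?X. ball x (d x z) \<inter> ball x' (?r x') = {})"
      if "x < p" "z < q" for x z
      using that tight_pair_eq[OF St(2) that] separate_eq[OF St(2)] fl t
      by (simp add: eligible_def Inv_def St_simps[OF St(2)])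
    show "Inv (Suc n) (B ?t)"
    proof (cases "\<exists>x<p. \<exists>z<q. eligible ?t x z")
      case False
      then have "B ?t = ?t" by (simp only: B_def ifs_def St_simps[OF St(2)] skip_def if_False)
      moreover have "stuck ?X ?r" unfolding stuck_def using False el by (metis tight_def valid_def)
      ultimately show ?thesis using t fl St by (simp add: Inv_def)
    next
      case True
      define x z where "x = largest_fst ?t" and "z = largest_snd ?t"
      note m = min_fst_snd[OF True, where V = "\<lambda>x z. 0 - d x z"]
      have xz: "x < p" "z < q" "eligible ?t x z" "\<And>x' z'. x' < p \<Longrightarrow> z' < q \<Longrightarrow> eligible ?t x' z' \<Longrightarrow> d x' z' \<le> d x z"
        using m unfolding x_def z_def largest_fst_def largest_snd_def St_simps[OF St(2)] by auto
      let ?t1 = "nset ''bx'' 0 x ?t"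
      have "eligible ?t1 = eligible ?t"
        by (intro ext) (simp add: eligible_def tight_pair_def valid_pair_def pair_slack_def state_defs cong: if_cong)
      then have "largest_snd ?t1 = z" by (simp add: z_def largest_snd_def state_defs)
      then have Bt: "B ?t = insert_ball ''mo'' ''mr'' (\<lambda>s. na ''bx'' s 0) (\<lambda>s. dst s (na ''bx'' s 0) (na ''bz'' s 0))
          (nset ''bz'' 0 z ?t1)"
        using True by (simp add: B_def ifs_def St_simps[OF St(2)] sequence_def x_def[symmetric])
      let ?t2 = "nset ''bz'' 0 z ?t1"
      have St2: "St ?t2" using St by (simp add: loads_def)
      have X': "flags ''mo'' (B ?t) = insert x ?X"
        unfolding Bt using xz(1) St_simps(1)[OF St2] by (subst flags_insert) (simp_all add: flags_def nP_def)
      have r': "ra ''mr'' (B ?t) = ?r(x := d x z)"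
        unfolding Bt ra_insert St_simps(3)[OF St2] by simp
      have "partial ?lam ?al ?X ?r" using t by (simp add: Inv_def)
      moreover have "d x' z' \<le> d x z" if "tight ?al ?lam x' z'" "\<forall>y\<in>?X. ball x' (d x' z') \<inter> ball y (?r y) = {}" for x' z'
        using xz(4) el that by (metis tight_def valid_def)
      moreover have "tight ?al ?lam x z" "\<forall>x'\<in>?X. ball x (d x z) \<inter> ball x' (?r x') = {}"
        using xz(3) el[OF xz(1,2)] by auto
      ultimately have "x \<notin> ?X" "partial ?lam ?al (insert x ?X) (?r(x := d x z))"
        using partial_insert by blast+
      moreover have "\<not> stuck ?X ?r" unfolding stuck_def using xz(3) el[OF xz(1,2)] by blast
      moreover have "St (B ?t)" unfolding Bt insert_ball_def sequence_def using St2 by (simp add: loads_def)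
      moreover have "ra ''lam'' (B ?t) 0 = ?lam" "ra ''al'' (B ?t) = ?al"
        using t by (simp_all add: Bt insert_ball_def sequence_def Inv_def)
      ultimately show ?thesis using t unfolding Inv_def X' r' by simp
    qed
  qed
  then have I: "Inv p (select s)" by (simp add: n1)
  let ?X = "flags ''mo'' (select s)" and ?r = "ra ''mr'' (select s)"
  have P: "partial ?lam ?al ?X ?r" using I by (simp add: Inv_def)
  \<comment> \<open>If all p centres are chosen, every tight ball is blocked at its own centre by
    \<open>partial_meets\<close>.\<close>
  have "stuck ?X ?r"
  proof (cases "p \<le> card ?X")
    case True
    then have "?X = {..<p}" using P by (intro card_subset_eq) (auto simp: partial_def card_mono subset_antisym dest!: card_mono[rotated])
    moreover have "x < p" if "tight ?al ?lam x z" for x z using that by (simp add: tight_def valid_def)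
    ultimately show ?thesis unfolding stuck_def using partial_meets[OF P] by blast
  qed (use I in \<open>simp add: Inv_def\<close>)
  then show ?thesis using P unfolding selection_def partial_def stuck_def by blast
qed

section \<open>Binary search for the multiplier\<close>

lemma selection_cong:
  assumes "selection lam al X r" "\<And>x. x \<in> X \<Longrightarrow> r' x = r x"
  shows "selection lam al X r'"
proof -
  have "disjoint_balls X r'" using assms by (simp add: selection_def disjoint_balls_def)
  moreover have "\<forall>x\<in>G. r' x = rG x" "\<forall>x\<in>X - G. \<exists>z. r' x = d x z \<and> tight al lam x z"
    using assms by (auto simp: selection_def)
  moreover have "\<exists>x'\<in>X. ball x (d x z) \<inter> ball x' (r' x') \<noteq> {} \<and> d x z \<le> r' x'" if t: "tight al lam x z" for x z
  proof -
    obtain x' where "x' \<in> X" "ball x (d x z) \<inter> ball x' (r x') \<noteq> {}" "d x z \<le> r x'"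
      using assms(1) t unfolding selection_def by blast
    then show ?thesis using assms(2)[of x'] by (intro bexI[of _ x']) auto
  qed
  ultimately show ?thesis using assms(1) by (simp add: selection_def)
qed

text \<open>The array \<open>al\<close> is overwritten by the next halving, so for a stored family
  only the existence of a suitable dual is remembered.\<close>

definition sel_at :: "real \<Rightarrow> var \<Rightarrow> var \<Rightarrow> state \<Rightarrow> bool" where
  "sel_at lam fl r s \<longleftrightarrow> (\<exists>al. ascent lam al \<and> selection lam al (flags fl s) (ra r s))"

lemma sel_at_cong:
  "nmem t fl = nmem s fl \<Longrightarrow> rmem t r = rmem s r \<Longrightarrow> nP t = nP s \<Longrightarrow> sel_at lam fl r t \<longleftrightarrow> sel_at lam fl r s"
  by (simp add: sel_at_def flags_def)

lemma sel_at_copy: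
  assumes s: "St s" and sel: "sel_at lam fl r s" and n: "fl \<noteq> fl'" "r \<noteq> r'" "fl \<noteq> ''nF''" "fl' \<noteq> ''nF''"
  shows "sel_at lam fl' r' (copy_family fl r fl' r' s)"
proof -
  obtain al where al: "ascent lam al" "selection lam al (flags fl s) (ra r s)"
    using sel by (auto simp: sel_at_def)
  have "x < nP s" if "x \<in> flags fl s" for x using that by (simp add: flags_def)
  then have "selection lam al (flags fl s) (ra r' (copy_family fl r fl' r' s))"
    using n by (intro selection_cong[OF al(2)]) (simp add: copy_family_simps)
  then show ?thesis using al(1) n unfolding sel_at_def by (auto simp: copy_family_simps)
qed

lemma nP_St: "St s \<Longrightarrow> St t \<Longrightarrow> nP t = nP s"
  by (simp add: St_simps)

lemma halve_correct:
  assumes s: "St s" "Gs s" and lam_def: "lam = (ra ''lo'' s 0 + ra ''hi'' s 0) / 2"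
  defines "t \<equiv> halve s"
  shows "St t" "Gs t"
    "ra ''lo'' t 0 = lam \<and> ra ''hi'' t 0 = ra ''hi'' s 0 \<and>
       sel_at lam ''ao'' ''ar'' t \<and> card G + kk < card (flags ''ao'' t) \<and>
       nmem t ''bo'' = nmem s ''bo'' \<and> rmem t ''br'' = rmem s ''br'' \<or>
     ra ''lo'' t 0 = ra ''lo'' s 0 \<and> ra ''hi'' t 0 = lam \<and>
       sel_at lam ''bo'' ''br'' t \<and> card (flags ''bo'' t) \<le> card G + kk \<and>
       nmem t ''ao'' = nmem s ''ao'' \<and> rmem t ''ar'' = rmem s ''ar''"
proof -
  let ?W = "{''i'', ''y'', ''al'', ''mo'', ''mr'', ''bx'', ''bz'', ''lam'', ''lo'', ''hi'', ''ao'', ''ar'', ''bo'', ''br''}"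
  have W: "stm ?W halve" by (rule stm_halve) auto
  show "St t" unfolding t_def by (rule St_stm[OF W]) (auto simp: loads_def s)
  show "Gs t" unfolding t_def by (rule Gs_stm[OF W]) (auto simp: s)
  define s1 where "s1 = rset ''lam'' 0 lam s"
  define s2 where "s2 = ascend s1"
  define s3 where "s3 = select s2"
  have Wa: "stm {''y'', ''al''} ascend" by (rule stm_ascend) (auto simp: writable_simps)
  have Ws: "stm {''i'', ''mo'', ''mr'', ''bx'', ''bz''} select" by (rule stm_select) (auto simp: writable_simps)
  have St: "St s1" "St s2" "St s3"
    unfolding s3_def s2_def s1_def by (rule St_stm[OF Ws] St_stm[OF Wa] | simp add: s loads_def)+
  have Gs: "Gs s1" "Gs s2" "Gs s3"
    unfolding s3_def s2_def s1_def by (rule Gs_stm[OF Ws] Gs_stm[OF Wa] | simp add: s)+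
  have m2: "nmem s2 v = nmem s1 v" "rmem s2 v = rmem s1 v" if "v \<notin> {''y'', ''al''}" for v
    using stm_frame[OF Wa that] by (simp_all add: s2_def)
  have m3: "nmem s3 v = nmem s2 v" "rmem s3 v = rmem s2 v" if "v \<notin> {''i'', ''mo'', ''mr'', ''bx'', ''bz''}" for v
    using stm_frame[OF Ws that] by (simp_all add: s3_def)
  have lam2: "ra ''lam'' s2 0 = lam" by (simp add: m2 s1_def)
  have "ascent (ra ''lam'' s1 0) (ra ''al'' s2)" unfolding s2_def by (rule ascend_correct[OF St(1)])
  then have asc: "ascent lam (ra ''al'' s2)" by (simp add: s1_def)
  have "selection lam (ra ''al'' s2) (flags ''mo'' s3) (ra ''mr'' s3)"
    using select_correct[OF St(2) Gs(2)] unfolding lam2 s3_def .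
  then have sel: "sel_at lam ''mo'' ''mr'' s3" using asc by (auto simp: sel_at_def)
  have go: "flags ''go'' s3 = G" using Gs(3) by (simp add: Gs_def)
  have lam3: "ra ''lam'' s3 0 = lam" using lam2 by (simp add: m3)
  have keep: "ra ''lo'' s3 0 = ra ''lo'' s 0" "ra ''hi'' s3 0 = ra ''hi'' s 0"
    "nmem s3 ''bo'' = nmem s ''bo''" "rmem s3 ''br'' = rmem s ''br''"
    "nmem s3 ''ao'' = nmem s ''ao''" "rmem s3 ''ar'' = rmem s ''ar''"
    by (simp_all add: m2 m3 s1_def)
  have t: "t = (if card G + kk < card (flags ''mo'' s3)
      then copy_family ''mo'' ''mr'' ''ao'' ''ar'' (rset ''lo'' 0 lam s3)
      else copy_family ''mo'' ''mr'' ''bo'' ''br'' (rset ''hi'' 0 lam s3))"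
    unfolding t_def halve_def sequence_def ifs_def
      lam_def[symmetric] s1_def[symmetric] s2_def[symmetric] s3_def[symmetric]
    by (simp add: members_count_eq go St_simps[OF St(3)] lam3)
  let ?u = "rset ''lo'' 0 lam s3" and ?v = "rset ''hi'' 0 lam s3"
  have "sel_at lam ''mo'' ''mr'' ?u" "sel_at lam ''mo'' ''mr'' ?v"
    using sel by (simp_all add: sel_at_def flags_def nP_def)
  moreover have "St ?u" "St ?v" using St(3) by (simp_all add: loads_def)
  ultimately have c: "sel_at lam ''ao'' ''ar'' (copy_family ''mo'' ''mr'' ''ao'' ''ar'' ?u)"
      "sel_at lam ''bo'' ''br'' (copy_family ''mo'' ''mr'' ''bo'' ''br'' ?v)"
    by (simp_all add: sel_at_copy)
  have fl: "flags ''mo'' ?u = flags ''mo'' s3" "flags ''mo'' ?v = flags ''mo'' s3"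
    by (simp_all add: flags_def nP_def)
  show "ra ''lo'' t 0 = lam \<and> ra ''hi'' t 0 = ra ''hi'' s 0 \<and>
       sel_at lam ''ao'' ''ar'' t \<and> card G + kk < card (flags ''ao'' t) \<and>
       nmem t ''bo'' = nmem s ''bo'' \<and> rmem t ''br'' = rmem s ''br'' \<or>
     ra ''lo'' t 0 = ra ''lo'' s 0 \<and> ra ''hi'' t 0 = lam \<and>
       sel_at lam ''bo'' ''br'' t \<and> card (flags ''bo'' t) \<le> card G + kk \<and>
       nmem t ''ao'' = nmem s ''ao'' \<and> rmem t ''ar'' = rmem s ''ar''"
    using c keep fl unfolding t by (cases "card G + kk < card (flags ''mo'' s3)") (simp_all add: copy_family_simps)
qed

text \<open>Chosen to exceed \<open>real (card Op) * R\<close>, as |Op| is at most q; this is the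
  threshold in \<open>selection_card\<close>. For R = 0 any positive value serves.\<close>

definition hmax :: real where "hmax = (if 0 < R then (real q + 1) * R else 1)"

definition searched :: "state \<Rightarrow> bool" where
  "searched s \<longleftrightarrow> St s \<and> Gs s \<and> 0 \<le> ra ''lo'' s 0 \<and>
     ra ''hi'' s 0 - ra ''lo'' s 0 = 2 * hmax / 2 ^ (12 * q + 1) \<and>
     (ra ''lo'' s 0 = 0 \<or> sel_at (ra ''lo'' s 0) ''ao'' ''ar'' s \<and> card G + kk < card (flags ''ao'' s)) \<and>
     sel_at (ra ''hi'' s 0) ''bo'' ''br'' s \<and> card (flags ''bo'' s) \<le> card G + kk"

lemma hmax_pos: "0 < hmax"
  by (simp add: hmax_def)

lemma sel_at_hmax:
  assumes "sel_at hmax fl r s"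
  shows "card (flags fl s) \<le> card G + kk"
proof -
  obtain al where al: "ascent hmax al" "selection hmax al (flags fl s) (ra r s)"
    using assms by (auto simp: sel_at_def)
  have "real (card Op) * R < hmax"
  proof (cases "0 < R")
    case True
    have "real (card Op) * R < (real q + 1) * R" using Op_q True by (intro mult_strict_right_mono) auto
    then show ?thesis using True by (simp add: hmax_def)
  next
    case False
    then have "real (card Op) * R = 0" using R_nonneg by simp
    then show ?thesis using hmax_pos by linarith
  qed
  then have "card (flags fl s - G) \<le> card Op" by (rule selection_card[OF al])
  moreover have "card (flags fl s) = card G + card (flags fl s - G)"
    using card_split_G[OF selection_covering[OF less_imp_le[OF hmax_pos] al]] .
  ultimately show ?thesis using Op_kk by simp
qed

lemma search_correct:
  assumes s: "St s" "Gs s"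
  shows "searched (search s)"
proof -
  let ?s = "rset ''hi'' 0 (2 * hmax) (rset ''lo'' 0 0 s)"
  \<comment> \<open>Before the first round \<open>bo\<close> and \<open>br\<close> are meaningless,
    so the invariant asks for \<open>lo = 0\<close> instead. The first midpoint is then
    \<open>hmax\<close>, and \<open>sel_at_hmax\<close> rules out that this round moves
    \<open>lo\<close>.\<close>
  define Inv where "Inv n t \<longleftrightarrow> St t \<and> Gs t \<and> 0 \<le> ra ''lo'' t 0 \<and>
     ra ''hi'' t 0 - ra ''lo'' t 0 = 2 * hmax / 2 ^ n \<and>
     (ra ''lo'' t 0 = 0 \<or> sel_at (ra ''lo'' t 0) ''ao'' ''ar'' t \<and> card G + kk < card (flags ''ao'' t)) \<and>
     (if n = 0 then ra ''lo'' t 0 = 0 else sel_at (ra ''hi'' t 0) ''bo'' ''br'' t \<and> card (flags ''bo'' t) \<le> card G + kk)" for n t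
  let ?n = "\<lambda>s. nQ s + nQ s + nQ s + nQ s + nQ s + nQ s + nQ s + nQ s + nQ s + nQ s + nQ s + nQ s + 1"
  have St: "St ?s" "Gs ?s" using s by (simp_all add: loads_def)
  have "guess_radius (rset ''lo'' 0 0 s) = R" "nQ (rset ''lo'' 0 0 s) = q"
    using St_simps[of "rset ''lo'' 0 0 s"] s by (simp_all add: loads_def)
  then have eq: "search s = forv ''t'' ?n halve ?s"
    by (simp add: search_def sequence_def hmax_def)
  have n: "?n ?s = 12 * q + 1" using St_simps(2)[OF St(1)] by simp
  have "Inv (?n ?s) (search s)"
    unfolding eq
  proof (rule forv_induct)
    show "Inv 0 ?s" using St by (simp add: Inv_def)
    fix n t assume t: "Inv n t"
    let ?t = "nset ''t'' 0 n t"
    define lam where "lam = (ra ''lo'' t 0 + ra ''hi'' t 0) / 2"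
    have I: "St t" "Gs t" "0 \<le> ra ''lo'' t 0" "ra ''hi'' t 0 - ra ''lo'' t 0 = 2 * hmax / 2 ^ n"
      using t by (auto simp: Inv_def)
    have St': "St ?t" "Gs ?t" using I by (simp_all add: loads_def)
    have lam': "lam = (ra ''lo'' ?t 0 + ra ''hi'' ?t 0) / 2" by (simp add: lam_def)
    note h = halve_correct[OF St' lam']
    have gap: "ra ''hi'' t 0 - lam = 2 * hmax / 2 ^ Suc n" "lam - ra ''lo'' t 0 = 2 * hmax / 2 ^ Suc n"
      using I(4) by (simp_all add: lam_def field_simps)
    have "0 \<le> hmax / 2 ^ n" using hmax_pos by simp
    then have lam0: "0 \<le> lam" using I by (simp add: lam_def)
    have np: "nP (halve ?t) = nP t" using nP_St[OF I(1) h(1)] .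
    from h(3) show "Inv (Suc n) (halve ?t)"
    proof (elim disjE conjE)
      assume a: "ra ''lo'' (halve ?t) 0 = lam" "ra ''hi'' (halve ?t) 0 = ra ''hi'' ?t 0"
        "sel_at lam ''ao'' ''ar'' (halve ?t)" "card G + kk < card (flags ''ao'' (halve ?t))"
        "nmem (halve ?t) ''bo'' = nmem ?t ''bo''" "rmem (halve ?t) ''br'' = rmem ?t ''br''"
      have n0: "n \<noteq> 0"
      proof
        assume "n = 0"
        then have "lam = hmax" using t by (simp add: Inv_def lam_def)
        then show False using sel_at_hmax a(3,4) by fastforce
      qed
      have "sel_at (ra ''hi'' t 0) ''bo'' ''br'' (halve ?t)" "flags ''bo'' (halve ?t) = flags ''bo'' t"
        using sel_at_cong[of "halve ?t" "''bo''" t "''br''"] t a np n0 by (simp_all add: Inv_def flags_def)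
      then show ?thesis using a h(1,2) lam0 gap t n0 by (simp add: Inv_def)
    next
      assume a: "ra ''lo'' (halve ?t) 0 = ra ''lo'' ?t 0" "ra ''hi'' (halve ?t) 0 = lam"
        "sel_at lam ''bo'' ''br'' (halve ?t)" "card (flags ''bo'' (halve ?t)) \<le> card G + kk"
        "nmem (halve ?t) ''ao'' = nmem ?t ''ao''" "rmem (halve ?t) ''ar'' = rmem ?t ''ar''"
      have "sel_at l ''ao'' ''ar'' (halve ?t) = sel_at l ''ao'' ''ar'' t" "flags ''ao'' (halve ?t) = flags ''ao'' t" for l
        using sel_at_cong[of "halve ?t" "''ao''" t "''ar''"] a np by (simp_all add: flags_def)
      then show ?thesis using a h(1,2) I gap t by (simp add: Inv_def)
    qed
  qed
  then show ?thesis unfolding n by (simp add: Inv_def searched_def)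
qed

text \<open>While the budget is not exhausted, a scanned ball of A is inserted unless it meets the
  current family, so in either case it meets the family afterwards. This yields the last
  alternative.\<close>

lemma extend_correct:
  assumes s: "searched s" and lo: "0 < ra ''lo'' s 0"
  defines "A \<equiv> flags ''ao'' s" and "B0 \<equiv> flags ''bo'' s" and "B \<equiv> flags ''bo'' (extend s)" and "rA \<equiv> ra ''ar'' s"
    and "rB0 \<equiv> ra ''br'' s" and "rB \<equiv> ra ''br'' (extend s)"
  shows "B0 \<subseteq> B" "B \<subseteq> {..<p}" "x \<in> B0 \<Longrightarrow> rB x = rB0 x" "x \<in> B - B0 \<Longrightarrow> x \<in> A \<and> rB x = rA x"
    "disjoint_balls B rB" "card B \<le> card G + kk"
    "card B = card G + kk \<or> (\<forall>a\<in>A. \<exists>b\<in>B. ball a (rA a) \<inter> ball b (rB b) \<noteq> {})"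
proof -
  have S: "St s" "Gs s" using s by (auto simp: searched_def)
  obtain al where al: "ascent (ra ''lo'' s 0) al" "selection (ra ''lo'' s 0) al A rA"
    using s lo by (auto simp: searched_def sel_at_def A_def rA_def)
  obtain al2 where al2: "ascent (ra ''hi'' s 0) al2" "selection (ra ''hi'' s 0) al2 B0 rB0"
    using s by (auto simp: searched_def sel_at_def B0_def rB0_def)
  have "0 \<le> 2 * hmax / 2 ^ (12 * q + 1)" using hmax_pos by simp
  then have hi: "0 \<le> ra ''hi'' s 0" using s lo by (simp add: searched_def)
  have covA: "covering A rA" using selection_covering[OF _ al] lo by simp
  have covB0: "covering B0 rB0" using selection_covering[OF hi al2] .
  define Inv where "Inv n t \<longleftrightarrow> St t \<and> Gs t \<and> flags ''ao'' t = A \<and> ra ''ar'' t = rA \<and>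
     (let X = flags ''bo'' t; r = ra ''br'' t in B0 \<subseteq> X \<and> X \<subseteq> {..<p} \<and> (\<forall>x\<in>B0. r x = rB0 x) \<and>
       (\<forall>x\<in>X - B0. x \<in> A \<and> r x = rA x) \<and> disjoint_balls X r \<and> card X \<le> card G + kk \<and>
       (card X = card G + kk \<or> (\<forall>a\<in>A. a < n \<longrightarrow> (\<exists>b\<in>X. ball a (rA a) \<inter> ball b (r b) \<noteq> {}))))" for n t
  define Bd where "Bd = ifs (\<lambda>s. members_count ''bo'' s < members_count ''go'' s + spare s \<and>
         na ''ao'' s (na ''i'' s 0) \<noteq> 0 \<and> separate ''bo'' ''br'' s (na ''i'' s 0) (ra ''ar'' s (na ''i'' s 0)))
       (insert_ball ''bo'' ''br'' (\<lambda>s. na ''i'' s 0) (\<lambda>s. ra ''ar'' s (na ''i'' s 0))) skip"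
  have eq: "extend s = forv ''i'' nP Bd s" using lo by (simp add: extend_def ifs_def Bd_def)
  have "Inv (nP s) (extend s)"
    unfolding eq
  proof (rule forv_induct)
    show "Inv 0 s" using S covB0 s unfolding Inv_def Let_def
      by (auto simp: A_def rA_def B0_def rB0_def covering_def searched_def)
    fix n t assume "n < nP s" and t: "Inv n t"
    then have n: "n < p" using S by (simp add: St_simps)
    let ?t = "nset ''i'' 0 n t" and ?X = "flags ''bo'' t" and ?r = "ra ''br'' t"
    have I: "St t" "Gs t" "flags ''ao'' t = A" "ra ''ar'' t = rA" "B0 \<subseteq> ?X" "?X \<subseteq> {..<p}" "\<And>x. x \<in> B0 \<Longrightarrow> ?r x = rB0 x"
       "\<And>x. x \<in> ?X - B0 \<Longrightarrow> x \<in> A \<and> ?r x = rA x" "disjoint_balls ?X ?r" "card ?X \<le> card G + kk"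
       "card ?X = card G + kk \<or> (\<forall>a\<in>A. a < n \<longrightarrow> (\<exists>b\<in>?X. ball a (rA a) \<inter> ball b (?r b) \<noteq> {}))"
      using t unfolding Inv_def Let_def by auto
    have St: "St ?t" "Gs ?t" using I by (simp_all add: loads_def)
    have fl: "flags ''bo'' ?t = ?X" "ra ''br'' ?t = ?r" "flags ''ao'' ?t = A" "ra ''ar'' ?t = rA" "flags ''go'' ?t = G"
      using I St(2) by (simp_all add: flags_def nP_def Gs_def)
    have ao: "na ''ao'' t n \<noteq> 0 \<longleftrightarrow> n \<in> A" using I(1,3) n by (auto simp: flags_def St_simps)
    let ?c = "card ?X < card G + kk \<and> n \<in> A \<and> (\<forall>x'\<in>?X. ball n (rA n) \<inter> ball x' (?r x') = {})"
    have c: "Bd ?t = (if ?c then insert_ball ''bo'' ''br'' (\<lambda>s. na ''i'' s 0) (\<lambda>s. ra ''ar'' s (na ''i'' s 0)) ?t else ?t)"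
      using separate_eq[OF St(1), of "''bo''" "''br''" n "rA n"] fl(1,3,5) ao fun_cong[OF I(4), of n]
      by (simp add: Bd_def ifs_def skip_def members_count_eq St_simps[OF St(1)] cong: conj_cong)
    show "Inv (Suc n) (Bd ?t)"
    proof (cases ?c)
      case True
      \<comment> \<open>A centre already present blocks its own ball from A, by
        \<open>covering_meets\<close>, so the insertion never changes a radius.\<close>
      have nX: "n \<notin> ?X"
      proof
        assume nX: "n \<in> ?X"
        show False
        proof (cases "n \<in> B0")
          case True
          then show False using covering_meets[OF covA covB0, of n] I(7)[OF True] \<open>?c\<close> nX by fastforce
        next
          case False
          then show False using covering_meets[OF covA covA, of n] I(8)[of n] \<open>?c\<close> nX by fastforce
        qed
      qed
      have Bt: "Bd ?t = insert_ball ''bo'' ''br'' (\<lambda>s. na ''i'' s 0) (\<lambda>s. ra ''ar'' s (na ''i'' s 0)) ?t"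
        using c True by simp
      have X': "flags ''bo'' (Bd ?t) = insert n ?X"
        unfolding Bt using n St_simps(1)[OF St(1)] fl(1) by (subst flags_insert) simp_all
      have r': "ra ''br'' (Bd ?t) = ?r(n := rA n)"
        unfolding Bt ra_insert using fun_cong[OF I(4), of n] by simp
      have ne: "ball n (rA n) \<noteq> {}" using covering_meets[OF covA covA, of n] True by auto
      have "St (Bd ?t)" "Gs (Bd ?t)" "flags ''ao'' (Bd ?t) = A" "ra ''ar'' (Bd ?t) = rA"
        unfolding Bt insert_ball_def sequence_def using St fl by (simp_all add: loads_def flags_def nP_def)
      moreover have "disjoint_balls (insert n ?X) (?r(n := rA n))"
        using I(9) True nX by (fastforce simp: disjoint_balls_def)
      moreover have "card (insert n ?X) \<le> card G + kk" using nX True by simp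
      moreover have "card (insert n ?X) = card G + kk \<or> (\<forall>a\<in>A. a < Suc n \<longrightarrow>
          (\<exists>b\<in>insert n ?X. ball a (rA a) \<inter> ball b ((?r(n := rA n)) b) \<noteq> {}))"
      proof -
        have "\<exists>b\<in>insert n ?X. ball a (rA a) \<inter> ball b ((?r(n := rA n)) b) \<noteq> {}" if a: "a \<in> A" "a < Suc n" for a
        proof (cases "a = n")
          case True
          then show ?thesis using ne by (intro bexI[of _ n]) auto
        next
          case False
          then have "a < n" "card ?X \<noteq> card G + kk" using a \<open>?c\<close> by auto
          then obtain b where "b \<in> ?X" "ball a (rA a) \<inter> ball b (?r b) \<noteq> {}"
            using I(11) a(1) by blast
          then show ?thesis using nX by (intro bexI[of _ b]) auto
        qed
        then show ?thesis by blast
      qed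
      moreover have "\<forall>x\<in>B0. (?r(n := rA n)) x = rB0 x" using I(5,7) nX by auto
      moreover have "\<forall>x\<in>insert n ?X - B0. x \<in> A \<and> (?r(n := rA n)) x = rA x" using I(8) True by auto
      ultimately show ?thesis unfolding Inv_def Let_def X' r' using I(5,6) n by auto
    next
      case False
      have "card ?X = card G + kk \<or> (\<forall>a\<in>A. a < Suc n \<longrightarrow> (\<exists>b\<in>?X. ball a (rA a) \<inter> ball b (?r b) \<noteq> {}))"
        using I(10,11) False by (metis le_neq_implies_less less_Suc_eq)
      moreover have "Bd ?t = ?t" using c False by (simp only: if_False)
      ultimately show ?thesis using I St fl unfolding Inv_def Let_def by auto
    qed
  qed
  then have I: "Inv p (extend s)" using S by (simp add: St_simps)
  then show "B0 \<subseteq> B" "B \<subseteq> {..<p}" "x \<in> B0 \<Longrightarrow> rB x = rB0 x" "x \<in> B - B0 \<Longrightarrow> x \<in> A \<and> rB x = rA x"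
    "disjoint_balls B rB" "card B \<le> card G + kk"
    unfolding Inv_def Let_def B_def rB_def by auto
  have "a < p" if "a \<in> A" for a using covA that by (auto simp: covering_def)
  then show "card B = card G + kk \<or> (\<forall>a\<in>A. \<exists>b\<in>B. ball a (rA a) \<inter> ball b (rB b) \<noteq> {})"
    using I unfolding Inv_def Let_def B_def rB_def by blast
qed

end

section \<open>Recording solutions\<close>

lemma total_radius_cong:
  "nP t = nP s \<Longrightarrow> nmem t ''co'' = nmem s ''co'' \<Longrightarrow> rmem t ''fr'' = rmem s ''fr'' \<Longrightarrow>
    total_radius t = total_radius s"
  by (simp add: total_radius_def cong: if_cong)

context run
begin

lemma admissible_cong:
  assumes "admissible X cr fr" "\<And>x. x \<in> X \<Longrightarrow> cr' x = cr x" "\<And>x. x \<in> X \<Longrightarrow> fr' x = fr x"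
  shows "admissible X cr' fr'"
proof -
  have "disjoint_balls X cr'" using assms by (simp add: admissible_def disjoint_balls_def)
  moreover have "\<exists>x\<in>X. d x y \<le> fr' x" if "y < q" for y
    using assms that unfolding admissible_def by (metis (no_types, lifting))
  ultimately show ?thesis using assms by (auto simp: admissible_def)
qed

text \<open>The cores are disjoint, so a client in the core of x is assigned to x. The core then
  lies in the cluster of x and supplies its lower bound.\<close>

lemma acceptableI:
  assumes s: "St s" and adm: "admissible (flags ''co'' s) (ra ''cr'' s) (ra ''fr'' s)"
    and card: "card (flags ''co'' s) \<le> k"
  shows "acceptable (nfill ''as'' nQ assigned s)"
proof -
  let ?X = "flags ''co'' s" and ?cr = "ra ''cr'' s" and ?fr = "ra ''fr'' s"
  let ?t = "nfill ''as'' nQ assigned s"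
  have X: "x \<in> ?X \<longleftrightarrow> x < p \<and> na ''co'' s x \<noteq> 0" for x using s by (simp add: flags_def St_simps)
  have le: "\<And>x. x \<in> ?X \<Longrightarrow> 0 \<le> ?fr x \<and> ?cr x \<le> ?fr x \<and> L x \<le> card (ball x (?cr x))"
    and disj: "disjoint_balls ?X ?cr" and cover: "\<And>y. y < q \<Longrightarrow> \<exists>x\<in>?X. d x y \<le> ?fr x"
    using adm by (auto simp: admissible_def)
  have as: "assigned s y = (if \<exists>x\<in>?X. d x y \<le> ?cr x then first p (\<lambda>x. na ''co'' s x \<noteq> 0 \<and> d x y \<le> ?cr x)
     else first p (\<lambda>x. na ''co'' s x \<noteq> 0 \<and> d x y \<le> ?fr x))" for y
    unfolding assigned_def St_simps[OF s] using X by (auto intro!: if_cong)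
  have core: "assigned s y = x" if "x \<in> ?X" "y \<in> ball x (?cr x)" for x y
  proof -
    have y: "d x y \<le> ?cr x" "y < q" using that by (auto simp: ball_def)
    then have e: "assigned s y = first p (\<lambda>x. na ''co'' s x \<noteq> 0 \<and> d x y \<le> ?cr x)" using as that by auto
    have "assigned s y < p" "na ''co'' s (assigned s y) \<noteq> 0 \<and> d (assigned s y) y \<le> ?cr (assigned s y)"
      unfolding e using firstI[of x p "\<lambda>x. na ''co'' s x \<noteq> 0 \<and> d x y \<le> ?cr x"] that X y by auto
    then have "assigned s y \<in> ?X" "y \<in> ball (assigned s y) (?cr (assigned s y))" using X y by (auto simp: ball_def)
    then show ?thesis using disj that unfolding disjoint_balls_def by blast
  qed
  have asX: "assigned s y \<in> ?X \<and> d (assigned s y) y \<le> ?fr (assigned s y)" if y: "y < q" for y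
  proof (cases "\<exists>x\<in>?X. d x y \<le> ?cr x")
    case True
    then obtain x where x: "x \<in> ?X" "d x y \<le> ?cr x" by blast
    then have "assigned s y = x" using core y by (simp add: ball_def)
    then show ?thesis using x le[OF x(1)] by auto
  next
    case False
    obtain x where x: "x \<in> ?X" "d x y \<le> ?fr x" using cover[OF y] by blast
    then show ?thesis using False as[of y] firstI[of x p "\<lambda>x. na ''co'' s x \<noteq> 0 \<and> d x y \<le> ?fr x"] X by auto
  qed
  have t: "St ?t" "flags ''co'' ?t = ?X" "\<And>x. na ''co'' ?t x = na ''co'' s x" "\<And>x. ra ''fr'' ?t x = ?fr x"
    "\<And>y. y < q \<Longrightarrow> na ''as'' ?t y = assigned s y"
    using s by (simp_all add: loads_def flags_def nP_def St_simps)
  have count: "(\<Sum>y<q. if na ''as'' ?t y = x then 1 else 0) = card {y \<in> {..<q}. assigned s y = x}" for x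
  proof -
    have "(\<Sum>y<q. if na ''as'' ?t y = x then 1 else 0) = (\<Sum>y<q. if assigned s y = x then 1 else 0)"
      using t(5) by (intro sum.cong) auto
    also have "\<dots> = card {y \<in> {..<q}. assigned s y = x}" by (simp add: sum.If_cases Int_def)
    finally show ?thesis .
  qed
  have "L x \<le> card {y \<in> {..<q}. assigned s y = x}" if x: "x \<in> ?X" for x
  proof -
    have "ball x (?cr x) \<subseteq> {y \<in> {..<q}. assigned s y = x}" using core[OF x] by (auto simp: ball_def)
    then have "card (ball x (?cr x)) \<le> card {y \<in> {..<q}. assigned s y = x}" by (intro card_mono) auto
    then show ?thesis using le[OF x] by simp
  qed
  then show ?thesis
    unfolding acceptable_def St_simps[OF t(1)] members_count_eq t(2,3,4) count
    using asX card X le t(5) by auto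
qed

lemma total_radius_eq: "St s \<Longrightarrow> total_radius s = sum (ra ''fr'' s) (flags ''co'' s)"
proof -
  assume s: "St s"
  have "flags ''co'' s = {x \<in> {..<p}. na ''co'' s x \<noteq> 0}" using s by (auto simp: flags_def St_simps)
  then show "total_radius s = sum (ra ''fr'' s) (flags ''co'' s)"
    unfolding total_radius_def St_simps[OF s] by (simp add: sum.inter_filter[symmetric])
qed

end

locale instance_names =
  fixes F D :: "nat set" and c :: "nat \<Rightarrow> nat \<Rightarrow> real" and L :: "nat \<Rightarrow> nat" and k :: nat and s0 :: state and eps :: real
  assumes inst: "lbmsr_instance F D c L k" and s0: "s0 = input_state eps F D c L k"
begin

definition fn :: "nat \<Rightarrow> nat" where "fn x = sorted_list_of_set F ! x"
definition dn :: "nat \<Rightarrow> nat" where "dn y = sorted_list_of_set D ! y"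

lemma finite: "finite F" "finite D" using inst by (auto simp: lbmsr_instance_def)

lemma bij_fn: "bij_betw fn {..<card F} F" and bij_dn: "bij_betw dn {..<card D} D"
  unfolding fn_def dn_def using finite by (auto intro!: bij_betw_nth)

lemma fn_in: "x < card F \<Longrightarrow> fn x \<in> F" and dn_in: "y < card D \<Longrightarrow> dn y \<in> D"
  using bij_fn bij_dn by (auto simp: bij_betw_def)

lemma fn_inj: "x < card F \<Longrightarrow> x' < card F \<Longrightarrow> fn x = fn x' \<longleftrightarrow> x = x'"
  and dn_inj: "y < card D \<Longrightarrow> y' < card D \<Longrightarrow> dn y = dn y' \<longleftrightarrow> y = y'"
  using bij_fn bij_dn by (auto simp: bij_betw_def dest: inj_onD)

definition inputs :: "var set" where "inputs = {''nF'', ''nD'', ''k'', ''F'', ''D'', ''L'', ''c''}"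

definition In :: "state \<Rightarrow> bool" where
  "In s \<longleftrightarrow> (\<forall>v\<in>inputs. nmem s v = nmem s0 v \<and> rmem s v = rmem s0 v)"

lemma In_simps:
  assumes "In s"
  shows "nP s = card F" "nQ s = card D" "na ''k'' s 0 = k" "x < card F \<Longrightarrow> na ''F'' s x = fn x"
    "y < card D \<Longrightarrow> na ''D'' s y = dn y" "x < card F \<Longrightarrow> lbd s x = L (fn x)"
    "x < card F \<Longrightarrow> y < card D \<Longrightarrow> dst s x y = c (fn x) (dn y)"
proof -
  have e: "nmem s v = nmem s0 v" "rmem s v = rmem s0 v" if "v \<in> inputs" for v
    using assms that by (auto simp: In_def)
  have m: "nmem s0 = input_nmem F D L k" "rmem s0 = input_rmem eps F D c" by (simp_all add: s0 input_state_def)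
  show "nP s = card F" "nQ s = card D" "na ''k'' s 0 = k"
    by (simp_all add: nP_def nQ_def e inputs_def m input_nmem_def)
  show F: "x < card F \<Longrightarrow> na ''F'' s x = fn x" for x by (simp add: e inputs_def m input_nmem_def fn_def)
  show D: "y < card D \<Longrightarrow> na ''D'' s y = dn y" for y by (simp add: e inputs_def m input_nmem_def dn_def)
  show "x < card F \<Longrightarrow> lbd s x = L (fn x)"
    by (simp add: lbd_def F) (simp add: e inputs_def m input_nmem_def fn_in)
  show "x < card F \<Longrightarrow> y < card D \<Longrightarrow> dst s x y = c (fn x) (dn y)"
    by (simp add: dst_def F D) (simp add: e inputs_def m input_rmem_def fn_in dn_in)
qed

text \<open>Invariant of the whole program, whatever is guessed. That \<open>S\<close> has no flag
  outside F makes a new solution, which is written at all facility names, replace the old one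
  completely.\<close>

definition Ok :: "state \<Rightarrow> bool" where
  "Ok s \<longleftrightarrow> output_S s \<subseteq> F \<and> (na ''found'' s 0 = 0 \<longrightarrow> output_S s = {}) \<and> (na ''found'' s 0 \<noteq> 0 \<longrightarrow>
     feasible F D L k (output_S s) (output_sigma s) \<and> cost D c (output_S s) (output_sigma s) \<le> ra ''best'' s 0)"

definition solved :: "real \<Rightarrow> state \<Rightarrow> bool" where
  "solved b s \<longleftrightarrow> na ''found'' s 0 \<noteq> 0 \<and> ra ''best'' s 0 \<le> b"

lemma solved_mono: "solved b s \<Longrightarrow> b \<le> b' \<Longrightarrow> solved b' s"
  by (simp add: solved_def)

text \<open>A cost bound once reached stays reached. Hence in each loop only the iteration with the
  right guess has to be analysed for its cost.\<close>

definition keeps :: "(state \<Rightarrow> state) \<Rightarrow> bool" where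
  "keeps G \<longleftrightarrow> (\<forall>s. In s \<and> Ok s \<longrightarrow> In (G s) \<and> Ok (G s) \<and> (\<forall>b. solved b s \<longrightarrow> solved b (G s)))"

lemma keeps_cong:
  assumes "\<And>s v. v \<in> inputs \<union> {''found'', ''best'', ''S'', ''sigma''} \<Longrightarrow>
    nmem (G s) v = nmem s v \<and> rmem (G s) v = rmem s v"
  shows "keeps G"
proof -
  have "In (G s) = In s" "Ok (G s) = Ok s" "solved b (G s) = solved b s" for s b
  proof -
    show "In (G s) = In s" using assms[of _ s] by (simp add: In_def)
    have "nmem (G s) v = nmem s v \<and> rmem (G s) v = rmem s v" if "v \<in> {''found'', ''best'', ''S'', ''sigma''}" for v
      using assms that by blast
    then have "output_S (G s) = output_S s" "output_sigma (G s) = output_sigma s"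
        "na ''found'' (G s) 0 = na ''found'' s 0" "ra ''best'' (G s) 0 = ra ''best'' s 0"
      by (simp_all add: output_S_def output_sigma_def fun_eq_iff)
    then show "Ok (G s) = Ok s" "solved b (G s) = solved b s" by (simp_all add: Ok_def solved_def)
  qed
  then show ?thesis by (simp add: keeps_def)
qed

lemma keeps_stm:
  assumes "stm W G" "W \<inter> (inputs \<union> {''found'', ''best'', ''S'', ''sigma''}) = {}"
  shows "keeps G"
proof (rule keeps_cong)
  fix s v assume "v \<in> inputs \<union> {''found'', ''best'', ''S'', ''sigma''}"
  then have "v \<notin> W" using assms(2) by blast
  then show "nmem (G s) v = nmem s v \<and> rmem (G s) v = rmem s v" by (rule stm_frame[OF assms(1)])
qed

lemma keeps_set:
  assumes "v \<notin> inputs \<union> {''found'', ''best'', ''S'', ''sigma''}"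
  shows "keeps (\<lambda>s. nset v (i s) (e s) s)" "keeps (nfill v n f)" "keeps (rfill v n g)"
proof -
  have n: "w \<in> inputs \<union> {''found'', ''best'', ''S'', ''sigma''} \<Longrightarrow> w \<noteq> v" for w
    using assms by blast
  show "keeps (\<lambda>s. nset v (i s) (e s) s)" "keeps (nfill v n f)" "keeps (rfill v n g)"
    by (rule keeps_cong, drule n, simp)+
qed

lemma keeps_sequence: "keeps G \<Longrightarrow> keeps H \<Longrightarrow> keeps (G ;; H)"
  by (simp add: keeps_def sequence_def)

lemma keeps_forv:
  assumes v: "v \<notin> inputs \<union> {''found'', ''best'', ''S'', ''sigma''}" and G: "keeps G"
  shows "keeps (forv v n G)"
  unfolding keeps_def
proof (intro allI impI)
  fix s assume s: "In s \<and> Ok s"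
  show "In (forv v n G s) \<and> Ok (forv v n G s) \<and> (\<forall>b. solved b s \<longrightarrow> solved b (forv v n G s))"
  proof (rule forv_induct[where Inv = "\<lambda>_ t. In t \<and> Ok t \<and> (\<forall>b. solved b s \<longrightarrow> solved b t)"])
    fix x t assume t: "In t \<and> Ok t \<and> (\<forall>b. solved b s \<longrightarrow> solved b t)"
    then have "In (nset v 0 x t) \<and> Ok (nset v 0 x t) \<and> (\<forall>b. solved b s \<longrightarrow> solved b (nset v 0 x t))"
      using keeps_set(1)[OF v, of "\<lambda>_. 0" "\<lambda>_. x"] by (simp add: keeps_def)
    then show "In (G (nset v 0 x t)) \<and> Ok (G (nset v 0 x t)) \<and> (\<forall>b. solved b s \<longrightarrow> solved b (G (nset v 0 x t)))"
      using G by (simp add: keeps_def)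
  qed (use s in simp)
qed

lemma record_correct:
  assumes s: "In s" "Ok s" and acc: "acceptable s"
  defines "t \<equiv> record_solution s"
  shows "In t" "Ok t" "solved (total_radius s) t"
proof -
  define p q where "p = card F" and "q = card D"
  note sim = In_simps[OF s(1), folded p_def q_def]
  let ?s1 = "rset ''best'' 0 (total_radius (nset ''found'' 0 1 s)) (nset ''found'' 0 1 s)"
  have tr: "total_radius (nset ''found'' 0 1 s) = total_radius s"
    by (rule total_radius_cong) (simp_all add: nP_def)
  define B1 where "B1 = (\<lambda>s. nset ''S'' (na ''F'' s (na ''i'' s 0)) (na ''co'' s (na ''i'' s 0)) s)"
  define B2 where "B2 = (\<lambda>s. nset ''sigma'' (na ''D'' s (na ''i'' s 0)) (na ''F'' s (na ''as'' s (na ''i'' s 0))) s)"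
  define s2 where "s2 = forv ''i'' nP B1 ?s1"
  have t: "t = forv ''i'' nQ B2 s2" by (simp add: t_def record_solution_def sequence_def s2_def B1_def B2_def)
  let ?same = "\<lambda>u. (\<forall>v. v \<notin> {''i'', ''S'', ''sigma'', ''found''} \<longrightarrow> nmem u v = nmem s v) \<and> (\<forall>v. v \<noteq> ''best'' \<longrightarrow> rmem u v = rmem s v) \<and>
     na ''found'' u 0 = 1 \<and> ra ''best'' u 0 = total_radius s"
  have same1: "?same ?s1" using tr by simp
  have In': "In u" if "?same u" for u
    using that s(1) unfolding In_def inputs_def by simp
  define I1 where "I1 n u \<longleftrightarrow> ?same u \<and> (\<forall>x<n. na ''S'' u (fn x) = na ''co'' s x) \<and>
     (\<forall>i. i \<notin> F \<longrightarrow> na ''S'' u i = 0)" for n u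
  have "I1 (nP ?s1) s2"
    unfolding s2_def
  proof (rule forv_induct)
    show "I1 0 ?s1" using same1 s(2) by (auto simp: I1_def Ok_def output_S_def)
    fix n u assume n: "n < nP ?s1" and u: "I1 n u"
    have n: "n < p" using n sim by (simp add: nP_def)
    have "?same u" using u by (simp add: I1_def)
    then have e: "na ''F'' u n = fn n" "na ''co'' u n = na ''co'' s n" using sim(4)[OF n] by simp_all
    have "B1 (nset ''i'' 0 n u) = nset ''S'' (fn n) (na ''co'' s n) (nset ''i'' 0 n u)" by (simp add: B1_def e)
    then show "I1 (Suc n) (B1 (nset ''i'' 0 n u))"
      using u n fn_in fn_inj unfolding I1_def p_def by (auto simp: less_Suc_eq)
  qed
  moreover have "nP ?s1 = p" using sim by (simp add: nP_def)
  ultimately have s2: "I1 p s2" by simp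
  then have same2: "?same s2" by (simp add: I1_def)
  have q2: "nQ s2 = q" using In_simps(2)[OF In'[OF same2]] by (simp add: q_def)
  define I2 where "I2 n u \<longleftrightarrow> ?same u \<and> nmem u ''S'' = nmem s2 ''S'' \<and> (\<forall>y<n. na ''sigma'' u (dn y) = fn (na ''as'' s y))" for n u
  have as: "na ''as'' s y < p" "na ''co'' s (na ''as'' s y) \<noteq> 0"
    "c (fn (na ''as'' s y)) (dn y) \<le> ra ''fr'' s (na ''as'' s y)" if "y < q" for y
    using acc that sim unfolding acceptable_def by auto
  have "I2 (nQ s2) t"
    unfolding t
  proof (rule forv_induct)
    show "I2 0 s2" using same2 by (simp add: I2_def)
    fix n u assume n: "n < nQ s2" and u: "I2 n u"
    have n: "n < q" using n q2 by simp
    have "?same u" using u by (simp add: I2_def)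
    then have e: "na ''D'' u n = dn n" "na ''F'' u (na ''as'' u n) = fn (na ''as'' s n)"
      using sim(5)[OF n] sim(4)[OF as(1)[OF n]] by simp_all
    have "B2 (nset ''i'' 0 n u) = nset ''sigma'' (dn n) (fn (na ''as'' s n)) (nset ''i'' 0 n u)" by (simp add: B2_def e)
    then show "I2 (Suc n) (B2 (nset ''i'' 0 n u))"
      using u n dn_inj unfolding I2_def q_def by (auto simp: less_Suc_eq)
  qed
  then have I2: "I2 q t" using q2 by simp
  then have same: "?same t" by (simp add: I2_def)
  then show "In t" by (rule In')
  show "solved (total_radius s) t" using same by (simp add: solved_def)
  let ?X = "flags ''co'' s"
  have X: "x \<in> ?X \<longleftrightarrow> x < p \<and> na ''co'' s x \<noteq> 0" for x by (simp add: flags_def sim)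
  have S: "output_S t = fn ` ?X"
  proof -
    have "na ''S'' t i \<noteq> 0 \<longleftrightarrow> (\<exists>x. x < p \<and> na ''co'' s x \<noteq> 0 \<and> i = fn x)" for i
    proof (cases "i \<in> F")
      case True
      then obtain x where "x < p" "i = fn x" using bij_fn by (auto simp: bij_betw_def p_def)
      then show ?thesis using s2 I2 fn_inj unfolding I1_def I2_def p_def by auto
    next
      case False
      then show ?thesis using s2 I2 fn_in unfolding I1_def I2_def p_def by auto
    qed
    then show ?thesis using X by (auto simp: output_S_def)
  qed
  have inj: "inj_on fn ?X" using X fn_inj by (auto simp: inj_on_def p_def)
  have Dim: "j \<in> D \<longleftrightarrow> (\<exists>y<q. j = dn y)" for j
    using bij_dn unfolding bij_betw_def q_def by blast
  have sig: "output_sigma t (dn y) = fn (na ''as'' s y)" if "y < q" for y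
    using I2 that by (simp add: I2_def output_sigma_def)
  have cl: "cluster D (output_sigma t) (fn x) = dn ` {y \<in> {..<q}. na ''as'' s y = x}" if "x < p" for x
    using sig as(1) fn_inj that by (auto simp: cluster_def Dim p_def)
  have ac: "0 \<le> ra ''fr'' s x" "L (fn x) \<le> card {y \<in> {..<q}. na ''as'' s y = x}" if x: "x \<in> ?X" for x
    using acc x X[of x] sim unfolding acceptable_def by (auto simp: sum.If_cases Int_def)
  have feas: "feasible F D L k (output_S t) (output_sigma t)"
    unfolding feasible_def
  proof (intro conjI ballI)
    show "output_S t \<subseteq> F" unfolding S using X fn_in by (auto simp: p_def)
    have "card ?X \<le> k" using acc sim by (simp add: acceptable_def members_count_eq)
    then show "card (output_S t) \<le> k" unfolding S by (simp add: card_image[OF inj])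
    fix j assume "j \<in> D"
    then obtain y where "y < q" "j = dn y" using Dim by blast
    then show "output_sigma t j \<in> output_S t" unfolding S using sig as X by auto
  next
    fix i assume "i \<in> output_S t"
    then obtain x where x: "x \<in> ?X" "i = fn x" unfolding S by auto
    have "inj_on dn {y \<in> {..<q}. na ''as'' s y = x}" using dn_inj by (auto simp: inj_on_def q_def)
    then show "L i \<le> card (cluster D (output_sigma t) i)"
      using ac(2)[OF x(1)] x cl X[of x] by (simp add: card_image)
  qed
  have "cost D c (output_S t) (output_sigma t) = (\<Sum>x\<in>?X. radius D c (output_sigma t) (fn x))"
    unfolding cost_def S by (simp add: sum.reindex[OF inj])
  \<comment> \<open>The final radii bound all distances within a cluster. An empty cluster has
    radius 0, which is why \<open>acceptable\<close> tests that final radii are nonnegative.\<close>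
  also have "\<dots> \<le> (\<Sum>x\<in>?X. ra ''fr'' s x)"
  proof (rule sum_mono)
    fix x assume x: "x \<in> ?X"
    then have "x < p" using X by simp
    moreover have "c (fn x) (dn y) \<le> ra ''fr'' s x" if "y < q" "na ''as'' s y = x" for y
      using as(3)[OF that(1)] that(2) by simp
    ultimately show "radius D c (output_sigma t) (fn x) \<le> ra ''fr'' s x"
      using ac(1)[OF x] cl by (auto simp: radius_def)
  qed
  also have "\<dots> = total_radius s"
  proof -
    have "?X = {x \<in> {..<p}. na ''co'' s x \<noteq> 0}" using X by auto
    then show ?thesis unfolding total_radius_def by (simp add: sum.inter_filter[symmetric] sim)
  qed
  finally have "cost D c (output_S t) (output_sigma t) \<le> ra ''best'' t 0" using same by simp
  then show "Ok t" using feas same by (auto simp: Ok_def feasible_def)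
qed

lemma check_correct:
  assumes s: "In s" "Ok s"
  shows "In (check_solution s)" "Ok (check_solution s)" "solved b s \<Longrightarrow> solved b (check_solution s)"
    "acceptable (nfill ''as'' nQ assigned s) \<Longrightarrow> solved (total_radius s) (check_solution s)"
proof -
  let ?t = "nfill ''as'' nQ assigned s"
  have k: "keeps (nfill ''as'' nQ assigned)" by (rule keeps_set) (simp add: inputs_def)
  then have t: "In ?t" "Ok ?t" "\<And>b. solved b s \<Longrightarrow> solved b ?t" using s by (auto simp: keeps_def)
  have tr: "total_radius ?t = total_radius s" by (rule total_radius_cong) (simp_all add: nP_def)
  note r = record_correct[OF t(1,2)]
  have eq: "check_solution s = (if acceptable ?t \<and> (na ''found'' s 0 = 0 \<or> total_radius s < ra ''best'' s 0)
      then record_solution ?t else ?t)"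
    unfolding check_solution_def sequence_def ifs_def tr skip_def by simp
  show "In (check_solution s)" "Ok (check_solution s)" using t r unfolding eq by auto
  show "solved b (check_solution s)" if "solved b s"
    using that t(3)[OF that] r(3) solved_mono[of "total_radius s" "record_solution ?t" b] tr
    unfolding eq by (auto simp: solved_def)
  show "solved (total_radius s) (check_solution s)" if "acceptable ?t"
    using that t r(3) tr unfolding eq by (auto simp: solved_def)
qed

lemma keeps_check: "keeps check_solution"
  using check_correct by (simp add: keeps_def)

lemma keeps_tripled: "keeps tripled"
  unfolding tripled_def by (intro keeps_sequence keeps_set keeps_check) (auto simp: inputs_def)

lemma keeps_merge: "keeps merge"
  unfolding merge_def by (intro keeps_sequence keeps_set keeps_check) (auto simp: inputs_def)

lemma keeps_stages: "keeps guess_family" "keeps search" "keeps extend"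
proof -
  have "stm {''i'', ''go'', ''gr''} guess_family" by (rule stm_guess_family) (auto simp: writable_simps)
  then show "keeps guess_family" by (rule keeps_stm) (auto simp: inputs_def)
  have "stm {''t'', ''i'', ''y'', ''al'', ''mo'', ''mr'', ''bx'', ''bz'', ''lam'', ''lo'', ''hi'', ''ao'', ''ar'', ''bo'', ''br''} search"
    by (rule stm_search) auto
  then show "keeps search" by (rule keeps_stm) (auto simp: inputs_def)
  have "stm {''i'', ''bo'', ''br''} extend" by (rule stm_extend) (auto simp: writable_simps)
  then show "keeps extend" by (rule keeps_stm) (auto simp: inputs_def)
qed

lemma keeps_trial: "keeps trial"
  unfolding trial_def
  by (intro keeps_sequence keeps_stages keeps_tripled keeps_set keeps_forv keeps_merge) (auto simp: inputs_def)

lemma keeps_guess_loop: "keeps (guess_loop j)"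
proof (induction j)
  case (Suc j)
  then show ?case unfolding guess_loop.simps
    by (intro keeps_forv keeps_sequence keeps_set) (auto simp: inputs_def)
qed (simp add: keeps_trial)

end

section \<open>Trials with a correct guess\<close>

locale good_run = instance_names F D c L k s0 eps +
  run "card F" "card D" "dst s0" "lbd s0" R U G rG Op zs kk gxs gzs k
  for F D c L k s0 eps R U G rG Op zs kk gxs gzs
begin

lemma check_admissible:
  assumes u: "In u" "Ok u" "St u" and X: "flags ''co'' u = X" "card X \<le> k"
    and adm: "admissible X cr fr" "\<And>x. x \<in> X \<Longrightarrow> ra ''cr'' u x = cr x" "\<And>x. x \<in> X \<Longrightarrow> ra ''fr'' u x = fr x"
  shows "solved (sum fr X) (check_solution u)"
proof -
  have "admissible X (ra ''cr'' u) (ra ''fr'' u)" using admissible_cong[OF adm] .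
  then have "acceptable (nfill ''as'' nQ assigned u)" using acceptableI[OF u(3)] X by simp
  moreover have "total_radius u = sum fr X" using total_radius_eq[OF u(3)] adm X by (simp cong: sum.cong)
  ultimately show ?thesis using check_correct(4)[OF u(1,2)] by simp
qed

lemma tripled_correct:
  assumes u: "In u" "Ok u" "St u" and cov: "covering (flags ''bo'' u) (ra ''br'' u)" and card: "card (flags ''bo'' u) \<le> k"
  shows "solved (3 * sum (ra ''br'' u) (flags ''bo'' u)) (tripled u)"
proof -
  let ?X = "flags ''bo'' u" and ?r = "ra ''br'' u"
  let ?F = "nfill ''co'' nP (\<lambda>s x. na ''bo'' s x) ;; rfill ''cr'' nP (\<lambda>s x. ra ''br'' s x) ;; rfill ''fr'' nP (\<lambda>s x. 3 * ra ''br'' s x)"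
  let ?t = "?F u"
  have "keeps ?F" by (intro keeps_sequence keeps_set) (auto simp: inputs_def)
  then have t: "In ?t" "Ok ?t" using u by (auto simp: keeps_def)
  have St: "St ?t" using u(3) by (simp add: sequence_def loads_def)
  have "flags ''co'' ?t = ?X" by (auto simp: sequence_def flags_def nP_def)
  moreover have "ra ''cr'' ?t x = ?r x" "ra ''fr'' ?t x = 3 * ?r x" if "x \<in> ?X" for x
    using that by (simp_all add: sequence_def flags_def nP_def)
  ultimately have "solved (sum (\<lambda>x. 3 * ?r x) ?X) (check_solution ?t)"
    using check_admissible[OF t St _ card covering_admissible[OF cov]] by simp
  then show ?thesis by (simp add: tripled_def sequence_def sum_distrib_left)
qed

lemma go_iff:
  assumes "St t" "Gs t" "a < card F"
  shows "na ''go'' t a = 0 \<longleftrightarrow> a \<notin> G"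
proof -
  have "a \<in> flags ''go'' t \<longleftrightarrow> a \<in> G" using assms(2) unfolding Gs_def by blast
  then show ?thesis using assms(3) St_simps(1)[OF assms(1)] by (cases "a \<in> G") (simp_all add: flags_def)
qed

lemma group_defs:
  assumes t: "St t" "Gs t"
  defines "A \<equiv> flags ''ao'' t" and "gp \<equiv> na ''gp'' t"
  shows "a < card F \<Longrightarrow> member t b a \<longleftrightarrow> a \<in> members A gp b"
    and "group_size t b = card (members A gp b)" "group_sum t b = sum (ra ''ar'' t) (members A gp b)"
proof -
  note go = go_iff[OF t]
  show m: "member t b a \<longleftrightarrow> a \<in> members A gp b" if "a < card F" for a b
    using that go[OF that] St_simps(1)[OF t(1)] by (simp add: member_def members_def A_def gp_def flags_def)
  have e: "members A gp b = {a \<in> {..<card F}. member t b a}"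
  proof -
    have "members A gp b \<subseteq> {..<card F}"
      using St_simps(1)[OF t(1)] by (auto simp: members_def A_def flags_def)
    then show ?thesis using m by blast
  qed
  show "group_size t b = card (members A gp b)"
    unfolding e group_size_def St_simps[OF t(1)] by (simp add: sum.If_cases Int_def)
  show "group_sum t b = sum (ra ''ar'' t) (members A gp b)"
    unfolding e group_sum_def St_simps[OF t(1)] by (simp add: sum.inter_filter[symmetric])
qed

lemma merge_correct:
  assumes t: "In t" "Ok t" "St t" "Gs t"
  defines "A \<equiv> flags ''ao'' t" and "gp \<equiv> na ''gp'' t" and "rA \<equiv> ra ''ar'' t" and "rB \<equiv> ra ''br'' t"
    and "M \<equiv> {b. merged t (na ''u'' t 0) b}" and "fm \<equiv> \<lambda>b. first (card F) (member t b)"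
  assumes GA: "G \<subseteq> A" and adm: "admissible (kept A gp M fm) rA (kept_radius A gp rA rB M)"
    and card: "card (kept A gp M fm) \<le> k"
  shows "solved (sum (kept_radius A gp rA rB M) (kept A gp M fm)) (merge t)"
proof -
  let ?F = "nfill ''co'' nP merged_centre ;; rfill ''cr'' nP (\<lambda>s x. ra ''ar'' s x) ;; rfill ''fr'' nP merged_final"
  let ?s = "?F t"
  let ?s2 = "rfill ''cr'' nP (\<lambda>s x. ra ''ar'' s x) (nfill ''co'' nP merged_centre t)"
  have "keeps ?F" by (intro keeps_sequence keeps_set) (auto simp: inputs_def)
  then have s: "In ?s" "Ok ?s" using t by (auto simp: keeps_def)
  have St: "St ?s" using t(3) by (simp add: sequence_def loads_def)
  have mf: "merged_final ?s2 = merged_final t"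
    by (intro ext) (simp add: merged_final_def state_defs cong: if_cong)
  note go = go_iff[OF t(3,4)]
  have ao: "na ''ao'' t a \<noteq> 0 \<longleftrightarrow> a \<in> A" if "a < card F" for a
    using St_simps(1)[OF t(3)] that by (simp add: A_def flags_def)
  have Ap: "a < card F" if "a \<in> A" for a using that St_simps(1)[OF t(3)] by (simp add: A_def flags_def)
  note sim = St_simps[OF t(3)]
  have "merged_centre t x \<noteq> 0 \<longleftrightarrow> x \<in> kept A gp M fm" if "x < card F" for x
    using go[OF that] ao[OF that] GA
    by (auto simp: merged_centre_def kept_def sim M_def gp_def fm_def)
  moreover have "flags ''co'' ?s = {x. x < nP t \<and> merged_centre t x \<noteq> 0}"
    by (auto simp: sequence_def flags_def nP_def)
  moreover have "kept A gp M fm \<subseteq> {..<card F}" using Ap GA by (auto simp: kept_def)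
  ultimately have "flags ''co'' ?s = kept A gp M fm" unfolding sim(1) by blast
  moreover have "ra ''cr'' ?s x = rA x" "ra ''fr'' ?s x = kept_radius A gp rA rB M x"
    if x: "x \<in> kept A gp M fm" for x
  proof -
    have xp: "x < card F" using x GA Ap by (auto simp: kept_def)
    then show "ra ''cr'' ?s x = rA x" using sim by (simp add: sequence_def rA_def nP_def)
    have "ra ''fr'' ?s x = merged_final t x" using xp sim mf by (simp add: sequence_def nP_def)
    also have "\<dots> = kept_radius A gp rA rB M x"
      using go[OF xp] group_defs(3)[OF t(3,4)]
      by (simp add: merged_final_def kept_radius_def merged_radius_def sim M_def gp_def rA_def rB_def A_def)
    finally show "ra ''fr'' ?s x = kept_radius A gp rA rB M x" .
  qed
  ultimately have "solved (sum (kept_radius A gp rA rB M) (kept A gp M fm)) (check_solution ?s)"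
    using check_admissible[OF s St _ card adm] by simp
  then show ?thesis by (simp add: merge_def sequence_def)
qed

text \<open>The part of \<open>trial\<close> after \<open>guess_family\<close>, from where on
  \<open>Gs\<close> can be assumed.\<close>

definition rest :: "state \<Rightarrow> state" where
  "rest = search ;; extend ;; tripled ;; nfill ''gp'' nP group_of ;; forv ''u'' nP merge"

lemma keepsD: "keeps G' \<Longrightarrow> In s \<Longrightarrow> Ok s \<Longrightarrow> In (G' s) \<and> Ok (G' s) \<and> (\<forall>b. solved b s \<longrightarrow> solved b (G' s))"
  by (simp add: keeps_def)

lemma rest_tripled:
  assumes s: "In s" "Ok s" "St s" "Gs s"
    and u_def: "u = extend (search s)" and cov: "covering (flags ''bo'' u) (ra ''br'' u)" and card: "card (flags ''bo'' u) \<le> card G + kk"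
  shows "solved (3 * sum (ra ''br'' u) (flags ''bo'' u)) (rest s)"
proof -
  have "St (search s)" using search_correct[OF s(3,4)] by (simp add: searched_def)
  moreover have We: "stm {''i'', ''bo'', ''br''} extend" by (rule stm_extend) (auto simp: writable_simps)
  ultimately have St: "St u" unfolding u_def by (intro St_stm[OF We]) (auto simp: loads_def)
  have u: "In u" "Ok u" unfolding u_def using keepsD keeps_stages s by blast+
  let ?T = "nfill ''gp'' nP group_of ;; forv ''u'' nP merge"
  have "solved (3 * sum (ra ''br'' u) (flags ''bo'' u)) (tripled u)"
    using tripled_correct[OF u St cov] card budget by simp
  moreover have "keeps ?T" by (intro keeps_sequence keeps_set keeps_forv keeps_merge) (auto simp: inputs_def)
  moreover have "In (tripled u)" "Ok (tripled u)" using keepsD[OF keeps_tripled u] by auto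
  ultimately have "solved (3 * sum (ra ''br'' u) (flags ''bo'' u)) (?T (tripled u))" using keepsD by blast
  then show ?thesis by (simp add: rest_def sequence_def u_def)
qed

lemma keeps_set_u: "keeps (\<lambda>s. nset ''u'' 0 n s)"
  by (rule keeps_set(1)) (simp add: inputs_def)

text \<open>Only the iteration with value w of \<open>u\<close> matters. The set \<open>V\<close> in
  the invariant collects the arrays that \<open>merge\<close> reads, which earlier iterations leave
  unchanged; later iterations keep the bound.\<close>

lemma rest_merge:
  assumes s: "In s" "Ok s" "St s" "Gs s" and u_def: "u = extend (search s)"
    and v_def: "v = nfill ''gp'' nP group_of (tripled u)"
    and w: "w < card F" and GA: "G \<subseteq> flags ''ao'' u"
    and sol: "admissible (kept (flags ''ao'' u) (na ''gp'' v) {b. merged v w b} (\<lambda>b. first (card F) (member v b))) (ra ''ar'' u)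
        (kept_radius (flags ''ao'' u) (na ''gp'' v) (ra ''ar'' u) (ra ''br'' u) {b. merged v w b})"
      "card (kept (flags ''ao'' u) (na ''gp'' v) {b. merged v w b} (\<lambda>b. first (card F) (member v b))) \<le> k"
  shows "solved (sum (kept_radius (flags ''ao'' u) (na ''gp'' v) (ra ''ar'' u) (ra ''br'' u) {b. merged v w b})
     (kept (flags ''ao'' u) (na ''gp'' v) {b. merged v w b} (\<lambda>b. first (card F) (member v b)))) (rest s)" (is "solved ?b _")
proof -
  have S: "St (search s)" "Gs (search s)" using search_correct[OF s(3,4)] by (auto simp: searched_def)
  have We: "stm {''i'', ''bo'', ''br''} extend" by (rule stm_extend) (auto simp: writable_simps)
  have u: "St u" "Gs u" unfolding u_def using S by (auto intro: St_stm[OF We] Gs_stm[OF We] simp: loads_def)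
  have Iu: "In u" "Ok u" unfolding u_def using keepsD keeps_stages s by blast+
  let ?Wt = "{''i'', ''found'', ''best'', ''S'', ''sigma'', ''as'', ''co'', ''cr'', ''fr''}"
  have Wt: "stm ?Wt tripled" by (rule stm_tripled) auto
  have Wm: "stm ?Wt merge" by (rule stm_merge) auto
  have tu: "St (tripled u)" "Gs (tripled u)" using u by (auto intro: St_stm[OF Wt] Gs_stm[OF Wt] simp: loads_def)
  have Sv: "St v" "Gs v" unfolding v_def using tu by (simp_all add: loads_def)
  have kg: "keeps (nfill ''gp'' nP group_of)" by (rule keeps_set) (simp add: inputs_def)
  have Iv: "In v" "Ok v" unfolding v_def using keepsD[OF keeps_tripled Iu] keepsD[OF kg] by auto
  define V :: "var set" where "V = {''ao'', ''ar'', ''bo'', ''br'', ''go'', ''gr'', ''gp'', ''F'', ''D'', ''c'', ''L'', ''nF'', ''nD'', ''gx'', ''gz''}"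
  have vu: "nmem v x = nmem u x" "rmem v x = rmem u x" if "x \<in> V" "x \<noteq> ''gp''" for x
  proof -
    have "x \<notin> ?Wt" using that by (auto simp: V_def)
    from stm_frame[OF Wt this, of u] show "nmem v x = nmem u x" "rmem v x = rmem u x"
      using that(2) by (simp_all add: v_def)
  qed
  define Inv where "Inv n t \<longleftrightarrow> In t \<and> Ok t \<and> St t \<and> Gs t \<and> (\<forall>x\<in>V. nmem t x = nmem v x \<and> rmem t x = rmem v x) \<and>
     (w < n \<longrightarrow> solved ?b t)" for n t
  note ku = keeps_set_u
  have "Inv (nP v) (forv ''u'' nP merge v)"
  proof (rule forv_induct)
    show "Inv 0 v" using Sv Iv by (simp add: Inv_def)
    fix n t assume t: "Inv n t"
    let ?t = "nset ''u'' 0 n t"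
    have I: "In t" "Ok t" "St t" "Gs t" "\<And>x. x \<in> V \<Longrightarrow> nmem t x = nmem v x" "\<And>x. x \<in> V \<Longrightarrow> rmem t x = rmem v x"
      "w < n \<Longrightarrow> solved ?b t"
      using t unfolding Inv_def by blast+
    have t': "In ?t" "Ok ?t" "St ?t" "Gs ?t" "w < n \<Longrightarrow> solved ?b ?t"
    proof -
      show "In ?t" "Ok ?t" "w < n \<Longrightarrow> solved ?b ?t" using keepsD[OF ku I(1,2)] I(7) by blast+
      show "St ?t" "Gs ?t" using I(3,4) by (simp_all add: loads_def)
    qed
    have same: "nmem ?t x = nmem v x" "rmem ?t x = rmem v x" if "x \<in> V" for x
    proof -
      have "x \<noteq> ''u''" using that by (auto simp: V_def)
      then show "nmem ?t x = nmem v x" "rmem ?t x = rmem v x" using I(5,6)[OF that] by simp_all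
    qed
    have m: "nmem (merge ?t) x = nmem v x \<and> rmem (merge ?t) x = rmem v x" if x: "x \<in> V" for x
    proof -
      have "x \<notin> ?Wt" using x by (auto simp: V_def)
      from stm_frame[OF Wm this, of ?t] show ?thesis using same[OF x] by simp
    qed
    have "solved ?b (merge ?t)" if wn: "n = w"
    proof -
      have e: "flags ''ao'' ?t = flags ''ao'' u" "na ''gp'' ?t = na ''gp'' v" "ra ''ar'' ?t = ra ''ar'' u" "ra ''br'' ?t = ra ''br'' u"
        using I(5,6) vu by (simp_all add: V_def flags_def nP_def)
      have u0: "na ''u'' ?t 0 = w" using wn by simp
      have mg: "merged ?t w = merged v w" "member ?t = member v"
        using I(5,6) by (intro ext, simp add: V_def state_defs cong: if_cong)+
      show ?thesis
        by (rule merge_correct[OF t'(1-4), unfolded u0 e mg, OF GA sol])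
    qed
    moreover have "In (merge ?t)" "Ok (merge ?t)" "w < n \<Longrightarrow> solved ?b (merge ?t)"
      using keepsD[OF keeps_merge t'(1,2)] t'(5) by auto
    moreover have "St (merge ?t)" "Gs (merge ?t)"
      by (rule St_stm[OF Wm _ t'(3)], simp add: loads_def) (rule Gs_stm[OF Wm _ t'(4)], simp)
    moreover have "solved ?b (merge ?t)" if "w < Suc n" using calculation that by (cases "w = n") auto
    ultimately show "Inv (Suc n) (merge ?t)" using m unfolding Inv_def by blast
  qed
  moreover have "w < nP v" using w St_simps(1)[OF Sv(1)] by simp
  ultimately have "solved ?b (forv ''u'' nP merge v)" unfolding Inv_def by blast
  then show ?thesis by (simp add: rest_def sequence_def u_def v_def)
qed

end

context run
begin

text \<open>This is \<open>err\<close> at the end of the search. The factor (q + 2^q) (q + 1) is at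
  most 2 * 4^q, so the 12 q halvings beyond the first leave 2 R / 2^(10 q), which is at most R / 4
  once there is a client.\<close>

lemma gap_small:
  assumes "0 < R" "0 < q"
  shows "(real q + 2 ^ q) * (2 * hmax / 2 ^ (12 * q + 1)) \<le> R / 4"
proof -
  have q: "real q \<le> 2 ^ q" "real q + 1 \<le> 2 ^ q"
    using less_exp[of q] by (metis of_nat_le_iff of_nat_numeral of_nat_power less_imp_le)
      (metis Suc_leI less_exp of_nat_Suc of_nat_le_iff of_nat_numeral of_nat_power add.commute)
  have "(real q + 2 ^ q) * (2 * hmax / 2 ^ (12 * q + 1)) = (real q + 2 ^ q) * ((real q + 1) * R) / 2 ^ (12 * q)"
    using assms by (simp add: hmax_def)
  also have "\<dots> \<le> (2 ^ q + 2 ^ q) * (2 ^ q * R) / 2 ^ (12 * q)"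
    using q assms by (intro divide_right_mono mult_mono add_mono mult_right_mono) auto
  also have "\<dots> = 2 * R / 2 ^ (10 * q)"
    by (simp add: field_simps power_add[symmetric])
  also have "\<dots> \<le> R / 4"
  proof -
    have "(2::real) ^ 3 \<le> 2 ^ (10 * q)" using assms by (intro power_increasing) auto
    then have "2 * R * 4 \<le> R * 2 ^ (10 * q)" using assms by simp
    then show ?thesis by (simp add: field_simps)
  qed
  finally show ?thesis .
qed

end

lemma final_bound_small:
  fixes x g T S :: real
  assumes "g \<le> T" "0 \<le> S" "0 \<le> T" "x \<le> 3 * g + 3 * S"
  shows "x \<le> 383/100 * (T + S)"
  using assms by (simp add: field_simps)

lemma tripled_bound:
  fixes b g y S R :: real
  assumes "b = g + y" "y \<le> S + R / 4" "0 \<le> S" "0 < R"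
  shows "3 * b \<le> 3 * g + 153/40 * (S + R / 4) + 7 * R"
  using assms by (simp add: field_simps)

text \<open>The origin of the ten guesses: the additive loss is (7 + 3.825 / 4) R < 8 R, while the
  guessed balls, of total radius T, are charged with the factor 3 only. This leaves 0.83 T, which is
  at least 8.3 R.\<close>

lemma final_bound:
  fixes x g T S e R :: real
  assumes "g \<le> T" "0 \<le> S" "10 * R \<le> T" "0 < R" "e \<le> R / 4" "x \<le> 3 * g + 153/40 * (S + e) + 7 * R"
  shows "x \<le> 383/100 * (T + S)"
  using assms by (simp add: field_simps)

context good_run
begin

text \<open>Degenerate cases are separated from \<open>rounding\<close>: for \<open>lo = 0\<close>
  there is no family A, but \<open>hi\<close> is of the order of the error; for R = 0 all balls
  outside G have radius 0; without remaining facilities the search cannot end with a positive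
  \<open>lo\<close>.\<close>

lemma rest_correct:
  assumes s: "In s" "Ok s" "St s" "Gs s"
    and T: "sum rG G \<le> T" "Op \<noteq> {} \<Longrightarrow> 10 * R \<le> T" "0 \<le> T"
  shows "solved (383/100 * (T + S)) (rest s)"
proof -
  have num: "(3.825::real) = 153/40" by simp
  define ss u where "ss = search s" and "u = extend ss"
  have sd: "searched ss" unfolding ss_def by (rule search_correct[OF s(3,4)])
  define lo hi where "lo = ra ''lo'' ss 0" and "hi = ra ''hi'' ss 0"
  define A B0 B where "A = flags ''ao'' ss" and "B0 = flags ''bo'' ss" and "B = flags ''bo'' u"
  define rA rB0 rB where "rA = ra ''ar'' ss" and "rB0 = ra ''br'' ss" and "rB = ra ''br'' u"
  have St_ss: "St ss" "Gs ss" and lo0: "0 \<le> lo" and gap: "hi - lo = 2 * hmax / 2 ^ (12 * q' + 1)"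
    and cB0: "card B0 \<le> card G + kk" if "q' = card D" for q'
    using sd that by (auto simp: searched_def lo_def hi_def B0_def)
  note gap = gap[OF refl] and lo0 = lo0[OF refl] and St_ss = St_ss[OF refl] and cB0 = cB0[OF refl]
  have lohi: "lo \<le> hi" using gap hmax_pos by (smt (verit) divide_pos_pos mult_pos_pos zero_less_power)
  obtain al2 where al2: "ascent hi al2" "selection hi al2 B0 rB0"
    using sd by (auto simp: searched_def sel_at_def B0_def rB0_def hi_def)
  have covB0: "covering B0 rB0" using selection_covering[OF _ al2] lo0 lohi by simp
  have S0: "0 \<le> S" by (rule S_nonneg)
  \<comment> \<open>A remaining facility guarantees that there is a client, as
    \<open>gap_small\<close> requires.\<close>
  have small: "err lo hi \<le> R / 4" if "0 < R" "Op \<noteq> {}"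
  proof -
    have "0 < card Op" using that Op_finite by (simp add: card_gt_0_iff)
    then have "0 < card D" using Op_q by linarith
    then show ?thesis using gap_small[OF that(1)] by (simp add: err_def gap)
  qed
  have nonpos: "sum r (X - G) \<le> 0" if "R = 0" "covering X r" for X r
    using covering_radius(2)[OF that(2)] that(1) by (intro sum_nonpos) auto
  have by_tripled: "solved (383/100 * (T + S)) (rest s)"
    if cov: "covering B rB" and card: "card B \<le> card G + kk" and le: "3 * sum rB B \<le> 383/100 * (T + S)"
  proof -
    have "solved (3 * sum rB B) (rest s)"
      using rest_tripled[OF s, of u] cov card by (simp add: u_def ss_def B_def rB_def)
    then show ?thesis using le by (rule solved_mono)
  qed
  have zero_R: "3 * sum rB B \<le> 383/100 * (T + S)" if "R = 0" "covering B rB"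
  proof -
    have "3 * sum rB B \<le> 3 * T" using sum_split_G[OF that(2)] nonpos[OF that] T(1) by linarith
    also have "3 * T \<le> 383/100 * (T + S)" using T(3) S0 by (simp add: field_simps)
    finally show ?thesis .
  qed
  show ?thesis
  proof (cases "0 < lo")
    case False
    then have lo: "lo = 0" using lo0 by simp
    then have "u = ss" by (simp add: u_def extend_def ifs_def skip_def lo_def)
    then have B: "B = B0" "rB = rB0" by (simp_all add: B_def B0_def rB_def rB0_def)
    have cov: "covering B rB" using covB0 B by simp
    have nn: "0 \<le> real (card (B0 - G)) * hi" using lo0 lohi by simp
    have "0 \<le> hi" using lo0 lohi by simp
    from selection_packing[OF this al2] have C: "sum rB (B - G) \<le> S + real (card Op) * hi"
      using nn unfolding B by linarith
    have "3 * sum rB B \<le> 383/100 * (T + S)"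
    proof (cases "R = 0")
      case False
      then have R: "0 < R" using R_nonneg by simp
      show ?thesis
      proof (cases "Op = {}")
        case True
        then have "sum rB (B - G) \<le> S" using C by simp
        then have "3 * sum rB B \<le> 3 * sum rG G + 3 * S" using sum_split_G[OF cov] by linarith
        then show ?thesis by (rule final_bound_small[OF T(1) S0 T(3)])
      next
        case False
        \<comment> \<open>As \<open>lo = 0\<close>, the multiplier \<open>hi\<close> is the gap of
          the search, so the whole multiplier term counts as error.\<close>
        have "real (card Op) * hi \<le> err lo hi"
        proof -
          have "real (card Op) \<le> real (card D)" "(0::real) \<le> 2 ^ card D" using Op_q by simp_all
          then have "real (card Op) * hi \<le> (real (card D) + 2 ^ card D) * hi"
            using lohi lo by (intro mult_right_mono) linarith+
          then show ?thesis by (simp add: err_def lo)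
        qed
        then have "real (card Op) * hi \<le> R / 4" using small[OF R False] by linarith
        then have "sum rB (B - G) \<le> S + R / 4" using C by linarith
        then have "3 * sum rB B \<le> 3 * sum rG G + 153/40 * (S + R / 4) + 7 * R"
          by (rule tripled_bound[OF sum_split_G[OF cov] _ S0 R])
        then show ?thesis by (rule final_bound[OF T(1) S0 T(2)[OF False] R order_refl])
      qed
    qed (use zero_R cov in blast)
    then show ?thesis using by_tripled[OF cov] cB0 B by simp
  next
    case True
    have ex: "B0 \<subseteq> B" "B \<subseteq> {..<card F}" "\<And>x. x \<in> B0 \<Longrightarrow> rB x = rB0 x"
      "\<And>x. x \<in> B - B0 \<Longrightarrow> x \<in> A \<and> rB x = rA x" "disjoint_balls B rB" "card B \<le> card G + kk"
      "card B = card G + kk \<or> (\<forall>a\<in>A. \<exists>b\<in>B. ball a (rA a) \<inter> ball b (rB b) \<noteq> {})"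
      unfolding A_def B0_def B_def rA_def rB0_def rB_def u_def
      by (fact extend_correct[OF sd True[unfolded lo_def]])+
    obtain al where al: "ascent lo al" "selection lo al A rA" and cA: "card G + kk < card A"
      using sd True by (auto simp: searched_def sel_at_def A_def rA_def lo_def)
    have We: "stm {''i'', ''bo'', ''br''} extend" by (rule stm_extend) (auto simp: writable_simps)
    have Su: "St u" "Gs u" unfolding u_def
      by (rule St_stm[OF We _ St_ss(1)], simp add: loads_def) (rule Gs_stm[OF We _ St_ss(2)], simp)
    have ua: "nmem u x = nmem ss x" "rmem u x = rmem ss x" if "x \<notin> {''i'', ''bo'', ''br''}" for x
      using stm_frame[OF We that] by (simp_all add: u_def)
    let ?Wt = "{''i'', ''found'', ''best'', ''S'', ''sigma'', ''as'', ''co'', ''cr'', ''fr''}"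
    have Wt: "stm ?Wt tripled" by (rule stm_tripled) auto
    define t where "t = tripled u"
    have Stt: "St t" "Gs t" unfolding t_def
      by (rule St_stm[OF Wt _ Su(1)], simp add: loads_def) (rule Gs_stm[OF Wt _ Su(2)], simp)
    have ta: "nmem t x = nmem u x" "rmem t x = rmem u x" if "x \<notin> ?Wt" for x
      using stm_frame[OF Wt that] by (simp_all add: t_def)
    define v where "v = nfill ''gp'' nP group_of t"
    have Sv: "St v" "Gs v" unfolding v_def using Stt by (simp_all add: loads_def)
    have A: "flags ''ao'' u = A" "ra ''ar'' u = rA" "flags ''ao'' v = A" "ra ''ar'' v = rA" "flags ''bo'' v = B" "ra ''br'' v = rB"
      by (simp_all add: A_def rA_def B_def rB_def v_def ta ua flags_def nP_def)
    have covA: "covering A rA" using selection_covering[OF lo0 al] .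
    have GA: "G \<subseteq> A" and Ap: "\<And>a. a \<in> A \<Longrightarrow> a < card F" using covA by (auto simp: covering_def)
    note simv = St_simps[OF Sv(1)] and simt = St_simps[OF Stt(1)]
    let ?gp = "na ''gp'' v"
    have bo: "x \<in> B \<longleftrightarrow> x < card F \<and> na ''bo'' v x \<noteq> 0" for x
      using A(5) simv(1) by (auto simp: flags_def)
    have bot: "na ''bo'' t x = na ''bo'' v x" "na ''go'' t x = na ''go'' v x" "ra ''ar'' t x = rA x" "ra ''br'' t x = rB x" for x
      using fun_cong[OF A(4), of x] fun_cong[OF A(6), of x] by (simp_all add: v_def)
    have gp: "?gp a \<in> B - G \<and> ball a (rA a) \<inter> ball (?gp a) (rB (?gp a)) \<noteq> {}"
      if a: "a \<in> A - G" and b: "b \<in> B - G" "ball a (rA a) \<inter> ball b (rB b) \<noteq> {}" for a b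
    proof -
      let ?P = "\<lambda>b. na ''bo'' v b \<noteq> 0 \<and> na ''go'' v b = 0 \<and> (\<exists>y<card D. dst s0 a y \<le> rA a \<and> dst s0 b y \<le> rB b)"
      have "?gp a = group_of t a" using Ap a by (simp add: v_def simt(1))
      also have "\<dots> = first (card F) ?P" by (simp add: group_of_def bot simt(1-3))
      finally have "?gp a = first (card F) ?P" .
      moreover have P: "?P b \<longleftrightarrow> b \<in> B - G \<and> ball a (rA a) \<inter> ball b (rB b) \<noteq> {}" if "b < card F" for b
        using bo[of b] go_iff[OF Sv that] that by (auto simp: ball_def)
      moreover have "b < card F" using b bo by simp
      ultimately have "?gp a < card F" "?P (?gp a)" using firstI[of b "card F" ?P] b by auto
      then show ?thesis using P by blast
    qed
    let ?fm = "\<lambda>b. first (card F) (member v b)"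
    have mem: "member v b a \<longleftrightarrow> a \<in> members A ?gp b" if "a < card F" for a b
      using group_defs(1)[OF Sv that] A by simp
    have fm: "?fm (?gp a) \<in> A - G \<and> ?gp (?fm (?gp a)) = ?gp a" if a: "a \<in> A - G" for a
    proof -
      have "a < card F" "member v (?gp a) a" using Ap a mem by (auto simp: members_def)
      then have "?fm (?gp a) < card F" "member v (?gp a) (?fm (?gp a))" using firstI by blast+
      then show ?thesis using mem by (auto simp: members_def)
    qed
    have \<kappa>: "group_ratio v b = merge_cost A ?gp rA rB b / (real (card (members A ?gp b)) - 1)" for b
      using group_defs(2,3)[OF Sv, of b, unfolded A(3,4)] fun_cong[OF A(6), of b] by (simp add: group_ratio_def merge_cost_def)
    have M: "{b. merged v w b} = {b \<in> B - G. 2 \<le> card (members A ?gp b) \<and>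
        (group_ratio v b < group_ratio v w \<or> group_ratio v b = group_ratio v w \<and> b \<le> w)}" for w
    proof -
      have "merged v w b \<longleftrightarrow> b \<in> B - G \<and> 2 \<le> card (members A ?gp b) \<and>
        (group_ratio v b < group_ratio v w \<or> group_ratio v b = group_ratio v w \<and> b \<le> w)" for b
        using bo[of b] go_iff[OF Sv, of b] group_defs(2)[OF Sv, of b] A(3) simv(1)
        unfolding merged_def by auto
      then show ?thesis by blast
    qed
    note ro = rounding[OF lo0 al lohi al2 cA ex gp fm \<kappa> M]
    have cov: "covering B rB" by (rule ro(1); assumption)
    have ro2: "3 * sum rB B \<le> 3 * sum rG G + 3.825 * (S + err lo hi) \<or>
      (\<exists>w<card F. admissible (kept A ?gp {b. merged v w b} ?fm) rA (kept_radius A ?gp rA rB {b. merged v w b}) \<and>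
        card (kept A ?gp {b. merged v w b} ?fm) \<le> card G + kk \<and>
        sum (kept_radius A ?gp rA rB {b. merged v w b}) (kept A ?gp {b. merged v w b} ?fm) \<le>
          3 * sum rG G + 3.825 * (S + err lo hi) + 7 * R)"
      by (rule ro(2); assumption)
    show ?thesis
    proof (cases "R = 0")
      case R: True
      show ?thesis using by_tripled[OF cov] ex(6) zero_R[OF R cov] by blast
    next
      case False
      then have R: "0 < R" using R_nonneg by simp
      \<comment> \<open>Otherwise a positive \<open>lo\<close> would leave A with no ball outside G,
        although A exceeds the budget.\<close>
      have Op: "Op \<noteq> {}"
        using selection_empty[OF al True] card_split_G[OF covA] cA by auto
      note e = small[OF R Op]
      from ro2[unfolded num] show ?thesis
      proof (elim disjE exE conjE)
        assume "3 * sum rB B \<le> 3 * sum rG G + 153/40 * (S + err lo hi)"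
        then have "3 * sum rB B \<le> 3 * sum rG G + 153/40 * (S + err lo hi) + 7 * R" using R by linarith
        then have "3 * sum rB B \<le> 383/100 * (T + S)" by (rule final_bound[OF T(1) S0 T(2)[OF Op] R e])
        then show ?thesis using by_tripled[OF cov] ex(6) by blast
      next
        fix w
        let ?M = "{b. merged v w b}"
        assume w: "w < card F" "admissible (kept A ?gp ?M ?fm) rA (kept_radius A ?gp rA rB ?M)"
          "card (kept A ?gp ?M ?fm) \<le> card G + kk"
          "sum (kept_radius A ?gp rA rB ?M) (kept A ?gp ?M ?fm) \<le> 3 * sum rG G + 153/40 * (S + err lo hi) + 7 * R"
        have "solved (sum (kept_radius A ?gp rA rB ?M) (kept A ?gp ?M ?fm)) (rest s)"
          using rest_merge[OF s u_def[unfolded ss_def] v_def[unfolded t_def] w(1)] GA w(2,3) budget A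
          by (simp add: rB_def[symmetric])
        moreover have "sum (kept_radius A ?gp rA rB ?M) (kept A ?gp ?M ?fm) \<le> 383/100 * (T + S)"
          by (rule final_bound[OF T(1) S0 T(2)[OF Op] R e w(4)])
        ultimately show ?thesis by (rule solved_mono)
      qed
    qed
  qed
qed

end

section \<open>Guessing the largest balls of a solution\<close>

locale solution = instance_names F D c L k s0 eps
  for F D c L k s0 eps +
  fixes Sol :: "nat set" and \<sigma> :: "nat \<Rightarrow> nat"
  assumes feas: "feasible F D L k Sol \<sigma>" and D_nonempty: "D \<noteq> {}"
begin

abbreviation p where "p \<equiv> card F"
abbreviation q where "q \<equiv> card D"
abbreviation d where "d \<equiv> dst s0"

lemma In_s0: "In s0" by (simp add: In_def)

lemma d_eq: "x < p \<Longrightarrow> y < q \<Longrightarrow> d x y = c (fn x) (dn y)"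
  by (rule In_simps(7)[OF In_s0])

definition cl :: "nat \<Rightarrow> nat set" where "cl x = {y. y < q \<and> \<sigma> (dn y) = fn x}"
definition rs :: "nat \<Rightarrow> real" where "rs x = Max (d x ` cl x)"
definition zs :: "nat \<Rightarrow> nat" where "zs x = (SOME y. y \<in> cl x \<and> d x y = rs x)"
text \<open>Facilities without clients are dropped: they add nothing to the cost, and they have no
  client by which their ball could be named.\<close>

definition Xs :: "nat set" where "Xs = {x. x < p \<and> cl x \<noteq> {}}"

lemma finite_cl [simp]: "finite (cl x)" and finite_Xs [simp]: "finite Xs"
  by (simp_all add: cl_def Xs_def)

lemma zs:
  assumes "x \<in> Xs"
  shows "zs x \<in> cl x" "d x (zs x) = rs x" "zs x < q"
proof -
  have "Max (d x ` cl x) \<in> d x ` cl x" using assms by (intro Max_in) (auto simp: Xs_def)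
  then have "\<exists>y. y \<in> cl x \<and> d x y = rs x" by (auto simp: rs_def)
  then have "zs x \<in> cl x \<and> d x (zs x) = rs x" unfolding zs_def by (rule someI_ex)
  then show "zs x \<in> cl x" "d x (zs x) = rs x" "zs x < q" by (auto simp: cl_def)
qed

lemma cl_rs: "y \<in> cl x \<Longrightarrow> d x y \<le> rs x"
  by (simp add: rs_def)

lemma d_cover_instance: "cover_instance p q d"
proof
  interpret Metric_space "F \<union> D" c using inst by (simp add: lbmsr_instance_def)
  show "0 \<le> d x y" if "x < p" "y < q" for x y using that by (simp add: d_eq)
  show "d x y \<le> d x y' + d x' y' + d x' y" if "x < p" "x' < p" "y < q" "y' < q" for x x' y y'
  proof -
    have m: "fn x \<in> F \<union> D" "fn x' \<in> F \<union> D" "dn y \<in> F \<union> D" "dn y' \<in> F \<union> D" using that fn_in dn_in by auto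
    have "c (fn x) (dn y) \<le> c (fn x) (dn y') + c (dn y') (dn y)" using triangle m by blast
    also have "c (dn y') (dn y) \<le> c (dn y') (fn x') + c (fn x') (dn y)" using triangle m by blast
    also have "c (dn y') (fn x') = c (fn x') (dn y')" by (rule commute)
    finally show ?thesis using that by (simp add: d_eq)
  qed
qed

lemma rs_nonneg: "x \<in> Xs \<Longrightarrow> 0 \<le> rs x"
  using cover_instance.d_nonneg[OF d_cover_instance, of x "zs x"] zs[of x] by (simp add: Xs_def)

lemma cluster_eq: "cluster D \<sigma> (fn x) = dn ` cl x"
proof -
  have "j \<in> D \<longleftrightarrow> (\<exists>y<q. j = dn y)" for j using bij_dn unfolding bij_betw_def by blast
  then show ?thesis by (auto simp: cluster_def cl_def)
qed

lemma fn_Xs: "fn ` Xs \<subseteq> Sol"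
  using feas dn_in by (auto simp: Xs_def cl_def feasible_def) metis

lemma inj_fn_Xs: "inj_on fn Xs"
  using fn_inj by (auto simp: Xs_def inj_on_def)

lemma finite_Sol: "finite Sol"
  using feas finite finite_subset by (auto simp: feasible_def)

lemma card_Xs: "card Xs \<le> k"
  using card_mono[OF finite_Sol fn_Xs] card_image[OF inj_fn_Xs] feas by (simp add: feasible_def)

text \<open>Clusters of distinct facilities are disjoint, so their farthest clients are distinct.
  The resulting bound on |Op| enters \<open>err\<close> and \<open>hmax\<close>.\<close>

lemma card_Xs_q: "card Xs \<le> q"
proof -
  have "inj_on zs Xs"
  proof (rule inj_onI)
    fix x x' assume x: "x \<in> Xs" "x' \<in> Xs" "zs x = zs x'"
    then have "fn x = fn x'" using zs(1)[of x] zs(1)[of x'] by (simp add: cl_def)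
    then show "x = x'" using x fn_inj by (simp add: Xs_def)
  qed
  moreover have "zs ` Xs \<subseteq> {..<q}" using zs(3) by auto
  ultimately show ?thesis using card_mono[of "{..<q}" "zs ` Xs"] by (simp add: card_image)
qed

lemma cost_ge: "sum rs Xs \<le> cost D c Sol \<sigma>"
proof -
  have "sum rs Xs = (\<Sum>x\<in>Xs. radius D c \<sigma> (fn x))"
  proof (rule sum.cong)
    fix x assume x: "x \<in> Xs"
    then have "c (fn x) ` dn ` cl x = d x ` cl x" by (auto simp: Xs_def cl_def d_eq image_iff)
    then show "rs x = radius D c \<sigma> (fn x)" using x by (simp add: radius_def cluster_eq rs_def Xs_def)
  qed simp
  also have "\<dots> = (\<Sum>i\<in>fn ` Xs. radius D c \<sigma> i)" by (simp add: sum.reindex[OF inj_fn_Xs])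
  also have "\<dots> \<le> cost D c Sol \<sigma>"
    unfolding cost_def
  proof (rule sum_mono2[OF finite_Sol fn_Xs])
    interpret Metric_space "F \<union> D" c using inst by (simp add: lbmsr_instance_def)
    fix i assume "i \<in> Sol - fn ` Xs"
    show "0 \<le> radius D c \<sigma> i"
    proof (cases "cluster D \<sigma> i = {}")
      case False
      moreover have "finite (cluster D \<sigma> i)" using finite by (simp add: cluster_def)
      ultimately have "Max (c i ` cluster D \<sigma> i) \<in> c i ` cluster D \<sigma> i" by (intro Max_in) auto
      then show ?thesis using False nonneg by (auto simp: radius_def)
    qed (simp add: radius_def)
  qed
  finally show ?thesis .
qed

section \<open>The ten largest balls of the comparison solution\<close>

definition xs :: "nat list" where "xs = sort_key (\<lambda>x. - rs x) (sorted_list_of_set Xs)"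
text \<open>With fewer than ten balls the minimum repeats the last one, so that all ten slots of the
  guess are filled.\<close>

definition gxs :: "nat \<Rightarrow> nat" where "gxs i = xs ! min i (length xs - 1)"
definition gzs :: "nat \<Rightarrow> nat" where "gzs i = zs (gxs i)"
definition Top :: "nat set" where "Top = set (take 10 xs)"
definition Op :: "nat set" where "Op = set (drop 10 xs)"

lemma xs: "set xs = Xs" "distinct xs" "length xs = card Xs"
proof -
  show s: "set xs = Xs" "distinct xs" by (simp_all add: xs_def)
  show "length xs = card Xs" using distinct_card[OF s(2)] s(1) by simp
qed

lemma Xs_ex: "y < q \<Longrightarrow> \<exists>x\<in>Xs. y \<in> cl x"
proof -
  assume y: "y < q"
  then have "\<sigma> (dn y) \<in> F" using feas dn_in by (auto simp: feasible_def)
  then obtain x where "x < p" "\<sigma> (dn y) = fn x" using bij_fn by (auto simp: bij_betw_def)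
  then show ?thesis using y by (auto simp: Xs_def cl_def)
qed

lemma length_xs: "0 < length xs"
proof -
  have "0 < q" using D_nonempty finite by (simp add: card_gt_0_iff)
  then have "Xs \<noteq> {}" using Xs_ex by blast
  then show ?thesis using xs by (simp add: card_gt_0_iff)
qed

lemma xs_desc: "i \<le> j \<Longrightarrow> j < length xs \<Longrightarrow> rs (xs ! j) \<le> rs (xs ! i)"
  using sorted_nth_mono[of "map (\<lambda>x. - rs x) xs" i j] by (simp add: xs_def)

lemma min_index: "min i (length xs - 1) < length xs"
  using length_xs by linarith

lemma gxs_in: "gxs i \<in> Xs"
  using nth_mem[OF min_index] unfolding gxs_def xs(1) .

lemma gxs_desc: "i \<le> j \<Longrightarrow> rs (gxs j) \<le> rs (gxs i)"
  unfolding gxs_def by (intro xs_desc min_index) auto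

lemma Top_eq: "Top = gxs ` {..<10}"
proof -
  have "gxs i \<in> Top" if "i < 10" for i
  proof -
    have "min i (length xs - 1) < length (take 10 xs)" 
      unfolding length_take using that min_index[of i] by linarith
    then have "take 10 xs ! min i (length xs - 1) \<in> Top" unfolding Top_def by (rule nth_mem)
    then show ?thesis using that by (simp add: gxs_def)
  qed
  moreover have "x \<in> gxs ` {..<10}" if "x \<in> Top" for x
  proof -
    obtain i where i: "i < length (take 10 xs)" "x = take 10 xs ! i"
      using \<open>x \<in> Top\<close> unfolding Top_def by (metis in_set_conv_nth)
    then have i': "i < length xs" "i < 10" by simp_all
    then have "min i (length xs - 1) = i" by linarith
    then have "x = gxs i" using i i' by (simp add: gxs_def)
    then show ?thesis using i' by blast
  qed
  ultimately show ?thesis by blast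
qed

lemma Top_Op: "Top \<union> Op = Xs" "Top \<inter> Op = {}"
proof -
  have "Top \<union> Op = set (take 10 xs @ drop 10 xs)" unfolding Top_def Op_def by (rule set_append[symmetric])
  then show "Top \<union> Op = Xs" unfolding append_take_drop_id xs(1) .
  show "Top \<inter> Op = {}"
    unfolding Top_def Op_def by (rule set_take_disj_set_drop_if_distinct[OF xs(2) order_refl])
qed

lemma finite_Top [simp]: "finite Top" and finite_Op [simp]: "finite Op"
  by (simp_all add: Top_def Op_def)

lemma card_Top: "card Top = min 10 (card Xs)" and card_Op: "card Op = card Xs - 10"
  unfolding Top_def Op_def using xs by (simp_all add: distinct_card)

lemma Op_nth:
  assumes "x \<in> Op"
  shows "rs x \<le> rs (gxs 9)" "10 < card Xs"
proof -
  obtain i where i: "i < length (drop 10 xs)" "x = drop 10 xs ! i"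
    using assms unfolding Op_def by (metis in_set_conv_nth)
  then have "x = xs ! (10 + i)" "10 + i < length xs" by auto
  moreover have "min 9 (length xs - 1) = 9" using \<open>10 + i < length xs\<close> by linarith
  then have "gxs 9 = xs ! 9" unfolding gxs_def by simp
  ultimately show "rs x \<le> rs (gxs 9)" "10 < card Xs" using xs_desc[of 9 "10 + i"] xs(3) by auto
qed

definition R where "R = d (gxs 9) (gzs 9)"
definition U where "U = {y. y < q \<and> (\<forall>i<10. \<not> d (gxs i) y \<le> d (gxs i) (gzs i))}"

lemma d_gxs: "d (gxs i) (gzs i) = rs (gxs i)"
  unfolding gzs_def by (rule zs(2)[OF gxs_in])

lemma R_le: "i < 10 \<Longrightarrow> R \<le> rs (gxs i)"
  unfolding R_def d_gxs by (rule gxs_desc) simp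

lemma ten_R: "Op \<noteq> {} \<Longrightarrow> 10 * R \<le> sum rs Top"
proof -
  assume "Op \<noteq> {}"
  then have "card Top = 10" using Op_nth(2) card_Top by fastforce
  moreover have "real (card Top) * R \<le> sum rs Top"
    using R_le by (intro sum_bounded_below) (auto simp: Top_eq)
  ultimately show ?thesis by simp
qed

sublocale ci: cover_instance p q d "lbd s0" R U
  by (rule d_cover_instance)

lemma core: "x \<in> Xs \<Longrightarrow> lbd s0 x \<le> card (ci.ball x (rs x))"
proof -
  assume x: "x \<in> Xs"
  have "lbd s0 x = L (fn x)" using x In_simps(6)[OF In_s0] by (simp add: Xs_def)
  also have "\<dots> \<le> card (cluster D \<sigma> (fn x))" using feas fn_Xs x by (auto simp: feasible_def)
  also have "\<dots> \<le> card (cl x)" unfolding cluster_eq by (simp add: card_image_le)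
  also have "\<dots> \<le> card (ci.ball x (rs x))"
    using cl_rs by (intro card_mono) (auto simp: ci.ball_def cl_def)
  finally show ?thesis .
qed

lemma zs_ball: "x \<in> Xs \<Longrightarrow> zs x \<in> ci.ball x (rs x)"
  using zs by (simp add: ci.ball_def)

definition ready :: "state \<Rightarrow> bool" where
  "ready s \<longleftrightarrow> nP s = p \<and> nQ s = q \<and> dst s = d \<and> lbd s = lbd s0 \<and> na ''k'' s 0 = k \<and>
     (\<forall>i<10. na ''gx'' s i = gxs i \<and> na ''gz'' s i = gzs i)"

lemma ready_cong:
  assumes s: "ready s" and e: "\<And>v. v \<in> loads \<Longrightarrow> nmem t v = nmem s v \<and> rmem t v = rmem s v"
  shows "ready t"
proof -
  have e': "nmem t v = nmem s v" "rmem t v = rmem s v" if "v \<in> loads" for v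
    using e[OF that] by auto
  have "nP t = nP s" "nQ t = nQ s" "dst t = dst s" "lbd t = lbd s"
    by (simp_all add: nP_def nQ_def dst_def lbd_def fun_eq_iff e' loads_def)
  moreover have "nmem t v = nmem s v" if "v \<in> {''k'', ''gx'', ''gz''}" for v
    by (rule e'(1)) (use that in \<open>auto simp: loads_def\<close>)
  ultimately show ?thesis using s unfolding ready_def by simp
qed

text \<open>The slots come by decreasing radius, so a rejected ball meets an accepted ball that is
  at least as large, and tripling the latter covers it.\<close>

lemma guess_family_correct:
  assumes s: "ready s"
  defines "t \<equiv> guess_family s"
  shows "ready t" "flags ''go'' t \<subseteq> Top" "\<And>x. x \<in> flags ''go'' t \<Longrightarrow> ra ''gr'' t x = rs x"
    "ci.disjoint_balls (flags ''go'' t) rs"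
    "\<And>i. i < 10 \<Longrightarrow> \<exists>x\<in>flags ''go'' t. ci.ball (gxs i) (rs (gxs i)) \<inter> ci.ball x (rs x) \<noteq> {} \<and> rs (gxs i) \<le> rs x"
proof -
  let ?s1 = "nfill ''go'' nP (\<lambda>s x. 0) s"
  define Bd where "Bd = ifs (\<lambda>s. separate ''go'' ''gr'' s (na ''gx'' s (na ''i'' s 0))
         (dst s (na ''gx'' s (na ''i'' s 0)) (na ''gz'' s (na ''i'' s 0))))
       (insert_ball ''go'' ''gr'' (\<lambda>s. na ''gx'' s (na ''i'' s 0))
         (\<lambda>s. dst s (na ''gx'' s (na ''i'' s 0)) (na ''gz'' s (na ''i'' s 0)))) skip"
  define Inv where "Inv n t \<longleftrightarrow> ready t \<and> flags ''go'' t \<subseteq> gxs ` {..<n} \<and> (\<forall>x\<in>flags ''go'' t. ra ''gr'' t x = rs x) \<and>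
     ci.disjoint_balls (flags ''go'' t) rs \<and>
     (\<forall>i<n. \<exists>x\<in>flags ''go'' t. ci.ball (gxs i) (rs (gxs i)) \<inter> ci.ball x (rs x) \<noteq> {} \<and> rs (gxs i) \<le> rs x)" for n t
  have eq: "t = forv ''i'' (\<lambda>s. 10) Bd ?s1" by (simp add: t_def guess_family_def sequence_def Bd_def)
  have "Inv ((\<lambda>s. 10) ?s1) (forv ''i'' (\<lambda>s. 10) Bd ?s1)"
  proof (rule forv_induct)
    have "ready ?s1" by (rule ready_cong[OF s]) (auto simp: loads_def)
    moreover have "flags ''go'' ?s1 = {}" by (auto simp: flags_def nP_def)
    ultimately show "Inv 0 ?s1" by (simp add: Inv_def ci.disjoint_balls_def)
    fix n :: nat and t assume n: "n < 10" and t: "Inv n t"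
    let ?t = "nset ''i'' 0 n t" and ?X = "flags ''go'' t" and ?x = "gxs n"
    have I: "ready t" "?X \<subseteq> gxs ` {..<n}" "\<And>x. x \<in> ?X \<Longrightarrow> ra ''gr'' t x = rs x" "ci.disjoint_balls ?X rs"
      "\<And>i. i < n \<Longrightarrow> \<exists>x\<in>?X. ci.ball (gxs i) (rs (gxs i)) \<inter> ci.ball x (rs x) \<noteq> {} \<and> rs (gxs i) \<le> rs x"
      using t unfolding Inv_def by blast+
    have rt: "ready ?t" by (rule ready_cong[OF I(1)]) (auto simp: loads_def)
    have f: "nP ?t = p" "nQ ?t = q" "dst ?t = d" "na ''gx'' ?t n = gxs n" "na ''gz'' ?t n = gzs n"
      using rt n unfolding ready_def by blast+
    have fl: "flags ''go'' ?t = ?X" by (simp add: flags_def nP_def)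
    have X: "x' \<in> ?X \<longleftrightarrow> x' < p \<and> na ''go'' ?t x' \<noteq> 0" for x' unfolding fl[symmetric] by (simp add: flags_def f(1))
    have sep: "separate ''go'' ''gr'' ?t ?x (rs ?x) \<longleftrightarrow> (\<forall>x'\<in>?X. ci.ball ?x (rs ?x) \<inter> ci.ball x' (rs x') = {})"
    proof -
      have "separate ''go'' ''gr'' ?t ?x (rs ?x) \<longleftrightarrow>
          (\<forall>x'\<in>?X. \<forall>y<q. \<not> (d ?x y \<le> rs ?x \<and> d x' y \<le> ra ''gr'' ?t x'))"
        unfolding separate_def f using X by auto
      also have "\<dots> \<longleftrightarrow> (\<forall>x'\<in>?X. \<forall>y<q. \<not> (d ?x y \<le> rs ?x \<and> d x' y \<le> rs x'))"
        using I(3) by simp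
      finally show ?thesis by (auto simp: ci.ball_def)
    qed
    have in_now: "na ''i'' ?t 0 = n" by simp
    have Bt: "Bd ?t = (if separate ''go'' ''gr'' ?t ?x (rs ?x) then nset ''go'' ?x 1 (rset ''gr'' ?x (rs ?x) ?t) else ?t)"
      unfolding Bd_def ifs_def insert_ball_def sequence_def skip_def in_now f d_gxs
      using f(4) by simp
    have sub: "gxs ` {..<n} \<subseteq> gxs ` {..<Suc n}" "?x \<in> gxs ` {..<Suc n}" by auto
    have xX: "?x \<in> Xs" by (rule gxs_in)
    show "Inv (Suc n) (Bd ?t)"
    proof (cases "separate ''go'' ''gr'' ?t ?x (rs ?x)")
      case True
      let ?u = "nset ''go'' ?x 1 (rset ''gr'' ?x (rs ?x) ?t)"
      have u: "Bd ?t = ?u" using Bt True by (simp only: if_True)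
      have "ready ?u" by (rule ready_cong[OF rt]) (auto simp: loads_def)
      moreover have Xu: "flags ''go'' ?u = insert ?x ?X"
      proof -
        have "?x < p" using xX by (simp add: Xs_def)
        moreover have "nP ?u = p" using \<open>ready ?u\<close> by (simp add: ready_def)
        ultimately show ?thesis using X unfolding flags_def by auto
      qed
      moreover have "ra ''gr'' ?u x = rs x" if "x \<in> insert ?x ?X" for x using that I(3) by auto
      moreover have "ci.disjoint_balls (insert ?x ?X) rs"
        using I(4) True sep unfolding ci.disjoint_balls_def by blast
      moreover have "\<exists>x\<in>insert ?x ?X. ci.ball (gxs i) (rs (gxs i)) \<inter> ci.ball x (rs x) \<noteq> {} \<and> rs (gxs i) \<le> rs x"
        if "i < Suc n" for i
      proof (cases "i = n")
        case True
        then show ?thesis using zs_ball[OF xX] by (intro bexI[of _ ?x]) auto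
      next
        case False
        then have "i < n" using that by simp
        then show ?thesis using I(5) by blast
      qed
      ultimately show ?thesis unfolding u Inv_def Xu using I(2) sub by blast
    next
      case False
      then have u: "Bd ?t = ?t" using Bt by (simp only: if_False)
      obtain x' where x': "x' \<in> ?X" "ci.ball ?x (rs ?x) \<inter> ci.ball x' (rs x') \<noteq> {}" using False sep by blast
      then obtain j where "j < n" "x' = gxs j" using I(2) by auto
      then have "rs ?x \<le> rs x'" using gxs_desc by simp
      then have "\<exists>x\<in>?X. ci.ball (gxs i) (rs (gxs i)) \<inter> ci.ball x (rs x) \<noteq> {} \<and> rs (gxs i) \<le> rs x"
        if "i < Suc n" for i
        using that x' I(5)[of i] less_antisym by blast
      moreover have "ra ''gr'' ?t x = rs x" if "x \<in> ?X" for x using I(3)[OF that] by simp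
      ultimately show ?thesis unfolding u Inv_def fl using I(2,4) sub rt by blast
    qed
  qed
  then show "ready t" "flags ''go'' t \<subseteq> Top" "\<And>x. x \<in> flags ''go'' t \<Longrightarrow> ra ''gr'' t x = rs x"
    "ci.disjoint_balls (flags ''go'' t) rs"
    "\<And>i. i < 10 \<Longrightarrow> \<exists>x\<in>flags ''go'' t. ci.ball (gxs i) (rs (gxs i)) \<inter> ci.ball x (rs x) \<noteq> {} \<and> rs (gxs i) \<le> rs x"
    unfolding eq[symmetric] Inv_def Top_eq by blast+
qed

text \<open>With the right guess the assumptions of \<open>good_run\<close> hold: T is the total
  radius of the ten largest balls and S that of the others, which together are the radii of the
  comparison solution.\<close>

lemma trial_correct:
  assumes s: "In s" "Ok s" "ready s"
  shows "solved (383/100 * sum rs Xs) (trial s)"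
proof -
  define t where "t = guess_family s"
  define G where "G = flags ''go'' t"
  note g = guess_family_correct[OF s(3), folded t_def, folded G_def]
  have GX: "x \<in> Xs" if "x \<in> G" for x using that g(2) Top_Op(1) by blast
  have Gp: "x < p" if "x \<in> G" for x using GX[OF that] by (simp add: Xs_def)
  have cG: "card G \<le> card Top" using g(2) by (intro card_mono) auto
  have OpX: "x \<in> Xs" if "x \<in> Op" for x using that Top_Op(1) by blast
  have Rr: "R = rs (gxs 9)" by (simp add: R_def d_gxs)
  interpret gr: good_run F D c L k s0 eps R U G rs Op zs "k - 10" gxs gzs
  proof
    show "0 \<le> R" unfolding Rr by (rule rs_nonneg[OF gxs_in])
    show "U \<subseteq> {..<q}" by (auto simp: U_def)
    show "G \<subseteq> {..<p}" using Gp by auto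
    show "ci.disjoint_balls G rs" by (rule g(4))
    show "R \<le> rs x" if x: "x \<in> G" for x
    proof -
      obtain i where "i < 10" "x = gxs i" using x g(2) by (auto simp: Top_eq)
      then show ?thesis using R_le by simp
    qed
    show "lbd s0 x \<le> card (ci.ball x (rs x))" if "x \<in> G" for x by (rule core[OF GX[OF that]])
    show "\<exists>x\<in>G. d x y \<le> 3 * rs x" if y: "y < q" "y \<notin> U" for y
    proof -
      obtain i where i: "i < 10" "d (gxs i) y \<le> rs (gxs i)" using y by (auto simp: U_def d_gxs)
      obtain x w where x: "x \<in> G" "w \<in> ci.ball (gxs i) (rs (gxs i))" "w \<in> ci.ball x (rs x)" "rs (gxs i) \<le> rs x"
        using g(5)[OF i(1)] by blast
      have "gxs i < p" using gxs_in by (simp add: Xs_def)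
      then have "d x y \<le> d x w + d (gxs i) w + d (gxs i) y"
        using ci.d_triangle Gp[OF x(1)] y x(2) by (simp add: ci.ball_def)
      then have "d x y \<le> 3 * rs x" using x(2-4) i(2) by (simp add: ci.ball_def)
      then show ?thesis using x(1) by blast
    qed
    show "finite Op" by simp
    show "ci.valid x (zs x)" if x: "x \<in> Op" for x
      using zs(2,3)[OF OpX[OF x]] OpX[OF x] Op_nth(1)[OF x] core[OF OpX[OF x]]
      unfolding ci.valid_def by (simp add: Xs_def Rr)
    show "\<exists>x\<in>Op. d x y \<le> d x (zs x)" if y: "y \<in> U" for y
    proof -
      obtain x where x: "x \<in> Xs" "y \<in> cl x" using Xs_ex y by (auto simp: U_def)
      have le: "d x y \<le> d x (zs x)" using cl_rs[OF x(2)] zs(2)[OF x(1)] by simp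
      have "x \<notin> Top"
      proof
        assume "x \<in> Top"
        then obtain i where "i < 10" "x = gxs i" by (auto simp: Top_eq)
        then show False using y le by (auto simp: U_def gzs_def)
      qed
      then show ?thesis using x(1) le Top_Op(1) by blast
    qed
    show "card Op \<le> k - 10" using card_Op card_Xs by simp
    show "card Op \<le> q" using card_Op card_Xs_q by simp
    show "R = d (gxs 9) (gzs 9)" by (rule R_def)
    show "U = {y. y < q \<and> (\<forall>i<10. \<not> d (gxs i) y \<le> d (gxs i) (gzs i))}" by (rule U_def)
    show "k - 10 = k - 10" by simp
    \<comment> \<open>For k below 10 the second summand is 0 and |G| is at most |Xs|, hence at most
      k; otherwise |G| is at most 10.\<close>
    show "card G + (k - 10) \<le> k" using cG card_Top card_Xs by linarith
    show "ci.ball x (rs x) \<noteq> {}" if "x \<in> G" for x using zs_ball[OF GX[OF that]] by blast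
  qed
  have t: "In t" "Ok t" using s keeps_stages(1) unfolding t_def keeps_def by blast+
  have "gr.St t" using g(1) unfolding ready_def gr.St_def .
  moreover have "gr.Gs t" unfolding gr.Gs_def using g(3) by (simp add: G_def)
  moreover have "sum rs G \<le> sum rs Top"
    using g(2) rs_nonneg Top_Op(1) by (intro sum_mono2) auto
  moreover have "0 \<le> sum rs Top" using rs_nonneg Top_Op(1) by (intro sum_nonneg) auto
  ultimately have "solved (383/100 * (sum rs Top + gr.S)) (gr.rest t)"
    using gr.rest_correct[OF t] ten_R by blast
  moreover have "gr.S = sum rs Op" unfolding gr.S_def using OpX zs(2) by (intro sum.cong) auto
  moreover have "sum rs Top + sum rs Op = sum rs Xs"
    using sum.union_disjoint[of Top Op rs] Top_Op by simp
  moreover have "gr.rest t = trial s" by (simp add: gr.rest_def trial_def sequence_def t_def)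
  ultimately show ?thesis by simp
qed

section \<open>Nested loops over all guesses\<close>

lemma guess_loop_frame:
  "j \<le> i \<Longrightarrow> na ''gx'' (guess_loop j s) i = na ''gx'' s i \<and> na ''gz'' (guess_loop j s) i = na ''gz'' s i"
proof (induction j arbitrary: s i)
  case 0
  have "stm trial_vars trial" by (rule stm_trial) (auto simp: trial_vars_def)
  then have "nmem (trial s) v = nmem s v" if "v \<in> {''gx'', ''gz''}" for v
    using stm_frame[of trial_vars trial v s] that by (auto simp: trial_vars_def)
  then show ?case by simp
next
  case (Suc j)
  let ?same = "\<lambda>t. na ''gx'' t i = na ''gx'' s i \<and> na ''gz'' t i = na ''gz'' s i"
  let ?B = "(\<lambda>s. nset ''gz'' j (na ''z'' s 0) s) ;; guess_loop j"
  have inner: "?same (forv ''z'' nQ ?B t)" if t: "?same t" for t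
  proof (rule forv_induct[where Inv = "\<lambda>_. ?same"])
    fix x t assume "?same t"
    then show "?same (?B (nset ''z'' 0 x t))" using Suc.IH[of i] Suc.prems by (simp add: sequence_def)
  qed (use t in simp)
  have "?same (forv ''x'' nP ((\<lambda>s. nset ''gx'' j (na ''x'' s 0) s) ;; forv ''z'' nQ ?B) s)"
  proof (rule forv_induct[where Inv = "\<lambda>_. ?same"])
    fix x t assume "?same t"
    then show "?same (((\<lambda>s. nset ''gx'' j (na ''x'' s 0) s) ;; forv ''z'' nQ ?B) (nset ''x'' 0 x t))"
      using inner Suc.prems by (simp add: sequence_def)
  qed simp
  then show ?case by simp
qed

text \<open>When level j is entered, the slots from j on are right. The loops of level j + 1 reach
  the right centre and the right boundary client for slot j in one of their iterations, and
  \<open>keeps\<close> preserves the bound from there.\<close>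

lemma guess_loop_correct:
  assumes "In s" "Ok s" "j \<le> 10" "\<And>i. j \<le> i \<Longrightarrow> i < 10 \<Longrightarrow> na ''gx'' s i = gxs i \<and> na ''gz'' s i = gzs i"
  shows "solved (383/100 * sum rs Xs) (guess_loop j s)"
  using assms
proof (induction j arbitrary: s)
  case 0
  have e: "nmem s v = nmem s0 v" "rmem s v = rmem s0 v" if "v \<in> inputs" for v
    using 0(1) that by (auto simp: In_def)
  have "ready s"
    unfolding ready_def using 0 In_simps(1-3)[OF 0(1)]
    by (simp add: dst_def lbd_def fun_eq_iff e inputs_def)
  then show ?case using trial_correct 0 by simp
next
  case (Suc j)
  let ?b = "383/100 * sum rs Xs"
  let ?B = "(\<lambda>s. nset ''gz'' j (na ''z'' s 0) s) ;; guess_loop j"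
  let ?C = "(\<lambda>s. nset ''gx'' j (na ''x'' s 0) s) ;; forv ''z'' nQ ?B"
  define hi where "hi t \<longleftrightarrow> (\<forall>i. Suc j \<le> i \<longrightarrow> i < 10 \<longrightarrow> na ''gx'' t i = gxs i \<and> na ''gz'' t i = gzs i)" for t
  have kB: "keeps ?B" by (intro keeps_sequence keeps_set keeps_guess_loop) (auto simp: inputs_def)
  have kz: "keeps (\<lambda>s. nset ''z'' 0 n s)" and kx: "keeps (\<lambda>s. nset ''x'' 0 n s)" and kg: "keeps (\<lambda>s. nset ''gx'' j n s)"
    and kgz: "keeps (\<lambda>s. nset ''gz'' j n s)" for n
    by (rule keeps_set(1), simp add: inputs_def)+
  have kC: "keeps ?C"
    by (intro keeps_sequence keeps_forv keeps_set kB) (auto simp: inputs_def)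
  have hB: "hi (?B (nset ''z'' 0 n t)) \<and> na ''gx'' (?B (nset ''z'' 0 n t)) j = na ''gx'' t j" if "hi t" for n t
    using that guess_loop_frame[of j _ "nset ''gz'' j n (nset ''z'' 0 n t)"] by (auto simp: hi_def sequence_def)
  have inner: "hi (forv ''z'' nQ ?B t)" if "hi t" for t
    by (rule forv_induct[where Inv = "\<lambda>_. hi"]) (use that hB in auto)
  have hC: "hi (?C (nset ''x'' 0 n t))" if "hi t" for n t
  proof -
    have "hi (nset ''gx'' j n (nset ''x'' 0 n t))" using that by (simp add: hi_def)
    then show ?thesis using inner by (simp add: sequence_def)
  qed
  have zloop: "solved ?b (forv ''z'' nQ ?B t)" if t: "In t" "Ok t" "hi t" "na ''gx'' t j = gxs j" for t
  proof -
    define Inv where "Inv n t \<longleftrightarrow> In t \<and> Ok t \<and> hi t \<and> na ''gx'' t j = gxs j \<and> (gzs j < n \<longrightarrow> solved ?b t)" for n t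
    have "Inv (nQ t) (forv ''z'' nQ ?B t)"
    proof (rule forv_induct)
      show "Inv 0 t" using t by (simp add: Inv_def)
      fix n u assume u: "Inv n u"
      let ?u = "nset ''z'' 0 n u"
      have I: "In u" "Ok u" "hi u" "na ''gx'' u j = gxs j" "gzs j < n \<Longrightarrow> solved ?b u" using u unfolding Inv_def by blast+
      have I': "In ?u" "Ok ?u" "gzs j < n \<Longrightarrow> solved ?b ?u" using kz[of n] I(1,2,5) unfolding keeps_def by blast+
      have kk: "In (?B ?u)" "Ok (?B ?u)" "gzs j < n \<Longrightarrow> solved ?b (?B ?u)" using kB I' unfolding keeps_def by blast+
      have "solved ?b (?B ?u)" if "n = gzs j"
      proof -
        let ?v = "nset ''gz'' j n ?u"
        have v: "In ?v" "Ok ?v" using kgz[of n] I' unfolding keeps_def by blast+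
        have "na ''gx'' ?v i = gxs i \<and> na ''gz'' ?v i = gzs i" if "j \<le> i" "i < 10" for i
          using I(3,4) \<open>n = gzs j\<close> that by (cases "i = j") (auto simp: hi_def)
        then have "solved ?b (guess_loop j ?v)" using Suc.IH[OF v] Suc.prems(3) by simp
        then show ?thesis by (simp add: sequence_def)
      qed
      then show "Inv (Suc n) (?B ?u)" using kk hB[OF I(3), of n] I(4) unfolding Inv_def by (auto simp: less_Suc_eq)
    qed
    moreover have "gzs j < nQ t" using In_simps(2)[OF t(1)] zs(3)[OF gxs_in] by (simp add: gzs_def)
    ultimately show ?thesis unfolding Inv_def by blast
  qed
  define Inv where "Inv n t \<longleftrightarrow> In t \<and> Ok t \<and> hi t \<and> (gxs j < n \<longrightarrow> solved ?b t)" for n t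
  have "Inv (nP s) (forv ''x'' nP ?C s)"
  proof (rule forv_induct)
    show "Inv 0 s" using Suc.prems by (simp add: Inv_def hi_def)
    fix n u assume u: "Inv n u"
    let ?u = "nset ''x'' 0 n u"
    have I: "In u" "Ok u" "hi u" "gxs j < n \<Longrightarrow> solved ?b u" using u unfolding Inv_def by blast+
    have I': "In ?u" "Ok ?u" "gxs j < n \<Longrightarrow> solved ?b ?u" using kx[of n] I(1,2,4) unfolding keeps_def by blast+
    have kk: "In (?C ?u)" "Ok (?C ?u)" "gxs j < n \<Longrightarrow> solved ?b (?C ?u)" using kC I' unfolding keeps_def by blast+
    have "solved ?b (?C ?u)" if "n = gxs j"
    proof -
      let ?v = "nset ''gx'' j n ?u"
      have v: "In ?v" "Ok ?v" using kg[of n] I' unfolding keeps_def by blast+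
      moreover have "hi ?v" using I(3) by (simp add: hi_def)
      ultimately have "solved ?b (forv ''z'' nQ ?B ?v)" using zloop that by simp
      then show ?thesis by (simp add: sequence_def)
    qed
    then show "Inv (Suc n) (?C ?u)" using kk hC[OF I(3), of n] unfolding Inv_def by (auto simp: less_Suc_eq)
  qed
  moreover have "gxs j < nP s" using In_simps(1)[OF Suc.prems(1)] gxs_in by (simp add: Xs_def)
  ultimately show ?case unfolding Inv_def by simp
qed

lemma guess_loop_solves:
  assumes "Ok s0"
  shows "solved (383/100 * cost D c Sol \<sigma>) (guess_loop 10 s0)"
proof -
  have "solved (383/100 * sum rs Xs) (guess_loop 10 s0)"
    using guess_loop_correct[OF In_s0 assms] by simp
  then show ?thesis by (rule solved_mono) (use cost_ge in simp)
qed

end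

(* The O-constants C1, C2 are absolute. The base "max 2 n" and the exponent "max 1 (1/eps)" only
   matter for n < 2 and eps > 1, where n powr (C2 / eps) would leave no time to read the input. *)
theorem mainTheorem2:
  "\<exists>(P::com) (C1::real) (C2::real). \<forall>\<epsilon>::real. \<epsilon> > 0 \<longrightarrow>
     (\<forall>(F::nat set) (D::nat set) (c::nat \<Rightarrow> nat \<Rightarrow> real) (L::nat \<Rightarrow> nat) (k::nat).
        lbmsr_instance F D c L k \<and> (\<exists>S \<sigma>. feasible F D L k S \<sigma>) \<longrightarrow>
        (\<exists>t s. exec P (input_state \<epsilon> F D c L k) t s \<and>
           feasible F D L k (output_S s) (output_sigma s) \<and>
           cost D c (output_S s) (output_sigma s) \<le> (3.83 + C1 * \<epsilon>) * opt_cost F D c L k \<and>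
           real t \<le> max 2 (real (card F + card D)) powr (C2 * max 1 (1 / \<epsilon>))))"
proof -
  obtain P b where P: "\<And>s. \<exists>t s'. exec P s t s' \<and> t \<le> size_of s ^ b \<and>
      (\<forall>v. v \<noteq> ''#'' \<longrightarrow> nmem s' v = nmem (guess_loop 10 s) v)"
    using stm_program[OF stm_guess_loop[of 10]] by blast
  show ?thesis
  \<comment> \<open>The ratio is 3.83 for every accuracy, so C1 is 0. The exponent is doubled to
    absorb the summand 2 of \<open>size_of\<close> into the base.\<close>
  proof (rule exI[of _ P], rule exI[of _ 0], rule exI[of _ "real (2 * b)"], intro allI impI, elim conjE)
    fix \<epsilon> :: real and F D :: "nat set" and c :: "nat \<Rightarrow> nat \<Rightarrow> real" and L :: "nat \<Rightarrow> nat" and k :: nat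
    assume eps: "\<epsilon> > 0" and inst: "lbmsr_instance F D c L k" and feas: "\<exists>S \<sigma>. feasible F D L k S \<sigma>"
    let ?s0 = "input_state \<epsilon> F D c L k"
    let ?s1 = "guess_loop 10 ?s0"
    obtain t s where ts: "exec P ?s0 t s" "t \<le> size_of ?s0 ^ b" "\<And>v. v \<noteq> ''#'' \<Longrightarrow> nmem s v = nmem ?s1 v"
      using P[of ?s0] by blast
    interpret names: instance_names F D c L k ?s0 \<epsilon> by unfold_locales (use inst in auto)
    have out: "output_S s = output_S ?s1" "output_sigma s = output_sigma ?s1"
      by (simp_all add: output_S_def output_sigma_def fun_eq_iff ts(3))
    have In0: "names.In ?s0" by (simp add: names.In_def)
    have "na ''found'' ?s0 0 = 0" "output_S ?s0 = {}"
      by (simp_all add: output_S_def input_state_def input_nmem_def)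
    then have Ok0: "names.Ok ?s0" by (simp add: names.Ok_def)
    have Ok1: "names.Ok ?s1" using names.keeps_guess_loop[of 10] In0 Ok0 by (simp add: names.keeps_def)
    have each: "feasible F D L k (output_S ?s1) (output_sigma ?s1) \<and>
        cost D c (output_S ?s1) (output_sigma ?s1) \<le> 383/100 * cost D c S \<sigma>"
      if S: "feasible F D L k S \<sigma>" for S \<sigma>
    \<comment> \<open>Without clients there is no ball to guess and nothing need be recorded. The
      empty output is then feasible, and every cost is 0.\<close>
    proof (cases "D = {}")
      case True
      then have "cost D c X \<tau> = 0" for X \<tau> by (simp add: cost_def radius_def cluster_def)
      moreover have "feasible F D L k (output_S ?s1) (output_sigma ?s1)"
      proof (cases "na ''found'' ?s1 0 = 0")
        case found: True
        then have "output_S ?s1 = {}" using Ok1 unfolding names.Ok_def by blast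
        then show ?thesis using True by (simp add: feasible_def)
      qed (use Ok1 in \<open>unfold names.Ok_def, blast\<close>)
      ultimately show ?thesis by simp
    next
      case False
      interpret sol: solution F D c L k ?s0 \<epsilon> S \<sigma> by unfold_locales (use S False in auto)
      have "names.solved (383/100 * cost D c S \<sigma>) ?s1" using sol.guess_loop_solves[OF Ok0] .
      then show ?thesis using Ok1 unfolding names.Ok_def names.solved_def by force
    qed
    let ?out = "cost D c (output_S s) (output_sigma s)"
    \<comment> \<open>Dividing by the ratio gives a lower bound for every feasible cost, so that no
      minimiser has to be exhibited.\<close>
    have "?out / (383/100) \<le> opt_cost F D c L k"
      unfolding opt_cost_def
    proof (rule cInf_greatest)
      show "{cost D c S \<sigma> |S \<sigma>. feasible F D L k S \<sigma>} \<noteq> {}" using feas by blast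
      fix x assume "x \<in> {cost D c S \<sigma> |S \<sigma>. feasible F D L k S \<sigma>}"
      then obtain S \<sigma> where "feasible F D L k S \<sigma>" "x = cost D c S \<sigma>" by blast
      then show "?out / (383/100) \<le> x" using each[of S \<sigma>] out by simp
    qed
    then have cost: "?out \<le> (3.83 + 0 * \<epsilon>) * opt_cost F D c L k" by simp
    let ?N = "max 2 (real (card F + card D))"
    have "real (size_of ?s0) = real (card F + card D) + 2"
      by (simp add: size_of_def input_state_def input_nmem_def)
    moreover have "2 \<le> ?N" "real (card F + card D) \<le> ?N" by simp_all
    moreover have "z \<le> 2 * N" if "z = m + 2" "2 \<le> N" "m \<le> N" for z m N :: real using that by simp
    ultimately have "real (size_of ?s0) \<le> 2 * ?N" by blast
    also have "\<dots> \<le> ?N * ?N" by (intro mult_right_mono) auto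
    finally have size: "real (size_of ?s0) \<le> ?N ^ 2" by (simp add: power2_eq_square)
    have "real t \<le> real (size_of ?s0) ^ b" using ts(2) by (metis of_nat_le_iff of_nat_power)
    also have "\<dots> \<le> (?N ^ 2) ^ b" using size by (intro power_mono) auto
    also have "\<dots> = ?N ^ (2 * b)" by (simp add: power_mult)
    also have "\<dots> = ?N powr real (2 * b)" by (rule powr_realpow[symmetric]) auto
    also have "\<dots> \<le> ?N powr (real (2 * b) * max 1 (1 / \<epsilon>))"
    proof (rule powr_mono)
      have "real (2 * b) * 1 \<le> real (2 * b) * max 1 (1 / \<epsilon>)" by (intro mult_left_mono) auto
      then show "real (2 * b) \<le> real (2 * b) * max 1 (1 / \<epsilon>)" by simp
    qed auto
    finally have time: "real t \<le> ?N powr (real (2 * b) * max 1 (1 / \<epsilon>))" .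
    obtain S \<sigma> where "feasible F D L k S \<sigma>" using feas by blast
    then have "feasible F D L k (output_S s) (output_sigma s)" using each out by simp
    then show "\<exists>t s. exec P ?s0 t s \<and> feasible F D L k (output_S s) (output_sigma s) \<and>
        cost D c (output_S s) (output_sigma s) \<le> (3.83 + 0 * \<epsilon>) * opt_cost F D c L k \<and>
        real t \<le> ?N powr (real (2 * b) * max 1 (1 / \<epsilon>))"
      using ts(1) cost time by blast
  qed
qed

end
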